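(* Fix $d\geq 2$. Let $F=I_d(h)$, $h\in\mathfrak{H}^{\odot d}$, be an element of the $d$th Gaussian Wiener chaos $C_d$ such that $E(F^2)=1$, let $Z\sim\mathscr{N}(0,1)$, and write $$T_1(F) := \sqrt{d^{2}\sum_{r=1}^{d-1}(r-1)!^{2}\binom{d-1}{r-1}^{4}(2d-2r)!\,\Vert h\,\widetilde{\otimes}_{r}\,h\Vert_{\mathfrak{H}^{\otimes 2(d-r)}}^{2}},\qquad T_2(F) := \sqrt{\frac{d-1}{3d}\,|E(F^4)-3|}.$$ Then $T_1(F)\leq T_2(F)$. Moreover, $d_{\mathrm{TV}}(F,Z)\leq 2T_1(F)$ and $d_{\mathrm{W}}(F,Z)\leq T_1(F)$. Finally, let $\varphi:\mathbb{R}\rightarrow\mathbb{R}$ be a thrice differentiable function such that $\|\varphi'''\|_{\infty}<\infty$. Then $$|E[\varphi(F)]-E[\varphi(Z)]|\leq C_{*}\times T_1(F),$$ with $$C_{*}=4\sqrt{2}\,\bigl(1+5^{3d/2}\bigr)\times\max\left\{\frac32|\varphi''(0)|+\frac{\Vert\varphi'''\Vert_{\infty}}{3}\frac{2\sqrt{2}}{\sqrt{\pi}}\,;\;2|\varphi'(0)|+\frac13\Vert\varphi'''\Vert_{\infty}\right\}.$$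
   Context: $\mathbf{G}=\{G_i:i\geq1\}$ is a sequence of i.i.d. $\mathscr{N}(0,1)$ random variables. $\mathfrak{H}$ is a real separable Hilbert space with orthonormal basis $\{e_j:j\geq1\}$; $\mathfrak{H}^{\otimes d}$ and $\mathfrak{H}^{\odot d}$ are its $d$th tensor power and symmetric tensor power. Hermite polynomials: $H_0=1$, $H_q=\delta^q \mathbf 1$ with $\delta f(x)=xf(x)-f'(x)$ (so $H_1(x)=x$, $H_2(x)=x^2-1$, etc.). A multi-index is $q=\{q_i:i\geq1\}$, nonnegative integers with finitely many nonzero; $|q|=\sum_i q_i$. The $d$th Wiener chaos $C_d$ ($d\ge 1$) is the $L^2(P)$-closed linear span of $\Phi(q)=\prod_{i\geq1}H_{q_i}(G_i)$, $|q|=d$. For $|q|=d$, let $\tilde e(q)\in\mathfrak{H}^{\odot d}$ be the symmetrization of $e_{i_1}^{\otimes q_{i_1}}\otimes\cdots\otimes e_{i_k}^{\otimes q_{i_k}}$, where $q_{i_1},\ldots,q_{i_k}$ are the nonzero entries of $q$. For $h=\sum_{|q|=d}c_q\tilde e(q)\in\mathfrak{H}^{\odot d}$, $I_d(h)=\sum_{|q|=d}c_q\Phi(q)$; $I_d$ maps $\mathfrak{H}^{\odot d}$ onto $C_d$ and $E[I_d(h)I_d(h')]=d!\langle h,h'\rangle_{\mathfrak{H}^{\otimes d}}$. For $f,g\in\mathfrak{H}^{\odot d}$ and $r=0,\ldots,d$, the contraction is $f\otimes_r g=\sum_{i_1,\ldots,i_r\geq1}\langle f,e_{i_1}\otimes\cdots\otimes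 e_{i_r}\rangle_{\mathfrak{H}^{\otimes r}}\otimes\langle g,e_{i_1}\otimes\cdots\otimes e_{i_r}\rangle_{\mathfrak{H}^{\otimes r}}\in\mathfrak{H}^{\otimes(2d-2r)}$, and $f\,\widetilde\otimes_r\,g$ is its canonical symmetrization. $d_{\mathrm{TV}}(F,G)=\sup|P(F\in A)-P(G\in A)|$ over Borel $A\subset\mathbb{R}$; $d_{\mathrm{W}}(F,G)=\sup|E[h(F)]-E[h(G)]|$ over Lipschitz $h$ with Lipschitz constant at most $1$. $\|\cdot\|_\infty$ is the supremum norm. *)

theory Defs
  imports
    "HOL-Probability.Probability"
    "HOL-Combinatorics.Permutations"
    "HOL-Computational_Algebra.Polynomial"
begin

section \<open>Tensor powers of a Hilbert space\<close>

definition orthonormal_basis :: "(nat \<Rightarrow> 'h::real_inner) \<Rightarrow> bool" where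
  "orthonormal_basis e \<longleftrightarrow>
     (\<forall>i j. inner (e i) (e j) = (if i = j then 1 else 0)) \<and> closure (span (range e)) = UNIV"

text \<open>
  The Hilbert space tensor power of order n is modelled, as usual, by the bounded n-linear forms
  f on H that are Hilbert-Schmidt: the tensor t corresponds to the form sending
  \<open>[x\<^sub>1, \<dots>, x\<^sub>n]\<close> to the inner product of t with the product of the \<open>x\<^sub>k\<close>. Arguments are passed
  as a list of length n, and forms are extended by 0 to lists of any other length, so that equality
  of tensors is equality of functions. The sums of (products of) values on basis vectors do not
  depend on the orthonormal basis e.
\<close>

type_synonym 'h form = "'h list \<Rightarrow> real"

definition tensor_power :: "(nat \<Rightarrow> 'h::real_inner) \<Rightarrow> nat \<Rightarrow> 'h form set" where
  "tensor_power e n = {f.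
     (\<forall>xs ys. length xs + length ys + 1 = n \<longrightarrow> linear (\<lambda>v. f (xs @ v # ys))) \<and>
     (\<exists>C. \<forall>xs. length xs = n \<longrightarrow> \<bar>f xs\<bar> \<le> C * prod_list (map norm xs)) \<and>
     (\<lambda>is. (f (map e is))\<^sup>2) summable_on {is. length is = n} \<and>
     (\<forall>xs. length xs \<noteq> n \<longrightarrow> f xs = 0)}"

definition tensor_inner :: "(nat \<Rightarrow> 'h::real_inner) \<Rightarrow> nat \<Rightarrow> 'h form \<Rightarrow> 'h form \<Rightarrow> real" where
  "tensor_inner e n f g = (\<Sum>\<^sub>\<infinity>is\<in>{is. length is = n}. f (map e is) * g (map e is))"

definition tensor_norm :: "(nat \<Rightarrow> 'h::real_inner) \<Rightarrow> nat \<Rightarrow> 'h form \<Rightarrow> real" where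
  "tensor_norm e n f = sqrt (tensor_inner e n f f)"

definition elementary_tensor :: "'h::real_inner list \<Rightarrow> 'h form" where
  "elementary_tensor vs =
     (\<lambda>xs. if length xs = length vs then \<Prod>k<length vs. inner (vs ! k) (xs ! k) else 0)"

definition symmetrization :: "nat \<Rightarrow> 'h form \<Rightarrow> 'h form" where
  "symmetrization n f =
     (\<lambda>xs. if length xs = n
           then (\<Sum>\<pi> | \<pi> permutes {..<n}. f (permute_list \<pi> xs)) / fact n else 0)"

definition sym_tensor_power :: "(nat \<Rightarrow> 'h::real_inner) \<Rightarrow> nat \<Rightarrow> 'h form set" where
  "sym_tensor_power e n = {f \<in> tensor_power e n.
     \<forall>\<pi> xs. \<pi> permutes {..<n} \<longrightarrow> length xs = n \<longrightarrow> f (permute_list \<pi> xs) = f xs}"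

text \<open>
  Contraction of two tensors of order d. In the form model, the partial inner product of f with
  the product of \<open>e\<^sub>i\<close> for i in the list is, in the first r slots, is the form
  \<open>ys \<mapsto> f (map e is @ ys)\<close>, and the tensor product of two forms of order d - r multiplies their
  values on the first and the last d - r arguments.
\<close>

definition contraction ::
    "(nat \<Rightarrow> 'h::real_inner) \<Rightarrow> nat \<Rightarrow> nat \<Rightarrow> 'h form \<Rightarrow> 'h form \<Rightarrow> 'h form" where
  "contraction e d r f g =
     (\<lambda>xs. if length xs = 2 * d - 2 * r
           then \<Sum>\<^sub>\<infinity>is\<in>{is. length is = r}.
                  f (map e is @ take (d - r) xs) * g (map e is @ drop (d - r) xs)
           else 0)"

definition sym_contraction ::
    "(nat \<Rightarrow> 'h::real_inner) \<Rightarrow> nat \<Rightarrow> nat \<Rightarrow> 'h form \<Rightarrow> 'h form \<Rightarrow> 'h form" where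
  "sym_contraction e d r f g = symmetrization (2 * d - 2 * r) (contraction e d r f g)"


section \<open>Hermite polynomials and the Wiener chaos\<close>

definition hermite :: "nat \<Rightarrow> real poly" where
  "hermite q = ((\<lambda>p. [:0, 1:] * p - pderiv p) ^^ q) 1"

lemma hermite_1: "hermite 1 = [:0, 1:]"
  by (simp add: hermite_def)

lemma hermite_2: "hermite 2 = [:-1, 0, 1:]"
  by (simp add: hermite_def numeral_2_eq_2 pderiv_pCons one_pCons)

definition multi_indices :: "nat \<Rightarrow> (nat \<Rightarrow> nat) set" where
  "multi_indices d = {q. finite {i. q i \<noteq> 0} \<and> (\<Sum>i | q i \<noteq> 0. q i) = d}"

definition hermite_product :: "(nat \<Rightarrow> 'a \<Rightarrow> real) \<Rightarrow> (nat \<Rightarrow> nat) \<Rightarrow> 'a \<Rightarrow> real" where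
  "hermite_product G q \<omega> = (\<Prod>i | q i \<noteq> 0. poly (hermite (q i)) (G i \<omega>))"

definition sym_basis_tensor ::
    "(nat \<Rightarrow> 'h::real_inner) \<Rightarrow> nat \<Rightarrow> (nat \<Rightarrow> nat) \<Rightarrow> 'h form" where
  "sym_basis_tensor e d q = symmetrization d (elementary_tensor
     (concat (map (\<lambda>i. replicate (q i) (e i)) (sorted_list_of_set {i. q i \<noteq> 0}))))"

text \<open>
  F is a version of the multiple integral of order d of h: for the coefficients c of an expansion
  of h in the symmetrized basis tensors, F is the L2 sum of the corresponding Hermite products.
  Both sums are unconditional, i.e. limits along the finite subsets of the index set.
\<close>

definition is_multiple_integral ::
    "'a measure \<Rightarrow> (nat \<Rightarrow> 'a \<Rightarrow> real) \<Rightarrow> (nat \<Rightarrow> 'h::real_inner) \<Rightarrow> nat \<Rightarrow> 'h form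
      \<Rightarrow> ('a \<Rightarrow> real) \<Rightarrow> bool" where
  "is_multiple_integral M G e d h F \<longleftrightarrow>
     F \<in> borel_measurable M \<and> integrable M (\<lambda>\<omega>. (F \<omega>)\<^sup>2) \<and>
     (\<exists>c :: (nat \<Rightarrow> nat) \<Rightarrow> real.
        ((\<lambda>A. tensor_norm e d (\<lambda>xs. h xs - (\<Sum>q\<in>A. c q * sym_basis_tensor e d q xs)))
           \<longlongrightarrow> 0) (finite_subsets_at_top (multi_indices d)) \<and>
        ((\<lambda>A. \<integral>\<omega>. (F \<omega> - (\<Sum>q\<in>A. c q * hermite_product G q \<omega>))\<^sup>2 \<partial>M)
           \<longlongrightarrow> 0) (finite_subsets_at_top (multi_indices d)))"


section \<open>Distances between laws\<close>

definition tv_distance :: "'a measure \<Rightarrow> ('a \<Rightarrow> real) \<Rightarrow> 'b measure \<Rightarrow> ('b \<Rightarrow> real) \<Rightarrow> real" where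
  "tv_distance M X N Y =
     (SUP A\<in>sets (borel :: real measure).
        \<bar>measure M (X -` A \<inter> space M) - measure N (Y -` A \<inter> space N)\<bar>)"

text \<open>Extended real valued, so that the supremum is meaningful without a boundedness argument.\<close>

definition wasserstein_distance ::
    "'a measure \<Rightarrow> ('a \<Rightarrow> real) \<Rightarrow> 'b measure \<Rightarrow> ('b \<Rightarrow> real) \<Rightarrow> ereal" where
  "wasserstein_distance M X N Y =
     (SUP g\<in>{g :: real \<Rightarrow> real. 1-lipschitz_on UNIV g}.
        ereal \<bar>(\<integral>\<omega>. g (X \<omega>) \<partial>M) - (\<integral>\<omega>. g (Y \<omega>) \<partial>N)\<bar>)"


section \<open>The two functionals of a chaos element\<close>

definition T1 :: "(nat \<Rightarrow> 'h::real_inner) \<Rightarrow> nat \<Rightarrow> 'h form \<Rightarrow> real" where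
  "T1 e d h = sqrt ((real d)\<^sup>2 *
     (\<Sum>r=1..d-1. (fact (r - 1))\<^sup>2 * real ((d - 1) choose (r - 1)) ^ 4 * fact (2 * d - 2 * r) *
        (tensor_norm e (2 * (d - r)) (sym_contraction e d r h h))\<^sup>2))"

definition T2 :: "'a measure \<Rightarrow> nat \<Rightarrow> ('a \<Rightarrow> real) \<Rightarrow> real" where
  "T2 M d F = sqrt ((real d - 1) / (3 * real d) * \<bar>(\<integral>\<omega>. (F \<omega>) ^ 4 \<partial>M) - 3\<bar>)"

end

theory Submission
  imports Defs "HOL-Real_Asymp.Real_Asymp"
begin

text \<open>
  The law of F is compared with the normal law by Stein's method. For a test function g let f solve
  \<open>f'(x) - x f(x) = g(x) - E g(Z)\<close>, and let \<open>\<Gamma>\<close> be the squared norm of the gradient of F divided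
  by d. Gaussian integration by parts gives \<open>E (F f(F)) = E (f'(F) \<Gamma>)\<close>, hence
  \<open>E g(F) - E g(Z) = E (f'(F) (1 - \<Gamma>))\<close>. As \<open>E \<Gamma> = E F\<^sup>2 = 1\<close>, the Cauchy-Schwarz inequality bounds
  this by the L2 norm of f'(F) times the standard deviation of \<open>\<Gamma>\<close>, and this standard deviation is
  exactly T1(F).

  The identification with T1 rests on the product formula \<open>chaos_product\<close>. It expands \<open>\<Gamma>\<close> and
  \<open>F\<^sup>2\<close> into the multiple integrals of the contractions of the kernel with itself, which lie in
  chaoses of different orders and are therefore orthogonal (\<open>carre_expansion\<close>, \<open>carre_variance\<close>).
  The coefficients of the contraction of length r in the two expansions differ by the factor r / d,
  so the identity \<open>E F ^ 4 = 3 E (F\<^sup>2 \<Gamma>)\<close> writes the fourth cumulant as a sum of the terms of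
  T1 squared, weighted by 3 d / r with r at most d - 1. This is the inequality between T1 and T2
  (\<open>fourth_cumulant_bound\<close>). All operators are concrete: a multiple integral is a sum of
  iterated creation operators \<open>u \<mapsto> x\<^sub>i u - \<partial>\<^sub>i u\<close> applied to 1.

  The test functions enter through bounds for f'. It is at most 2 if g - E g(Z) is bounded by 1
  (\<open>stein_deriv_bound_bounded\<close>), at most 1 if g is 1-Lipschitz, and of linear growth if g has a
  bounded third derivative (\<open>stein_deriv_bound\<close>). In the last case the normalization of F controls
  the L2 norm of f'(F), with a constant that is far below the one claimed.
  The total variation distance is reached from Lipschitz functions by inner regularity
  (\<open>setwise_bound_from_lipschitz\<close>).

  The argument is carried out for kernels with finitely many coordinates, where F is a polynomial in
  finitely many Gaussian variables. A general F is the limit in L2 of such elements. The formula for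
  the fourth moment also yields \<open>E F ^ 4 \<le> C (E F\<^sup>2)\<^sup>2\<close> with C depending on d only
  (\<open>hypercontractivity\<close>), so that convergence in L2 implies convergence in L4
  (\<open>fourth_moment_remainder\<close>), and T1 is continuous in the kernel because contractions are bounded
  bilinear maps (\<open>l2_arr_contraction\<close>).
\<close>

section \<open>Gaussian polynomials with creation and annihilation operators\<close>

text \<open>Polynomial chaos elements are handled as plain functions of a sequence of reals, of which only the
  first n coordinates matter; the derivative in one coordinate is then an ordinary derivative.\<close>

definition pd :: "nat \<Rightarrow> ((nat \<Rightarrow> real) \<Rightarrow> real) \<Rightarrow> (nat \<Rightarrow> real) \<Rightarrow> real" where
  "pd i u x = deriv (\<lambda>t. u (x(i := t))) (x i)"

text \<open>The adjoint of the partial derivative under the standard Gaussian law. In one variable its powers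
  applied to 1 are the Hermite polynomials.\<close>

definition creation :: "nat \<Rightarrow> ((nat \<Rightarrow> real) \<Rightarrow> real) \<Rightarrow> (nat \<Rightarrow> real) \<Rightarrow> real" where
  "creation i u x = x i * u x - pd i u x"

text \<open>This class is stable under both operators, its partial derivatives can be computed by structural
  induction, and all its members have Gaussian moments of every order.\<close>

inductive_set polys :: "nat \<Rightarrow> ((nat \<Rightarrow> real) \<Rightarrow> real) set" for n where
  const: "(\<lambda>_. c) \<in> polys n"
| coord: "i < n \<Longrightarrow> (\<lambda>x. x i) \<in> polys n"
| add: "u \<in> polys n \<Longrightarrow> v \<in> polys n \<Longrightarrow> (\<lambda>x. u x + v x) \<in> polys n"
| mult: "u \<in> polys n \<Longrightarrow> v \<in> polys n \<Longrightarrow> (\<lambda>x. u x * v x) \<in> polys n"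

lemma polys_cmult: "u \<in> polys n \<Longrightarrow> (\<lambda>x. c * u x) \<in> polys n"
  by (intro polys.mult polys.const)

lemma polys_diff: "u \<in> polys n \<Longrightarrow> v \<in> polys n \<Longrightarrow> (\<lambda>x. u x - v x) \<in> polys n"
  using polys.add[of u n "\<lambda>x. (-1) * v x"] polys_cmult[of v n "-1"] by simp

lemma polys_sum: "(\<And>k. k \<in> K \<Longrightarrow> u k \<in> polys n) \<Longrightarrow> (\<lambda>x. \<Sum>k\<in>K. u k x) \<in> polys n"
  by (induction K rule: infinite_finite_induct) (auto intro: polys.intros)

lemma polys_power: "u \<in> polys n \<Longrightarrow> (\<lambda>x. u x ^ k) \<in> polys n"
  by (induction k) (auto intro: polys.intros)

lemma polys_has_partial_derivative:
  assumes "u \<in> polys n"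
  shows "\<exists>u'\<in>polys n. \<forall>x t. ((\<lambda>t. u (x(i := t))) has_real_derivative u' (x(i := t))) (at t)"
  using assms
proof induction
  case (const c)
  show ?case by (rule bexI[of _ "\<lambda>_. 0"]) (auto intro: polys.const)
next
  case (coord j)
  show ?case
    by (rule bexI[of _ "\<lambda>_. if i = j then 1 else 0"]) (auto intro: polys.const)
next
  case (add u v)
  then obtain u' v' where *: "u' \<in> polys n" "v' \<in> polys n"
    "\<And>x t. ((\<lambda>t. u (x(i := t))) has_real_derivative u' (x(i := t))) (at t)"
    "\<And>x t. ((\<lambda>t. v (x(i := t))) has_real_derivative v' (x(i := t))) (at t)"
    by blast
  show ?case
    by (rule bexI[of _ "\<lambda>x. u' x + v' x"], intro allI DERIV_add *, intro polys.add *)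
next
  case (mult u v)
  then obtain u' v' where *: "u' \<in> polys n" "v' \<in> polys n"
    "\<And>x t. ((\<lambda>t. u (x(i := t))) has_real_derivative u' (x(i := t))) (at t)"
    "\<And>x t. ((\<lambda>t. v (x(i := t))) has_real_derivative v' (x(i := t))) (at t)"
    by blast
  show ?case
    by (rule bexI[of _ "\<lambda>x. u x * v' x + u' x * v x"], intro allI DERIV_mult' *,
        intro polys.add polys.mult * mult.hyps)
qed

lemma pd_eqI:
  assumes "\<And>x t. ((\<lambda>t. u (x(i := t))) has_real_derivative u' (x(i := t))) (at t)"
  shows "pd i u = u'"
proof
  fix x
  show "pd i u x = u' x"
    unfolding pd_def using assms[of x "x i"] by (intro DERIV_imp_deriv) simp
qed

lemma has_pd:
  assumes "u \<in> polys n"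
  shows "((\<lambda>t. u (x(i := t))) has_real_derivative pd i u (x(i := t))) (at t)"
  using polys_has_partial_derivative[OF assms, of i] pd_eqI[of u i] by metis

lemma pd_polys: "u \<in> polys n \<Longrightarrow> pd i u \<in> polys n"
  using polys_has_partial_derivative[of u n i] pd_eqI[of u i] by metis

lemma creation_polys: "u \<in> polys n \<Longrightarrow> i < n \<Longrightarrow> creation i u \<in> polys n"
  using polys_diff[of "\<lambda>x. x i * u x" n "pd i u"] pd_polys[of u n i]
  by (simp add: creation_def[abs_def] polys.intros)

lemma pd_const: "pd i (\<lambda>_. c) = (\<lambda>_. 0)"
  by (rule pd_eqI) auto

lemma pd_coord: "pd i (\<lambda>x. x j) = (\<lambda>_. if i = j then 1 else 0)"
  by (rule pd_eqI) auto

lemma pd_add: "u \<in> polys n \<Longrightarrow> v \<in> polys n \<Longrightarrow> pd i (\<lambda>x. u x + v x) = (\<lambda>x. pd i u x + pd i v x)"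
  by (rule pd_eqI) (auto intro!: derivative_eq_intros has_pd)

lemma pd_mult: "u \<in> polys n \<Longrightarrow> v \<in> polys n \<Longrightarrow>
    pd i (\<lambda>x. u x * v x) = (\<lambda>x. u x * pd i v x + pd i u x * v x)"
  by (rule pd_eqI) (auto intro!: DERIV_mult'[THEN DERIV_cong] has_pd)

lemma pd_cmult: "u \<in> polys n \<Longrightarrow> pd i (\<lambda>x. c * u x) = (\<lambda>x. c * pd i u x)"
  by (subst pd_mult[OF polys.const]) (auto simp: pd_const)

lemma pd_diff:
  assumes "u \<in> polys n" "v \<in> polys n"
  shows "pd i (\<lambda>x. u x - v x) = (\<lambda>x. pd i u x - pd i v x)"
  using pd_add[OF assms(1) polys_cmult[OF assms(2), of "-1"], of i] pd_cmult[OF assms(2), of i "-1"]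
  by simp

lemma pd_sum:
  assumes "\<And>k. k \<in> K \<Longrightarrow> u k \<in> polys n"
  shows "pd i (\<lambda>x. \<Sum>k\<in>K. u k x) = (\<lambda>x. \<Sum>k\<in>K. pd i (u k) x)"
  using assms
proof (induction K rule: infinite_finite_induct)
  case (insert k K)
  have "(\<lambda>x. \<Sum>k\<in>K. u k x) \<in> polys n" using insert by (intro polys_sum) auto
  then show ?case using insert by (simp add: pd_add[where n = n])
qed (auto simp: pd_const)

text \<open>Both orders of differentiation obey the same rules on sums and products, so induction on the
  construction of the polynomial suffices.\<close>

lemma pd_commute:
  assumes "u \<in> polys n"
  shows "pd i (pd j u) = pd j (pd i u)"
  using assms
proof induction
  case (add u v)
  then show ?case by (simp add: pd_add[where n = n] pd_polys)
next
  case (mult u v)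
  then show ?case
    by (simp add: pd_mult[where n = n] pd_add[where n = n] pd_polys polys.mult fun_eq_iff algebra_simps)
qed (auto simp: pd_const pd_coord)

lemma creation_sum:
  assumes "\<And>k. k \<in> K \<Longrightarrow> u k \<in> polys n"
  shows "creation i (\<lambda>x. \<Sum>k\<in>K. c k * u k x) x = (\<Sum>k\<in>K. c k * creation i (u k) x)"
proof -
  have "pd i (\<lambda>x. \<Sum>k\<in>K. c k * u k x) = (\<lambda>x. \<Sum>k\<in>K. c k * pd i (u k) x)"
    using assms by (subst pd_sum[where n = n]) (auto simp: polys_cmult pd_cmult[where n = n])
  then show ?thesis
    by (simp add: creation_def sum_distrib_left sum_subtractf[symmetric] algebra_simps)
qed

lemma creation_cmult:
  assumes "u \<in> polys n"
  shows "creation i (\<lambda>x. c * u x) x = c * creation i u x"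
  using creation_sum[of "{()}" "\<lambda>_. u" n i "\<lambda>_. c" x] assms by simp

lemma creation_zero: "creation i (\<lambda>_. 0) x = 0"
  by (simp add: creation_def pd_const)

text \<open>Creation fails to be linear over multiplication by v exactly by a derivative of v. This is the
  inductive step of the product formula.\<close>

lemma creation_times:
  assumes "u \<in> polys n" "v \<in> polys n"
  shows "creation i u x * v x = creation i (\<lambda>x. u x * v x) x + u x * pd i v x"
  using assms by (simp add: creation_def pd_mult[where n = n] algebra_simps)

text \<open>The canonical commutation relation.\<close>

lemma pd_creation:
  assumes "u \<in> polys n" "j < n"
  shows "pd i (creation j u) = (\<lambda>x. (if i = j then u x else 0) + creation j (pd i u) x)"
proof -
  have "pd i (creation j u) = (\<lambda>x. pd i (\<lambda>x. x j * u x) x - pd i (pd j u) x)"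
    unfolding creation_def[abs_def]
    by (rule pd_diff[where n = n]) (auto intro!: polys.intros pd_polys assms)
  also have "pd i (\<lambda>x. x j * u x) = (\<lambda>x. x j * pd i u x + (if i = j then 1 else 0) * u x)"
    by (subst pd_mult[where n = n]) (auto simp: assms polys.coord pd_coord)
  finally show ?thesis
    unfolding creation_def[of j "pd i u"] pd_commute[OF assms(1), of i j]
    by (simp add: fun_eq_iff)
qed

lemma creation_commute:
  assumes "u \<in> polys n" "i < n" "j < n"
  shows "creation i (creation j u) = creation j (creation i u)"
proof
  fix x
  have "creation i (creation j u) x = x i * (x j * u x - pd j u x)
      - ((if i = j then u x else 0) + (x j * pd i u x - pd j (pd i u) x))"
    unfolding creation_def[of i "creation j u"] pd_creation[OF assms(1,3)] by (simp add: creation_def)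
  moreover have "creation j (creation i u) x = x j * (x i * u x - pd i u x)
      - ((if j = i then u x else 0) + (x i * pd j u x - pd i (pd j u) x))"
    unfolding creation_def[of j "creation i u"] pd_creation[OF assms(1,2)] by (simp add: creation_def)
  ultimately show "creation i (creation j u) x = creation j (creation i u) x"
    using fun_cong[OF pd_commute[OF assms(1), of i j], of x]
    by (cases "i = j") (simp_all add: right_diff_distrib mult.left_commute[of "x i" "x j"])
qed

section \<open>Wick monomials and the multiple integral of an array\<close>

text \<open>Applying creation operators k times in the same coordinate gives the Hermite polynomial of degree
  k, so this is the product of Hermite polynomials in which the degree of a coordinate is its number
  of occurrences in the list.\<close>

fun wick :: "nat list \<Rightarrow> (nat \<Rightarrow> real) \<Rightarrow> real" where
  "wick [] = (\<lambda>_. 1)"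
| "wick (i # is) = creation i (wick is)"

definition ibox :: "nat \<Rightarrow> nat \<Rightarrow> nat list set" where
  "ibox n d = {is. set is \<subseteq> {..<n} \<and> length is = d}"

lemma finite_ibox [simp]: "finite (ibox n d)"
  unfolding ibox_def by (rule finite_lists_length_eq) simp

lemma ibox_0 [simp]: "ibox n 0 = {[]}"
  by (auto simp: ibox_def)

lemma ibox_Suc: "ibox n (Suc d) = (\<lambda>(i, is). i # is) ` ({..<n} \<times> ibox n d)"
  by (auto simp: ibox_def length_Suc_conv image_iff)

lemma sum_ibox_Suc: "sum f (ibox n (Suc d)) = (\<Sum>i<n. \<Sum>is\<in>ibox n d. f (i # is))"
proof -
  have "sum f (ibox n (Suc d)) = (\<Sum>(i, is)\<in>{..<n} \<times> ibox n d. f (i # is))"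
    unfolding ibox_Suc by (subst sum.reindex) (auto simp: inj_on_def case_prod_beta)
  then show ?thesis by (simp add: sum.cartesian_product)
qed

lemma wick_polys: "set is \<subseteq> {..<n} \<Longrightarrow> wick is \<in> polys n"
  by (induction "is") (auto intro: polys.const creation_polys)

lemma wick_move:
  assumes "set (xs @ i # ys) \<subseteq> {..<n}"
  shows "wick (xs @ i # ys) = wick (i # xs @ ys)"
  using assms
proof (induction xs)
  case (Cons j xs)
  then have "wick ((j # xs) @ i # ys) = creation j (creation i (wick (xs @ ys)))" by simp
  also have "\<dots> = creation i (creation j (wick (xs @ ys)))"
    using Cons.prems by (intro creation_commute[where n = n] wick_polys) auto
  finally show ?case by simp
qed simp

text \<open>Creation operators commute, so only the multiset of the indices matters. This is why a kernel may
  be replaced by its symmetrization.\<close>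

lemma wick_mset:
  assumes "mset is = mset js"
  shows "wick is = wick js"
  using assms
proof (induction "is" arbitrary: js)
  case (Cons i "is")
  then have "i \<in> set js" by (metis list.set_intros(1) mset_eq_setD)
  then obtain xs ys where js: "js = xs @ i # ys" by (meson split_list)
  with Cons.prems have "mset is = mset (xs @ ys)" by simp
  from Cons.IH[OF this] have "wick (i # is) = wick (i # xs @ ys)" by simp
  also have "\<dots> = wick js"
    unfolding js by (rule wick_move[symmetric, where n = "Suc (Max (set (xs @ i # ys)))"])
      (auto simp: less_Suc_eq_le)
  finally show ?case .
qed simp

text \<open>The multiple integral of order d of the tensor whose coordinates, with respect to the first n basis
  vectors, are given by the array a.\<close>

definition chaos :: "nat \<Rightarrow> nat \<Rightarrow> (nat list \<Rightarrow> real) \<Rightarrow> (nat \<Rightarrow> real) \<Rightarrow> real" where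
  "chaos n d a x = (\<Sum>is\<in>ibox n d. a is * wick is x)"

definition symmetric_array :: "nat \<Rightarrow> (nat list \<Rightarrow> real) \<Rightarrow> bool" where
  "symmetric_array d a \<longleftrightarrow> (\<forall>is js. length is = d \<longrightarrow> mset is = mset js \<longrightarrow> a is = a js)"

lemma symmetric_arrayD: "symmetric_array d a \<Longrightarrow> length is = d \<Longrightarrow> mset is = mset js \<Longrightarrow> a is = a js"
  unfolding symmetric_array_def by blast

lemma symmetric_array_slice: "symmetric_array (Suc d) a \<Longrightarrow> symmetric_array d (\<lambda>is. a (i # is))"
  unfolding symmetric_array_def by auto

lemma chaos_polys: "chaos n d a \<in> polys n"
  unfolding chaos_def[abs_def] by (intro polys_sum polys_cmult wick_polys) (auto simp: ibox_def)

lemma chaos_0: "chaos n 0 a = (\<lambda>_. a [])"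
  by (auto simp: chaos_def)

lemma chaos_Suc: "chaos n (Suc d) a = (\<lambda>x. \<Sum>i<n. creation i (chaos n d (\<lambda>is. a (i # is))) x)"
proof
  fix x
  have "creation i (chaos n d (\<lambda>is. a (i # is))) x = (\<Sum>is\<in>ibox n d. a (i # is) * wick (i # is) x)" for i
    unfolding chaos_def[abs_def] wick.simps
    by (rule creation_sum[where n = n]) (auto simp: ibox_def intro: wick_polys)
  then show "chaos n (Suc d) a x = (\<Sum>i<n. creation i (chaos n d (\<lambda>is. a (i # is))) x)"
    by (simp add: chaos_def sum_ibox_Suc)
qed

lemma chaos_cong: "(\<And>is. is \<in> ibox n d \<Longrightarrow> a is = b is) \<Longrightarrow> chaos n d a = chaos n d b"
  by (auto simp: chaos_def fun_eq_iff)

lemma chaos_sum: "chaos n d (\<lambda>is. \<Sum>k\<in>K. a k is) x = (\<Sum>k\<in>K. chaos n d (a k) x)"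
  unfolding chaos_def by (subst sum.swap) (simp add: sum_distrib_right)

lemma chaos_cmult: "chaos n d (\<lambda>is. c * a is) x = c * chaos n d a x"
  unfolding chaos_def by (simp add: sum_distrib_left mult.assoc)

text \<open>Moving the derivative past the outermost creation operator yields one copy of the slice at i and,
  inductively, q further copies; symmetry of the array lets the index i be moved to the front each
  time.\<close>

lemma pd_chaos:
  assumes "symmetric_array (Suc q) b" "i < n"
  shows "pd i (chaos n (Suc q) b) = (\<lambda>x. real (Suc q) * chaos n q (\<lambda>is. b (i # is)) x)"
  using assms(1)
proof (induction q arbitrary: b)
  case 0
  have "pd i (chaos n (Suc 0) b)
      = (\<lambda>x. \<Sum>j<n. pd i (creation j (chaos n 0 (\<lambda>is. b (j # is)))) x)"
    unfolding chaos_Suc by (rule pd_sum[where n = n]) (auto intro: creation_polys chaos_polys)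
  also have "\<dots> = (\<lambda>x. \<Sum>j<n. if i = j then b [j] else 0)"
    by (intro ext sum.cong refl) (simp add: pd_creation[OF chaos_polys], simp add: chaos_0 pd_const creation_zero)
  finally show ?case using assms(2) by (simp add: chaos_0)
next
  case (Suc q)
  have sl: "pd i (chaos n (Suc q) (\<lambda>is. b (j # is)))
      = (\<lambda>x. real (Suc q) * chaos n q (\<lambda>is. b (i # j # is)) x)" for j
  proof -
    have "b (j # i # is) = b (i # j # is)" if "is \<in> ibox n q" for "is"
      using that by (intro symmetric_arrayD[OF Suc.prems]) (auto simp: ibox_def)
    then have "chaos n q (\<lambda>is. b (j # i # is)) = chaos n q (\<lambda>is. b (i # j # is))"
      by (rule chaos_cong)
    with Suc.IH[OF symmetric_array_slice[OF Suc.prems], of j] show ?thesis by simp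
  qed
  have "pd i (chaos n (Suc (Suc q)) b)
      = (\<lambda>x. \<Sum>j<n. pd i (creation j (chaos n (Suc q) (\<lambda>is. b (j # is)))) x)"
    unfolding chaos_Suc[of n "Suc q"]
    by (rule pd_sum[where n = n]) (auto intro: creation_polys chaos_polys)
  also have "\<dots> = (\<lambda>x. \<Sum>j<n. (if i = j then chaos n (Suc q) (\<lambda>is. b (j # is)) x else 0)
      + real (Suc q) * creation j (chaos n q (\<lambda>is. b (i # j # is))) x)"
    by (intro ext sum.cong)
      (auto simp: pd_creation[OF chaos_polys] sl creation_cmult[OF chaos_polys] simp del: of_nat_Suc)
  also have "\<dots> = (\<lambda>x. real (Suc (Suc q)) * chaos n (Suc q) (\<lambda>is. b (i # is)) x)"
    using assms(2)
    by (simp add: sum.distrib sum_distrib_left[symmetric] chaos_Suc[of n q "\<lambda>is. b (i # is)"]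
        distrib_right fun_eq_iff)
  finally show ?case .
qed

definition box_contraction ::
    "nat \<Rightarrow> nat \<Rightarrow> nat \<Rightarrow> (nat list \<Rightarrow> real) \<Rightarrow> (nat list \<Rightarrow> real) \<Rightarrow> nat list \<Rightarrow> real" where
  "box_contraction n p r f g zs = (\<Sum>is\<in>ibox n r. f (is @ take (p - r) zs) * g (is @ drop (p - r) zs))"

text \<open>By symmetry the free index i of f may be moved behind the contracted indices.\<close>

lemma box_contraction_slice:
  assumes f: "symmetric_array (Suc p) f" and r: "r \<le> p" and zs: "length zs \<ge> p - r"
  shows "box_contraction n (Suc p) r f g (i # zs) = box_contraction n p r (\<lambda>is. f (i # is)) g zs"
  unfolding box_contraction_def
proof (rule sum.cong)
  fix "is" assume "is \<in> ibox n r"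
  then have "f (is @ i # take (p - r) zs) = f (i # is @ take (p - r) zs)"
    using r zs by (intro symmetric_arrayD[OF f]) (auto simp: ibox_def)
  then show "f (is @ take (Suc p - r) (i # zs)) * g (is @ drop (Suc p - r) (i # zs)) =
         f (i # is @ take (p - r) zs) * g (is @ drop (p - r) zs)"
    using r by (simp add: Suc_diff_le)
qed simp

lemma box_contraction_Suc:
  "box_contraction n (Suc p) (Suc r) f g zs
    = (\<Sum>i<n. box_contraction n p r (\<lambda>is. f (i # is)) (\<lambda>is. g (i # is)) zs)"
  unfolding box_contraction_def sum_ibox_Suc by simp

text \<open>Induction on p. Peeling one creation operator off the first factor leaves a term in which it acts
  on the whole product, which adds a free index, and a term in which it differentiates the second
  factor, which adds a contraction. Pascal's rule combines the two families of coefficients.\<close>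

theorem chaos_product:
  assumes "symmetric_array p f" "symmetric_array q g"
  shows "chaos n p f x * chaos n q g x = (\<Sum>r\<le>p. fact r * real (p choose r) * real (q choose r)
            * chaos n (p + q - 2 * r) (box_contraction n p r f g) x)"
  using assms
proof (induction p arbitrary: f q g x)
  case 0
  have "chaos n 0 f x * chaos n q g x = chaos n q (\<lambda>is. f [] * g is) x"
    by (simp add: chaos_0 chaos_cmult)
  then show ?case by (simp add: box_contraction_def)
next
  case (Suc p)
  note f = symmetric_array_slice[OF Suc.prems(1)]
  let ?f = "\<lambda>i is. f (i # is)" and ?g = "\<lambda>i is. g (i # is)"
  let ?B = "\<lambda>r. box_contraction n (Suc p) r f g"
  let ?A = "\<Sum>r\<le>p. fact r * real (p choose r) * real (q choose r) * chaos n (Suc p + q - 2 * r) (?B r) x"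
  let ?C = "\<Sum>r\<le>p. fact (Suc r) * real (p choose r) * real (q choose Suc r)
            * chaos n (Suc p + q - 2 * Suc r) (?B (Suc r)) x"
  have "chaos n (Suc p) f x * chaos n q g x
      = (\<Sum>i<n. creation i (chaos n p (?f i)) x * chaos n q g x)"
    by (simp add: chaos_Suc sum_distrib_right)
  also have "\<dots> = (\<Sum>i<n. creation i (\<lambda>x. chaos n p (?f i) x * chaos n q g x) x)
      + (\<Sum>i<n. chaos n p (?f i) x * pd i (chaos n q g) x)"
    by (simp add: creation_times[OF chaos_polys chaos_polys] sum.distrib)
  (* The operator acts on the whole product: by the induction hypothesis the index i becomes an
     additional free index of f. *)
  also have "(\<Sum>i<n. creation i (\<lambda>x. chaos n p (?f i) x * chaos n q g x) x) = ?A"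
  proof -
    have "(\<Sum>i<n. creation i (\<lambda>x. chaos n p (?f i) x * chaos n q g x) x)
      = (\<Sum>i<n. \<Sum>r\<le>p. fact r * real (p choose r) * real (q choose r)
            * creation i (chaos n (p + q - 2 * r) (box_contraction n p r (?f i) g)) x)"
      unfolding Suc.IH[OF f Suc.prems(2)]
      by (intro sum.cong refl creation_sum[where n = n] chaos_polys)
    also have "\<dots> = (\<Sum>r\<le>p. fact r * real (p choose r) * real (q choose r)
            * (\<Sum>i<n. creation i (chaos n (p + q - 2 * r) (box_contraction n p r (?f i) g)) x))"
      by (subst sum.swap) (simp add: sum_distrib_left)
    also have "\<dots> = ?A"
    proof (intro sum.cong refl)
      fix r assume r: "r \<in> {..p}"
      show "fact r * real (p choose r) * real (q choose r)
            * (\<Sum>i<n. creation i (chaos n (p + q - 2 * r) (box_contraction n p r (?f i) g)) x)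
          = fact r * real (p choose r) * real (q choose r) * chaos n (Suc p + q - 2 * r) (?B r) x"
      (* For r > q the coefficient vanishes, which hides the truncated subtraction in the order. *)
      proof (cases "r \<le> q")
        case True
        have "chaos n (p + q - 2 * r) (box_contraction n p r (?f i) g)
            = chaos n (p + q - 2 * r) (\<lambda>zs. ?B r (i # zs))" for i
        proof (rule chaos_cong)
          fix zs assume "zs \<in> ibox n (p + q - 2 * r)"
          then have "length zs \<ge> p - r" using True by (auto simp: ibox_def)
          then show "box_contraction n p r (?f i) g zs = ?B r (i # zs)"
            using box_contraction_slice[OF Suc.prems(1)] r by simp
        qed
        then have "(\<Sum>i<n. creation i (chaos n (p + q - 2 * r) (box_contraction n p r (?f i) g)) x)
          = chaos n (Suc (p + q - 2 * r)) (?B r) x"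
          by (simp add: chaos_Suc)
        moreover have "Suc (p + q - 2 * r) = Suc p + q - 2 * r" using True r by simp
        ultimately show ?thesis by simp
      qed simp
    qed
    finally show ?thesis .
  qed
  (* The operator annihilates an index of g: summing over i contracts one more pair of indices. *)
  also have "(\<Sum>i<n. chaos n p (?f i) x * pd i (chaos n q g) x) = ?C"
  proof (cases q)
    case 0
    then show ?thesis by (simp add: chaos_0 pd_const)
  next
    case q: (Suc q')
    note g = symmetric_array_slice[OF Suc.prems(2)[unfolded q]]
    have "(\<Sum>i<n. chaos n p (?f i) x * pd i (chaos n q g) x)
        = (\<Sum>i<n. real q * (chaos n p (?f i) x * chaos n q' (?g i) x))"
      using pd_chaos[OF Suc.prems(2)[unfolded q]] by (intro sum.cong) (auto simp: q simp del: of_nat_Suc)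
    also have "\<dots> = (\<Sum>i<n. \<Sum>r\<le>p. real q * (fact r * real (p choose r) * real (q' choose r))
            * chaos n (p + q' - 2 * r) (box_contraction n p r (?f i) (?g i)) x)"
      unfolding Suc.IH[OF f g] by (simp add: sum_distrib_left mult.assoc)
    also have "\<dots> = (\<Sum>r\<le>p. real q * (fact r * real (p choose r) * real (q' choose r))
            * (\<Sum>i<n. chaos n (p + q' - 2 * r) (box_contraction n p r (?f i) (?g i)) x))"
      by (subst sum.swap) (simp add: sum_distrib_left)
    also have "\<dots> = ?C"
    proof (intro sum.cong refl)
      fix r assume r: "r \<in> {..p}"
      have "real (Suc q') * real (q' choose r) = real (q choose Suc r) * real (Suc r)"
        unfolding q of_nat_mult[symmetric] by (simp only: Suc_times_binomial_eq)
      then have "real q * (fact r * real (p choose r) * real (q' choose r))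
          = fact (Suc r) * real (p choose r) * real (q choose Suc r)"
        unfolding q fact_Suc by (metis (no_types, opaque_lifting) mult.assoc mult.commute)
      moreover have "(\<Sum>i<n. chaos n (p + q' - 2 * r) (box_contraction n p r (?f i) (?g i)) x)
          = chaos n (p + q' - 2 * r) (?B (Suc r)) x"
        unfolding box_contraction_Suc[abs_def] by (rule chaos_sum[symmetric])
      ultimately show "real q * (fact r * real (p choose r) * real (q' choose r))
            * (\<Sum>i<n. chaos n (p + q' - 2 * r) (box_contraction n p r (?f i) (?g i)) x)
          = fact (Suc r) * real (p choose r) * real (q choose Suc r)
            * chaos n (Suc p + q - 2 * Suc r) (?B (Suc r)) x"
        by (simp add: q)
    qed
    finally show ?thesis .
  qed
  also have "?A + ?C = (\<Sum>r\<le>Suc p. fact r * real (Suc p choose r) * real (q choose r)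
            * chaos n (Suc p + q - 2 * r) (?B r) x)"
  proof -
    let ?t = "\<lambda>r. fact r * real (q choose r) * chaos n (Suc p + q - 2 * r) (?B r) x"
    have "(\<Sum>r\<le>Suc p. real (Suc p choose r) * ?t r)
        = ?t 0 + (\<Sum>r\<le>p. real ((p choose r) + (p choose Suc r)) * ?t (Suc r))"
      by (subst sum.atMost_Suc_shift) (simp only: binomial_Suc_Suc binomial_n_0 of_nat_1 mult_1)
    also have "\<dots> = (?t 0 + (\<Sum>r\<le>p. real (p choose Suc r) * ?t (Suc r)))
        + (\<Sum>r\<le>p. real (p choose r) * ?t (Suc r))"
      by (simp add: sum.distrib algebra_simps)
    also have "?t 0 + (\<Sum>r\<le>p. real (p choose Suc r) * ?t (Suc r))
        = (\<Sum>r\<le>Suc p. real (p choose r) * ?t r)"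
      by (subst sum.atMost_Suc_shift) simp
    also have "\<dots> = (\<Sum>r\<le>p. real (p choose r) * ?t r)" by simp
    finally show ?thesis by (simp add: ac_simps)
  qed
  finally show ?case .
qed

section \<open>Gaussian integration by parts\<close>

definition gauss :: "real measure" where
  "gauss = density lborel std_normal_density"

definition gaussn :: "nat \<Rightarrow> (nat \<Rightarrow> real) measure" where
  "gaussn n = (\<Pi>\<^sub>M i\<in>{..<n}. gauss)"

lemma sets_gauss [simp, measurable_cong]: "sets gauss = sets borel"
  by (simp add: gauss_def)

lemma space_gauss [simp]: "space gauss = UNIV"
  by (simp add: gauss_def)

lemma prob_space_gauss: "prob_space gauss"
  unfolding gauss_def by (intro prob_space_normal_density) simp

lemma sets_gaussn [measurable_cong]: "sets (gaussn n) = sets (\<Pi>\<^sub>M i\<in>{..<n}. borel)"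
  unfolding gaussn_def by (intro sets_PiM_cong) auto

lemma prob_space_gaussn: "prob_space (gaussn n)"
  unfolding gaussn_def by (intro prob_space_PiM prob_space_gauss)

lemma one_plus_power_le:
  fixes t :: real assumes "t \<ge> 0" shows "(1 + t) ^ k \<le> 2 ^ k * (1 + t ^ k)"
proof -
  have "1 + t \<le> 2 * max 1 t" by simp
  then have "(1 + t) ^ k \<le> (2 * max 1 t) ^ k" using assms by (intro power_mono) auto
  also have "\<dots> = 2 ^ k * max 1 t ^ k" by (simp add: power_mult_distrib)
  also have "max 1 t ^ k \<le> 1 + t ^ k" using assms by (auto simp: max_def)
  finally show ?thesis by simp
qed

lemma integrable_gauss_poly_growth:
  assumes [measurable]: "v \<in> borel_measurable borel" and v: "\<And>t. \<bar>v t\<bar> \<le> C * (1 + \<bar>t\<bar>) ^ k"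
  shows "integrable gauss v"
proof -
  have C: "C \<ge> 0" using v[of 0] by auto
  have "integrable lborel (\<lambda>t. C * 2 ^ k * (std_normal_density t * \<bar>t\<bar> ^ 0 + std_normal_density t * \<bar>t\<bar> ^ k))"
    by (intro integrable_mult_right Bochner_Integration.integrable_add integrable_std_normal_moment_abs)
  then have "integrable lborel (\<lambda>t. std_normal_density t * v t)"
  proof (rule Bochner_Integration.integrable_bound)
    show "AE t in lborel. norm (std_normal_density t * v t)
        \<le> norm (C * 2 ^ k * (std_normal_density t * \<bar>t\<bar> ^ 0 + std_normal_density t * \<bar>t\<bar> ^ k))"
    proof (rule AE_I2)
      fix t :: real
      have "\<bar>v t\<bar> \<le> C * (2 ^ k * (1 + \<bar>t\<bar> ^ k))"
        using order_trans[OF v[of t] mult_left_mono[OF one_plus_power_le[of "\<bar>t\<bar>" k] C]] by simp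
      then have "std_normal_density t * \<bar>v t\<bar> \<le> std_normal_density t * (C * (2 ^ k * (1 + \<bar>t\<bar> ^ k)))"
        by (rule mult_left_mono) simp
      then show "norm (std_normal_density t * v t)
        \<le> norm (C * 2 ^ k * (std_normal_density t * \<bar>t\<bar> ^ 0 + std_normal_density t * \<bar>t\<bar> ^ k))"
        using C by (simp add: abs_mult algebra_simps)
    qed
  qed auto
  then show ?thesis unfolding gauss_def by (subst integrable_density) auto
qed

lemma integral_gauss:
  assumes "v \<in> borel_measurable borel"
  shows "(\<integral>t. v t \<partial>gauss) = (\<integral>t. std_normal_density t * v t \<partial>lborel)"
  using assms unfolding gauss_def by (subst integral_density) auto

lemma DERIV_std_normal_density:
  "(std_normal_density has_real_derivative - t * std_normal_density t) (at t)"
proof -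
  define c where "c = 1 / sqrt (2 * pi)"
  show ?thesis
    unfolding std_normal_density_def[abs_def] c_def[symmetric]
    by (auto intro!: derivative_eq_intros simp: power2_eq_square)
qed

lemma poly_growth_times_gauss_tendsto:
  assumes "filterlim g at_top F" and v: "\<And>t. \<bar>v (h t)\<bar> \<le> C * (1 + g t) ^ k"
    and h: "\<And>t. std_normal_density (h t) = std_normal_density (g t)"
  shows "((\<lambda>t. v (h t) * std_normal_density (h t)) \<longlongrightarrow> 0) F"
proof -
  have "((\<lambda>t. C * (1 + t) ^ k * std_normal_density t) \<longlongrightarrow> 0) at_top"
    unfolding std_normal_density_def by real_asymp
  then have *: "((\<lambda>t. C * (1 + g t) ^ k * std_normal_density (g t)) \<longlongrightarrow> 0) F"
    by (rule filterlim_compose[OF _ assms(1)])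
  show ?thesis
    by (rule Lim_null_comparison[OF _ *])
      (auto simp: abs_mult h intro!: always_eventually mult_right_mono v)
qed

text \<open>The boundary terms vanish because the density beats polynomial growth.\<close>

lemma gauss_integration_by_parts:
  assumes d: "\<And>t. (v has_real_derivative v' t) (at t)" and c: "continuous_on UNIV v'"
    and v: "\<And>t. \<bar>v t\<bar> \<le> C * (1 + \<bar>t\<bar>) ^ k" and v': "\<And>t. \<bar>v' t\<bar> \<le> C' * (1 + \<bar>t\<bar>) ^ k'"
  shows "(\<integral>t. t * v t \<partial>gauss) = (\<integral>t. v' t \<partial>gauss)"
proof -
  have cv: "continuous_on UNIV v"
    using d by (meson DERIV_continuous continuous_at_imp_continuous_on)
  have [measurable]: "v \<in> borel_measurable borel" "v' \<in> borel_measurable borel"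
    using cv c by (auto intro: borel_measurable_continuous_onI)
  have C: "C \<ge> 0" using v[of 0] by auto
  let ?p = std_normal_density
  have bnd: "\<bar>t * v t\<bar> \<le> C * (1 + \<bar>t\<bar>) ^ Suc k" for t
  proof -
    have "\<bar>t * v t\<bar> \<le> (1 + \<bar>t\<bar>) * (C * (1 + \<bar>t\<bar>) ^ k)"
      unfolding abs_mult by (intro mult_mono v) auto
    then show ?thesis by (simp add: mult_ac)
  qed
  have i1: "integrable gauss (\<lambda>t. t * v t)"
    by (rule integrable_gauss_poly_growth[OF _ bnd]) measurable
  have i2: "integrable gauss v'"
    by (rule integrable_gauss_poly_growth[OF _ v']) measurable
  let ?f = "\<lambda>t. ?p t * v' t - ?p t * (t * v t)"
  have int: "integrable lborel ?f"
    using i1 i2 unfolding gauss_def by (auto simp: integrable_density)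
  have "(LBINT t=-\<infinity>..\<infinity>. ?f t) = 0 - 0"
  proof (rule interval_integral_FTC_integrable)
    show "((\<lambda>t. v t * ?p t) has_vector_derivative ?f t) (at t)" for t
      unfolding has_real_derivative_iff_has_vector_derivative[symmetric]
      by (rule DERIV_cong[OF DERIV_mult'[OF d DERIV_std_normal_density]]) (simp add: algebra_simps)
    have "continuous_on UNIV ?p"
      using DERIV_std_normal_density by (meson DERIV_continuous continuous_at_imp_continuous_on)
    then have "continuous_on UNIV ?f"
      by (intro continuous_intros cv c)
    then show "isCont ?f t" for t
      by (simp add: continuous_on_eq_continuous_at)
    show "set_integrable lborel (einterval (- \<infinity>) \<infinity>) ?f"
      using int by (simp add: set_integrable_def)
    have "((\<lambda>t. v (- t) * ?p (- t)) \<longlongrightarrow> 0) at_top"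
      by (rule poly_growth_times_gauss_tendsto[where g = "\<lambda>t. \<bar>t\<bar>" and C = C and k = k])
        (use v[of "- _"] in \<open>auto intro!: filterlim_abs_real simp: std_normal_density_def\<close>)
    then show "(((\<lambda>t. v t * ?p t) \<circ> real_of_ereal) \<longlongrightarrow> 0) (at_right (- \<infinity>))"
      unfolding ereal_tendsto_simps by (simp add: filterlim_at_bot_mirror)
    have "((\<lambda>t. v t * ?p t) \<longlongrightarrow> 0) at_top"
      by (rule poly_growth_times_gauss_tendsto[where g = "\<lambda>t. \<bar>t\<bar>" and C = C and k = k])
        (use v in \<open>auto intro!: filterlim_abs_real simp: std_normal_density_def\<close>)
    then show "(((\<lambda>t. v t * ?p t) \<circ> real_of_ereal) \<longlongrightarrow> 0) (at_left \<infinity>)"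
      unfolding ereal_tendsto_simps .
  qed auto
  then have "(\<integral>t. ?f t \<partial>lborel) = 0"
    by (simp add: interval_lebesgue_integral_def set_lebesgue_integral_def)
  moreover have "(\<integral>t. ?f t \<partial>lborel) = (\<integral>t. ?p t * v' t \<partial>lborel) - (\<integral>t. ?p t * (t * v t) \<partial>lborel)"
    using i1 i2 unfolding gauss_def by (intro Bochner_Integration.integral_diff) (auto simp: integrable_density)
  ultimately show ?thesis by (simp add: integral_gauss)
qed

text \<open>The functions of finitely many Gaussian variables to which integration by parts is applied: besides
  polynomials, these include smooth functions of polynomial growth of a polynomial. Dependence on the
  first n coordinates only is required so that values at whole sequences are determined by the finite
  product measure.\<close>

definition tame :: "nat \<Rightarrow> ((nat \<Rightarrow> real) \<Rightarrow> real) \<Rightarrow> bool" where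
  "tame n u \<longleftrightarrow> u \<in> borel_measurable (\<Pi>\<^sub>M i\<in>{..<n}. borel) \<and>
     (\<forall>x y. (\<forall>j<n. x j = y j) \<longrightarrow> u x = u y) \<and>
     (\<exists>C k. \<forall>x. \<bar>u x\<bar> \<le> C * (1 + (\<Sum>j<n. \<bar>x j\<bar>)) ^ k)"

lemma tameE:
  assumes "tame n u"
  obtains C k where "C \<ge> 0" "\<And>x. \<bar>u x\<bar> \<le> C * (1 + (\<Sum>j<n. \<bar>x j\<bar>)) ^ k"
proof -
  from assms obtain C k where *: "\<And>x. \<bar>u x\<bar> \<le> C * (1 + (\<Sum>j<n. \<bar>x j\<bar>)) ^ k"
    unfolding tame_def by blast
  have "C \<ge> 0" using *[of "\<lambda>_. 0"] by auto
  with * show thesis using that by blast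
qed

lemma tame_measurable: "tame n u \<Longrightarrow> u \<in> borel_measurable (gaussn n)"
  by (simp add: tame_def cong: measurable_cong_sets[OF sets_gaussn refl])

lemma tame_depends: "tame n u \<Longrightarrow> (\<And>j. j < n \<Longrightarrow> x j = y j) \<Longrightarrow> u x = u y"
  by (simp add: tame_def)

lemma tame_const: "tame n (\<lambda>_. c)"
  unfolding tame_def by (intro conjI exI[of _ "\<bar>c\<bar>"] exI[of _ "0::nat"]) auto

lemma tame_coord:
  assumes "i < n" shows "tame n (\<lambda>x. x i)"
proof -
  have "\<bar>x i\<bar> \<le> 1 * (1 + (\<Sum>j<n. \<bar>x j\<bar>)) ^ 1" for x :: "nat \<Rightarrow> real"
    using member_le_sum[of i "{..<n}" "\<lambda>j. \<bar>x j\<bar>"] assms by auto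
  moreover have "(\<lambda>x. x i) \<in> borel_measurable (\<Pi>\<^sub>M i\<in>{..<n}. (borel :: real measure))"
    using assms by (intro measurable_component_singleton) auto
  ultimately show ?thesis unfolding tame_def using assms by blast
qed

lemma tame_mult:
  assumes "tame n u" "tame n v" shows "tame n (\<lambda>x. u x * v x)"
proof -
  obtain C k D l where *: "C \<ge> 0" "D \<ge> 0" "\<And>x. \<bar>u x\<bar> \<le> C * (1 + (\<Sum>j<n. \<bar>x j\<bar>)) ^ k"
    "\<And>x. \<bar>v x\<bar> \<le> D * (1 + (\<Sum>j<n. \<bar>x j\<bar>)) ^ l"
    using assms by (metis tameE)
  have "\<bar>u x * v x\<bar> \<le> (C * (1 + (\<Sum>j<n. \<bar>x j\<bar>)) ^ k) * (D * (1 + (\<Sum>j<n. \<bar>x j\<bar>)) ^ l)" for x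
    unfolding abs_mult by (intro mult_mono *) (auto intro!: mult_nonneg_nonneg * sum_nonneg zero_le_power add_nonneg_nonneg)
  then have "\<bar>u x * v x\<bar> \<le> (C * D) * (1 + (\<Sum>j<n. \<bar>x j\<bar>)) ^ (k + l)" for x
    by (simp add: power_add mult_ac)
  moreover have "(\<lambda>x. u x * v x) \<in> borel_measurable (\<Pi>\<^sub>M i\<in>{..<n}. borel)"
    using assms by (auto simp: tame_def)
  moreover have "\<forall>x y. (\<forall>j<n. x j = y j) \<longrightarrow> u x * v x = u y * v y"
    using assms unfolding tame_def by metis
  ultimately show ?thesis unfolding tame_def by blast
qed

lemma tame_add:
  assumes "tame n u" "tame n v" shows "tame n (\<lambda>x. u x + v x)"
proof -
  obtain C k D l where *: "C \<ge> 0" "D \<ge> 0" "\<And>x. \<bar>u x\<bar> \<le> C * (1 + (\<Sum>j<n. \<bar>x j\<bar>)) ^ k"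
    "\<And>x. \<bar>v x\<bar> \<le> D * (1 + (\<Sum>j<n. \<bar>x j\<bar>)) ^ l"
    using assms by (metis tameE)
  have "\<bar>u x + v x\<bar> \<le> (C + D) * (1 + (\<Sum>j<n. \<bar>x j\<bar>)) ^ (k + l)" for x
  proof -
    let ?W = "1 + (\<Sum>j<n. \<bar>x j\<bar>)"
    have W: "?W \<ge> 1" by (simp add: sum_nonneg)
    have "\<bar>u x + v x\<bar> \<le> C * ?W ^ k + D * ?W ^ l"
      using *(3,4)[of x] by linarith
    also have "\<dots> \<le> C * ?W ^ (k + l) + D * ?W ^ (k + l)"
      using W * by (intro add_mono mult_left_mono power_increasing) auto
    finally show ?thesis by (simp add: algebra_simps)
  qed
  moreover have "(\<lambda>x. u x + v x) \<in> borel_measurable (\<Pi>\<^sub>M i\<in>{..<n}. borel)"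
    using assms by (auto simp: tame_def)
  moreover have "\<forall>x y. (\<forall>j<n. x j = y j) \<longrightarrow> u x + v x = u y + v y"
    using assms unfolding tame_def by metis
  ultimately show ?thesis unfolding tame_def by blast
qed

lemma tame_diff: "tame n u \<Longrightarrow> tame n v \<Longrightarrow> tame n (\<lambda>x. u x - v x)"
  using tame_add[of n u "\<lambda>x. (-1) * v x"] tame_mult[OF tame_const, of n v "-1"] by simp

lemma tame_power: "tame n u \<Longrightarrow> tame n (\<lambda>x. u x ^ k)"
  by (induction k) (auto intro: tame_const tame_mult)

lemma tame_polys: "u \<in> polys n \<Longrightarrow> tame n u"
  by (induction rule: polys.induct) (auto intro: tame_const tame_coord tame_add tame_mult)

lemma tame_compose:
  fixes f :: "real \<Rightarrow> real"
  assumes u: "tame n u" and [measurable]: "f \<in> borel_measurable borel"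
    and f: "\<And>y. \<bar>f y\<bar> \<le> A * (1 + \<bar>y\<bar>) ^ m"
  shows "tame n (\<lambda>x. f (u x))"
proof -
  have A: "A \<ge> 0" using f[of 0] by auto
  obtain C k where *: "C \<ge> 0" "\<And>x. \<bar>u x\<bar> \<le> C * (1 + (\<Sum>j<n. \<bar>x j\<bar>)) ^ k"
    using u by (metis tameE)
  have "\<bar>f (u x)\<bar> \<le> (A * (1 + C) ^ m) * (1 + (\<Sum>j<n. \<bar>x j\<bar>)) ^ (k * m)" for x
  proof -
    let ?W = "1 + (\<Sum>j<n. \<bar>x j\<bar>)"
    have W: "?W ^ k \<ge> 1" by (simp add: sum_nonneg)
    have "1 + \<bar>u x\<bar> \<le> (1 + C) * ?W ^ k"
      unfolding distrib_right mult_1 using *(2)[of x] W by linarith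
    then have "(1 + \<bar>u x\<bar>) ^ m \<le> ((1 + C) * ?W ^ k) ^ m" by (intro power_mono) auto
    then have "A * (1 + \<bar>u x\<bar>) ^ m \<le> A * ((1 + C) * ?W ^ k) ^ m" using A by (rule mult_left_mono)
    then show ?thesis using f[of "u x"] by (simp add: power_mult_distrib power_mult mult_ac)
  qed
  moreover have "(\<lambda>x. f (u x)) \<in> borel_measurable (\<Pi>\<^sub>M i\<in>{..<n}. borel)"
    by (rule measurable_compose[OF _ assms(2)]) (use u in \<open>simp add: tame_def\<close>)
  moreover have "\<forall>x y. (\<forall>j<n. x j = y j) \<longrightarrow> f (u x) = f (u y)"
    using u unfolding tame_def by metis
  ultimately show ?thesis unfolding tame_def by blast
qed

text \<open>Comparing the sum with n + 1 times its largest term reduces integrability of a power to moments of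
  a single coordinate.\<close>

lemma power_of_sum_le:
  fixes a :: "nat \<Rightarrow> real"
  assumes "\<And>j. j < n \<Longrightarrow> a j \<ge> 0"
  shows "(1 + (\<Sum>j<n. a j)) ^ k \<le> (real n + 1) ^ k * (1 + (\<Sum>j<n. a j ^ k))"
proof -
  let ?m = "Max (insert 1 (a ` {..<n}))"
  have m: "?m \<in> insert 1 (a ` {..<n})" by (rule Max_in) auto
  have "(\<Sum>j<n. a j) \<le> (\<Sum>j<n. ?m)" by (intro sum_mono Max_ge) auto
  moreover have "1 \<le> ?m" by (rule Max_ge) auto
  ultimately have "1 + (\<Sum>j<n. a j) \<le> (real n + 1) * ?m"
    unfolding sum_constant card_lessThan distrib_right mult_1 by linarith
  then have "(1 + (\<Sum>j<n. a j)) ^ k \<le> ((real n + 1) * ?m) ^ k"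
    using assms by (intro power_mono) (auto intro!: add_nonneg_nonneg sum_nonneg)
  also have "\<dots> = (real n + 1) ^ k * ?m ^ k" by (simp add: power_mult_distrib)
  also have "?m ^ k \<le> 1 + (\<Sum>j<n. a j ^ k)"
  proof (cases "?m = 1")
    case True
    then show ?thesis using assms by (auto intro!: sum_nonneg)
  next
    case False
    then obtain j where j: "j < n" "?m = a j" using m by auto
    have "a j ^ k \<le> (\<Sum>j<n. a j ^ k)" using j assms by (intro member_le_sum) auto
    then show ?thesis using j by simp
  qed
  finally show ?thesis by (simp add: mult_left_mono)
qed

lemma integrable_gaussn_coord:
  fixes v :: "real \<Rightarrow> real"
  assumes "i < n" and [measurable]: "v \<in> borel_measurable borel"
  shows "integrable (gaussn n) (\<lambda>x. v (x i)) \<longleftrightarrow> integrable gauss v"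
proof -
  have "gauss = distr (gaussn n) gauss (\<lambda>x. x i)"
    unfolding gaussn_def using assms(1) by (intro distr_PiM_component[symmetric] prob_space_gauss) auto
  have [measurable]: "(\<lambda>x. x i) \<in> gaussn n \<rightarrow>\<^sub>M gauss"
    unfolding gaussn_def using assms(1) by (intro measurable_component_singleton) auto
  have "integrable gauss v \<longleftrightarrow> integrable (distr (gaussn n) gauss (\<lambda>x. x i)) v"
    using \<open>gauss = _\<close> by metis
  also have "\<dots> \<longleftrightarrow> integrable (gaussn n) (\<lambda>x. v (x i))"
    by (rule integrable_distr_eq) measurable
  finally show ?thesis by simp
qed

lemma tame_integrable:
  assumes "tame n u" shows "integrable (gaussn n) u"
proof -
  interpret prob_space "gaussn n" by (rule prob_space_gaussn)
  obtain C k where *: "C \<ge> 0" "\<And>x. \<bar>u x\<bar> \<le> C * (1 + (\<Sum>j<n. \<bar>x j\<bar>)) ^ k"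
    using assms by (metis tameE)
  have "integrable (gaussn n) (\<lambda>x. C * ((real n + 1) ^ k * (1 + (\<Sum>j<n. \<bar>x j\<bar> ^ k))))"
  proof (intro integrable_mult_right Bochner_Integration.integrable_add Bochner_Integration.integrable_sum)
    fix j assume "j \<in> {..<n}"
    moreover have "integrable gauss (\<lambda>t. \<bar>t\<bar> ^ k)"
      by (rule integrable_gauss_poly_growth[where C = 1 and k = k]) (auto intro!: power_mono)
    ultimately show "integrable (gaussn n) (\<lambda>x. \<bar>x j\<bar> ^ k)"
      using integrable_gaussn_coord[of j n "\<lambda>t. \<bar>t\<bar> ^ k"] by auto
  qed simp
  then show ?thesis
  proof (rule Bochner_Integration.integrable_bound)
    show "AE x in gaussn n. norm (u x) \<le> norm (C * ((real n + 1) ^ k * (1 + (\<Sum>j<n. \<bar>x j\<bar> ^ k))))"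
    proof (rule AE_I2)
      fix x
      have "\<bar>u x\<bar> \<le> C * ((real n + 1) ^ k * (1 + (\<Sum>j<n. \<bar>x j\<bar> ^ k)))"
        using order_trans[OF *(2)[of x] mult_left_mono[OF power_of_sum_le[of n "\<lambda>j. \<bar>x j\<bar>" k] *(1)]] by simp
      then show "norm (u x) \<le> norm (C * ((real n + 1) ^ k * (1 + (\<Sum>j<n. \<bar>x j\<bar> ^ k))))" by simp
    qed
  qed (rule tame_measurable[OF assms])
qed

lemma tame_slice_growth:
  assumes "tame n u" "i < n"
  shows "\<exists>C k. \<forall>t. \<bar>u (x(i := t))\<bar> \<le> C * (1 + \<bar>t\<bar>) ^ k"
proof -
  obtain C k where *: "C \<ge> 0" "\<And>x. \<bar>u x\<bar> \<le> C * (1 + (\<Sum>j<n. \<bar>x j\<bar>)) ^ k"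
    using assms by (metis tameE)
  let ?W = "1 + (\<Sum>j<n. \<bar>x j\<bar>)"
  have "\<bar>u (x(i := t))\<bar> \<le> (C * ?W ^ k) * (1 + \<bar>t\<bar>) ^ k" for t
  proof -
    have "(\<Sum>j<n. \<bar>(x(i := t)) j\<bar>) = \<bar>t\<bar> + (\<Sum>j\<in>{..<n} - {i}. \<bar>x j\<bar>)"
      using assms(2) by (subst sum.remove[of _ i]) auto
    also have "(\<Sum>j\<in>{..<n} - {i}. \<bar>x j\<bar>) \<le> (\<Sum>j<n. \<bar>x j\<bar>)"
      by (intro sum_mono2) auto
    finally have "1 + (\<Sum>j<n. \<bar>(x(i := t)) j\<bar>) \<le> ?W + \<bar>t\<bar>" by simp
    also have "\<dots> \<le> ?W * (1 + \<bar>t\<bar>)"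
      by (simp add: algebra_simps sum_nonneg)
    finally have "(1 + (\<Sum>j<n. \<bar>(x(i := t)) j\<bar>)) ^ k \<le> (?W * (1 + \<bar>t\<bar>)) ^ k"
      by (intro power_mono) (auto intro!: add_nonneg_nonneg sum_nonneg)
    from mult_left_mono[OF this *(1)] *(2)[of "x(i := t)"] show ?thesis
      by (simp add: power_mult_distrib mult_ac)
  qed
  then show ?thesis by blast
qed

text \<open>By Fubini the coordinate i can be integrated out first, where the one-dimensional formula applies.\<close>

lemma gaussn_integration_by_parts:
  assumes i: "i < n" and u: "tame n u" and u': "tame n u'"
    and d: "\<And>x t. ((\<lambda>t. u (x(i := t))) has_real_derivative u' (x(i := t))) (at t)"
    and c: "\<And>x. continuous_on UNIV (\<lambda>t. u' (x(i := t)))"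
  shows "(\<integral>x. x i * u x \<partial>gaussn n) = (\<integral>x. u' x \<partial>gaussn n)"
proof -
  interpret prob_space gauss by (rule prob_space_gauss)
  interpret product_sigma_finite "\<lambda>_::nat. gauss" ..
  define I where "I = {..<n} - {i}"
  have I: "finite I" "i \<notin> I" "{..<n} = insert i I" using i by (auto simp: I_def)
  have fub: "(\<integral>x. w x \<partial>gaussn n) = (\<integral>x. (\<integral>t. w (x(i := t)) \<partial>gauss) \<partial>Pi\<^sub>M I (\<lambda>_. gauss))"
    if "tame n w" for w
    using tame_integrable[OF that] unfolding gaussn_def I(3) by (rule product_integral_insert[OF I(1,2)])
  have "(\<integral>t. (x(i := t)) i * u (x(i := t)) \<partial>gauss) = (\<integral>t. u' (x(i := t)) \<partial>gauss)" for x
  proof -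
    obtain C k C' k' where "\<And>t. \<bar>u (x(i := t))\<bar> \<le> C * (1 + \<bar>t\<bar>) ^ k" "\<And>t. \<bar>u' (x(i := t))\<bar> \<le> C' * (1 + \<bar>t\<bar>) ^ k'"
      using tame_slice_growth[OF u i] tame_slice_growth[OF u' i] by metis
    from gauss_integration_by_parts[OF d c this] show ?thesis by simp
  qed
  then show ?thesis
    by (subst fub[OF tame_mult[OF tame_coord[OF i] u]]) (simp add: fub[OF u'])
qed

text \<open>The second factor is allowed to be non-polynomial because it will be f(F) for a solution f of
  Stein's equation.\<close>

lemma creation_adjoint:
  assumes i: "i < n" and u: "u \<in> polys n" and v: "tame n v" and v': "tame n v'"
    and d: "\<And>x t. ((\<lambda>t. v (x(i := t))) has_real_derivative v' (x(i := t))) (at t)"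
    and c: "\<And>x. continuous_on UNIV (\<lambda>t. v' (x(i := t)))"
  shows "(\<integral>x. creation i u x * v x \<partial>gaussn n) = (\<integral>x. u x * v' x \<partial>gaussn n)"
proof -
  have cont: "continuous_on UNIV (\<lambda>t. w (x(i := t)))" if "w \<in> polys n" for w x
    using has_pd[OF that] by (meson DERIV_continuous continuous_at_imp_continuous_on)
  have cv: "continuous_on UNIV (\<lambda>t. v (x(i := t)))" for x
    using d by (meson DERIV_continuous continuous_at_imp_continuous_on)
  note t = tame_polys[OF u] tame_polys[OF pd_polys[OF u, of i]]
  have "(\<integral>x. x i * (u x * v x) \<partial>gaussn n) = (\<integral>x. u x * v' x + pd i u x * v x \<partial>gaussn n)"
  proof (rule gaussn_integration_by_parts[OF i tame_mult[OF t(1) v] tame_add[OF tame_mult[OF t(1) v'] tame_mult[OF t(2) v]]])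
    show "((\<lambda>t. u (x(i := t)) * v (x(i := t))) has_real_derivative
        u (x(i := t)) * v' (x(i := t)) + pd i u (x(i := t)) * v (x(i := t))) (at t)" for x t
      by (rule DERIV_mult'[OF has_pd[OF u] d])
    show "continuous_on UNIV (\<lambda>t. u (x(i := t)) * v' (x(i := t)) + pd i u (x(i := t)) * v (x(i := t)))" for x
      by (rule continuous_on_add[OF continuous_on_mult[OF cont[OF u] c]
            continuous_on_mult[OF cont[OF pd_polys[OF u]] cv]])
  qed
  also have "\<dots> = (\<integral>x. u x * v' x \<partial>gaussn n) + (\<integral>x. pd i u x * v x \<partial>gaussn n)"
    by (intro Bochner_Integration.integral_add tame_integrable tame_mult t v v')
  finally have "(\<integral>x. u x * v' x \<partial>gaussn n)
      = (\<integral>x. x i * (u x * v x) \<partial>gaussn n) - (\<integral>x. pd i u x * v x \<partial>gaussn n)" by simp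
  also have "\<dots> = (\<integral>x. x i * (u x * v x) - pd i u x * v x \<partial>gaussn n)"
    by (intro Bochner_Integration.integral_diff[symmetric] tame_integrable tame_mult t v v' tame_coord i)
  finally show ?thesis by (simp add: creation_def algebra_simps)
qed

lemma creation_adjoint_polys:
  assumes "i < n" "u \<in> polys n" "v \<in> polys n"
  shows "(\<integral>x. creation i u x * v x \<partial>gaussn n) = (\<integral>x. u x * pd i v x \<partial>gaussn n)"
proof (rule creation_adjoint)
  show "continuous_on UNIV (\<lambda>t. pd i v (x(i := t)))" for x
    using has_pd[OF pd_polys[OF assms(3)]] by (meson DERIV_continuous continuous_at_imp_continuous_on)
qed (use assms in \<open>auto intro: tame_polys pd_polys has_pd\<close>)

section \<open>Orthogonality of the chaoses and the carre du champ\<close>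

text \<open>Each creation operator on the left becomes a derivative on the right, which strips one index off the
  kernel. If the numbers of operators and of indices differ, what remains is either the derivative of
  a constant or the mean of something in the range of a creation operator, and both vanish.\<close>

lemma wick_chaos_inner:
  assumes "symmetric_array q b" "set is \<subseteq> {..<n}"
  shows "(\<integral>x. wick is x * chaos n q b x \<partial>gaussn n) = (if length is = q then fact q * b is else 0)"
  using assms
proof (induction "is" arbitrary: q b)
  case Nil
  interpret prob_space "gaussn n" by (rule prob_space_gaussn)
  show ?case
  proof (cases q)
    case 0
    then show ?thesis by (simp add: chaos_0 prob_space)
  next
    case (Suc q')
    have z: "(\<integral>x. creation i u x \<partial>gaussn n) = 0" if "i < n" "u \<in> polys n" for i u
      using creation_adjoint_polys[OF that polys.const[of 1]] by (simp add: pd_const)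
    have "(\<integral>x. chaos n q b x \<partial>gaussn n) = (\<Sum>i<n. (\<integral>x. creation i (chaos n q' (\<lambda>is. b (i # is))) x \<partial>gaussn n))"
      unfolding Suc chaos_Suc
      by (intro Bochner_Integration.integral_sum tame_integrable tame_polys creation_polys chaos_polys) auto
    also have "\<dots> = 0" by (intro sum.neutral ballI z chaos_polys) auto
    finally show ?thesis using Suc by simp
  qed
next
  case (Cons i "is")
  then have i: "i < n" and "is": "set is \<subseteq> {..<n}" by auto
  have "(\<integral>x. wick (i # is) x * chaos n q b x \<partial>gaussn n) = (\<integral>x. wick is x * pd i (chaos n q b) x \<partial>gaussn n)"
    unfolding wick.simps by (intro creation_adjoint_polys i wick_polys "is" chaos_polys)
  also have "\<dots> = (if length (i # is) = q then fact q * b (i # is) else 0)"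
  proof (cases q)
    case 0
    then show ?thesis by (simp add: chaos_0 pd_const)
  next
    case (Suc q')
    have "(\<integral>x. wick is x * pd i (chaos n q b) x \<partial>gaussn n)
        = real (Suc q') * (\<integral>x. wick is x * chaos n q' (\<lambda>is. b (i # is)) x \<partial>gaussn n)"
      unfolding Suc pd_chaos[OF Cons.prems(1)[unfolded Suc] i] by (simp add: mult.left_commute del: of_nat_Suc)
    also have "\<dots> = real (Suc q') * (if length is = q' then fact q' * b (i # is) else 0)"
      by (subst Cons.IH[OF symmetric_array_slice "is"]) (use Cons.prems(1) Suc in auto)
    finally show ?thesis using Suc by simp
  qed
  finally show ?case .
qed

lemma chaos_inner:
  assumes "symmetric_array q b"
  shows "(\<integral>x. chaos n p a x * chaos n q b x \<partial>gaussn n)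
    = (if p = q then fact q * (\<Sum>is\<in>ibox n q. a is * b is) else 0)"
proof -
  have "(\<integral>x. chaos n p a x * chaos n q b x \<partial>gaussn n)
      = (\<integral>x. (\<Sum>is\<in>ibox n p. a is * (wick is x * chaos n q b x)) \<partial>gaussn n)"
    by (simp add: chaos_def[of n p] sum_distrib_right mult.assoc)
  also have "\<dots> = (\<Sum>is\<in>ibox n p. a is * (\<integral>x. wick is x * chaos n q b x \<partial>gaussn n))"
    by (subst Bochner_Integration.integral_sum)
      (auto intro!: tame_integrable tame_mult tame_const tame_polys[OF wick_polys] tame_polys[OF chaos_polys]
        simp: ibox_def)
  also have "\<dots> = (\<Sum>is\<in>ibox n p. a is * (if p = q then fact q * b is else 0))"
    by (intro sum.cong refl, subst wick_chaos_inner[OF assms]) (auto simp: ibox_def)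
  finally show ?thesis by (auto simp: sum_distrib_left mult.left_commute)
qed

lemma permute_list_in_ibox: "zs \<in> ibox n m \<Longrightarrow> \<pi> permutes {..<m} \<Longrightarrow> permute_list \<pi> zs \<in> ibox n m"
  by (auto simp: ibox_def)

lemma sum_ibox_permute:
  assumes "\<pi> permutes {..<m}"
  shows "(\<Sum>zs\<in>ibox n m. f (permute_list \<pi> zs)) = sum f (ibox n m)"
proof (rule sum.reindex_bij_witness[of _ "permute_list (inv \<pi>)" "permute_list \<pi>"])
  have *: "inv \<pi> permutes {..<m}" using assms by (rule permutes_inv)
  fix zs assume zs: "zs \<in> ibox n m"
  then have l: "length zs = m" by (simp add: ibox_def)
  show "permute_list (inv \<pi>) (permute_list \<pi> zs) = zs"
    using permute_list_compose[of "inv \<pi>" zs \<pi>] * l permutes_inv_o[OF assms] by simp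
  show "permute_list \<pi> (permute_list (inv \<pi>) zs) = zs"
    using permute_list_compose[of \<pi> zs "inv \<pi>"] assms l permutes_inv_o[OF assms] by simp
  show "permute_list \<pi> zs \<in> ibox n m" "permute_list (inv \<pi>) zs \<in> ibox n m"
    using zs assms * by (auto intro: permute_list_in_ibox)
qed auto

lemma symmetric_symmetrization: "symmetric_array m (symmetrization m c)"
  unfolding symmetric_array_def
proof (intro allI impI)
  fix zs ws :: "nat list" assume l: "length zs = m" and eq: "mset zs = mset ws"
  from eq obtain \<sigma> where \<sigma>: "\<sigma> permutes {..<length ws}" "permute_list \<sigma> ws = zs"
    by (rule mset_eq_permutation)
  have lw: "length ws = m" using \<sigma> l by auto
  have "(\<Sum>\<pi> | \<pi> permutes {..<m}. c (permute_list \<pi> zs))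
      = (\<Sum>\<pi> | \<pi> permutes {..<m}. c (permute_list (\<sigma> \<circ> \<pi>) ws))"
  proof (intro sum.cong refl)
    fix \<pi> assume "\<pi> \<in> {\<pi>. \<pi> permutes {..<m}}"
    then have "permute_list (\<sigma> \<circ> \<pi>) ws = permute_list \<pi> (permute_list \<sigma> ws)"
      using lw by (intro permute_list_compose) auto
    then show "c (permute_list \<pi> zs) = c (permute_list (\<sigma> \<circ> \<pi>) ws)" using \<sigma> by simp
  qed
  also have "\<dots> = (\<Sum>\<pi> | \<pi> permutes {..<m}. c (permute_list \<pi> ws))"
    by (rule setum_permutations_compose_left[symmetric]) (use \<sigma>(1) lw in simp)
  finally show "symmetrization m c zs = symmetrization m c ws"
    using l lw by (simp add: symmetrization_def)
qed

text \<open>Reindexing the sum by a permutation changes the kernel but not the Wick monomials.\<close>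

lemma chaos_symmetrization: "chaos n m (symmetrization m c) = chaos n m c"
proof
  fix x
  have "chaos n m (symmetrization m c) x
      = (\<Sum>zs\<in>ibox n m. (\<Sum>\<pi> | \<pi> permutes {..<m}. c (permute_list \<pi> zs) * wick zs x) / fact m)"
    unfolding chaos_def by (intro sum.cong) (auto simp: ibox_def symmetrization_def sum_distrib_right)
  also have "\<dots> = (\<Sum>\<pi> | \<pi> permutes {..<m}. \<Sum>zs\<in>ibox n m. c (permute_list \<pi> zs) * wick zs x) / fact m"
    by (subst sum.swap) (simp add: sum_divide_distrib)
  also have "\<dots> = (\<Sum>\<pi> | \<pi> permutes {..<m}. chaos n m c x) / fact m"
  proof (intro arg_cong2[where f = "(/)"] sum.cong refl)
    fix \<pi> assume "\<pi> \<in> {\<pi>. \<pi> permutes {..<m}}"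
    then have \<pi>: "\<pi> permutes {..<m}" by simp
    have "(\<Sum>zs\<in>ibox n m. c (permute_list \<pi> zs) * wick zs x)
        = (\<Sum>zs\<in>ibox n m. c (permute_list \<pi> zs) * wick (permute_list \<pi> zs) x)"
    proof (intro sum.cong refl)
      fix zs assume "zs \<in> ibox n m"
      then have "mset (permute_list \<pi> zs) = mset zs" using \<pi> by (intro mset_permute_list) (auto simp: ibox_def)
      then show "c (permute_list \<pi> zs) * wick zs x = c (permute_list \<pi> zs) * wick (permute_list \<pi> zs) x"
        using wick_mset by metis
    qed
    also have "\<dots> = chaos n m c x"
      unfolding chaos_def by (rule sum_ibox_permute[OF \<pi>])
    finally show "(\<Sum>zs\<in>ibox n m. c (permute_list \<pi> zs) * wick zs x) = chaos n m c x" .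
  qed
  also have "\<dots> = chaos n m c x" by (simp add: card_permutations)
  finally show "chaos n m (symmetrization m c) x = chaos n m c x" .
qed

definition contraction_energy :: "nat \<Rightarrow> nat \<Rightarrow> nat \<Rightarrow> (nat list \<Rightarrow> real) \<Rightarrow> real" where
  "contraction_energy n d r a =
     (\<Sum>zs\<in>ibox n (2 * d - 2 * r). (symmetrization (2 * d - 2 * r) (box_contraction n d r a a) zs)\<^sup>2)"

text \<open>For the chaos element F given by a, this is the squared norm of the gradient of F divided by d: by
  the formula for partial derivatives each of them is d times the chaos element of a slice. It is
  called \<open>\<Gamma>\<close> in the comments below.\<close>

definition carre :: "nat \<Rightarrow> nat \<Rightarrow> (nat list \<Rightarrow> real) \<Rightarrow> (nat \<Rightarrow> real) \<Rightarrow> real" where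
  "carre n d a x = real d * (\<Sum>i<n. (chaos n (d - 1) (\<lambda>is. a (i # is)) x)\<^sup>2)"

text \<open>The coefficients in the expansions of \<open>\<Gamma>\<close> and of the square of F in contractions; both come from the
  product formula, in orders d - 1 and d.\<close>

definition carre_coeff :: "nat \<Rightarrow> nat \<Rightarrow> real" where
  "carre_coeff d r = real d * fact (r - 1) * (real ((d - 1) choose (r - 1)))\<^sup>2"

definition square_coeff :: "nat \<Rightarrow> nat \<Rightarrow> real" where
  "square_coeff d r = fact r * (real (d choose r))\<^sup>2"

abbreviation contraction_chaos :: "nat \<Rightarrow> nat \<Rightarrow> nat \<Rightarrow> (nat list \<Rightarrow> real) \<Rightarrow> (nat \<Rightarrow> real) \<Rightarrow> real" where
  "contraction_chaos n d r a \<equiv> chaos n (2 * d - 2 * r) (box_contraction n d r a a)"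

lemma chaos_square:
  assumes "symmetric_array d a"
  shows "(chaos n d a x)\<^sup>2 = (\<Sum>r\<le>d. square_coeff d r * contraction_chaos n d r a x)"
  unfolding power2_eq_square[of "chaos n d a x"] chaos_product[OF assms assms]
  by (simp add: square_coeff_def power2_eq_square mult_2 mult.assoc)

text \<open>The product formula in order d - 1 is applied to every slice; the sum over the slicing index carries
  out one more contraction.\<close>

lemma carre_expansion:
  assumes "symmetric_array d a" "d \<ge> 1"
  shows "carre n d a x = (\<Sum>r=1..d. carre_coeff d r * contraction_chaos n d r a x)"
proof -
  obtain p where d: "d = Suc p" using assms(2) by (cases d) auto
  let ?a = "\<lambda>i is. a (i # is)"
  note sa = symmetric_array_slice[OF assms(1)[unfolded d]]
  have shift: "(\<Sum>r\<le>p. g (Suc r)) = (\<Sum>r=1..Suc p. g r)" for g :: "nat \<Rightarrow> real"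
    by (rule sum.reindex_bij_witness[of _ "\<lambda>r. r - 1" Suc]) auto
  have dp: "d - 1 = p" using d by simp
  have "(\<Sum>i<n. (chaos n p (?a i) x)\<^sup>2)
      = (\<Sum>i<n. \<Sum>r\<le>p. square_coeff p r * contraction_chaos n p r (?a i) x)"
    by (simp add: chaos_square[OF sa])
  also have "\<dots> = (\<Sum>r\<le>p. square_coeff p r * (\<Sum>i<n. contraction_chaos n p r (?a i) x))"
    by (subst sum.swap) (simp add: sum_distrib_left)
  also have "\<dots> = (\<Sum>r\<le>p. square_coeff p r * contraction_chaos n d (Suc r) a x)"
    unfolding d box_contraction_Suc[abs_def] chaos_sum by simp
  finally have *: "(\<Sum>i<n. (chaos n p (?a i) x)\<^sup>2)
      = (\<Sum>r\<le>p. square_coeff p r * contraction_chaos n d (Suc r) a x)" .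
  have coeff: "real d * square_coeff p r = carre_coeff d (Suc r)" for r
    unfolding carre_coeff_def square_coeff_def dp by simp
  have "carre n d a x = (\<Sum>r\<le>p. carre_coeff d (Suc r) * contraction_chaos n d (Suc r) a x)"
    unfolding carre_def dp * sum_distrib_left coeff[symmetric] by (simp only: mult.assoc)
  then show ?thesis
    unfolding shift[of "\<lambda>r. carre_coeff d r * contraction_chaos n d r a x"] d[symmetric] .
qed

text \<open>Contractions of different length give elements of chaoses of different orders, which are
  orthogonal.\<close>

lemma contraction_chaos_inner:
  assumes "r \<le> d" "r' \<le> d"
  shows "(\<integral>x. contraction_chaos n d r a x * contraction_chaos n d r' a x \<partial>gaussn n)
    = (if r = r' then fact (2 * d - 2 * r) * contraction_energy n d r a else 0)"
proof -
  have "2 * d - 2 * r = 2 * d - 2 * r' \<longleftrightarrow> r = r'" using assms by auto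
  then show ?thesis
    using chaos_inner[OF symmetric_symmetrization[of "2 * d - 2 * r'" "box_contraction n d r' a a"],
        of n "2 * d - 2 * r" "symmetrization (2 * d - 2 * r) (box_contraction n d r a a)"]
    by (auto simp: chaos_symmetrization contraction_energy_def power2_eq_square)
qed

lemma contraction_chaos_sums_inner:
  assumes R: "R \<subseteq> {..d}" "R' \<subseteq> {..d}"
  shows "(\<integral>x. (\<Sum>r\<in>R. \<alpha> r * contraction_chaos n d r a x) * (\<Sum>r\<in>R'. \<beta> r * contraction_chaos n d r a x) \<partial>gaussn n)
    = (\<Sum>r\<in>R \<inter> R'. \<alpha> r * \<beta> r * fact (2 * d - 2 * r) * contraction_energy n d r a)"
proof -
  let ?J = "\<lambda>r. contraction_chaos n d r a"
  have fin: "finite R" "finite R'" using R finite_subset by auto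
  have "(\<integral>x. (\<Sum>r\<in>R. \<alpha> r * ?J r x) * (\<Sum>r\<in>R'. \<beta> r * ?J r x) \<partial>gaussn n)
      = (\<integral>x. (\<Sum>r\<in>R. \<Sum>r'\<in>R'. (\<alpha> r * \<beta> r') * (?J r x * ?J r' x)) \<partial>gaussn n)"
    by (simp add: sum_product mult_ac)
  also have "\<dots> = (\<Sum>r\<in>R. \<Sum>r'\<in>R'. (\<alpha> r * \<beta> r') * (\<integral>x. ?J r x * ?J r' x \<partial>gaussn n))"
  proof -
    have int: "integrable (gaussn n) (\<lambda>x. (\<alpha> r * \<beta> r') * (?J r x * ?J r' x))" for r r'
      by (intro tame_integrable tame_mult tame_const) (intro tame_polys chaos_polys)+
    have "(\<integral>x. (\<Sum>r\<in>R. \<Sum>r'\<in>R'. (\<alpha> r * \<beta> r') * (?J r x * ?J r' x)) \<partial>gaussn n)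
        = (\<Sum>r\<in>R. \<integral>x. (\<Sum>r'\<in>R'. (\<alpha> r * \<beta> r') * (?J r x * ?J r' x)) \<partial>gaussn n)"
      by (intro Bochner_Integration.integral_sum Bochner_Integration.integrable_sum int)
    also have "\<dots> = (\<Sum>r\<in>R. \<Sum>r'\<in>R'. \<integral>x. (\<alpha> r * \<beta> r') * (?J r x * ?J r' x) \<partial>gaussn n)"
      by (intro sum.cong refl Bochner_Integration.integral_sum int)
    finally show ?thesis by simp
  qed
  also have "\<dots> = (\<Sum>r\<in>R. \<Sum>r'\<in>R'. if r = r' then \<alpha> r * \<beta> r' * fact (2 * d - 2 * r) * contraction_energy n d r a else 0)"
  proof (intro sum.cong refl)
    fix r r' assume "r \<in> R" "r' \<in> R'"
    then have "r \<le> d" "r' \<le> d" using R by auto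
    from contraction_chaos_inner[OF this, of n a]
    show "(\<alpha> r * \<beta> r') * (\<integral>x. ?J r x * ?J r' x \<partial>gaussn n)
        = (if r = r' then \<alpha> r * \<beta> r' * fact (2 * d - 2 * r) * contraction_energy n d r a else 0)" by simp
  qed
  also have "\<dots> = (\<Sum>r\<in>R. if r \<in> R' then \<alpha> r * \<beta> r * fact (2 * d - 2 * r) * contraction_energy n d r a else 0)"
    using fin by simp
  finally show ?thesis using fin by (simp add: sum.inter_restrict)
qed

text \<open>F is a sum of creation operators applied to slices, and the derivative of F in direction i is d
  times the same slice, so the two slices multiply to \<open>\<Gamma>\<close>.\<close>

lemma chaos_integration_by_parts:
  assumes a: "symmetric_array d a" and d: "d \<ge> 1"
    and f: "\<And>y. (f has_real_derivative f' y) (at y)" and f': "continuous_on UNIV f'"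
    and gf: "\<And>y. \<bar>f y\<bar> \<le> A * (1 + \<bar>y\<bar>) ^ k" and gf': "\<And>y. \<bar>f' y\<bar> \<le> B * (1 + \<bar>y\<bar>) ^ l"
  shows "(\<integral>x. chaos n d a x * f (chaos n d a x) \<partial>gaussn n)
    = (\<integral>x. f' (chaos n d a x) * carre n d a x \<partial>gaussn n)"
proof -
  obtain p where d: "d = Suc p" using d by (cases d) auto
  let ?F = "chaos n d a" and ?c = "\<lambda>i. chaos n p (\<lambda>is. a (i # is))"
  have cf: "continuous_on UNIV f"
    using f by (meson DERIV_continuous continuous_at_imp_continuous_on)
  have tf: "tame n (\<lambda>x. f (?F x))"
    by (intro tame_compose[OF _ _ gf] tame_polys chaos_polys borel_measurable_continuous_onI cf)
  have tf': "tame n (\<lambda>x. f' (?F x))"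
    by (intro tame_compose[OF _ _ gf'] tame_polys chaos_polys borel_measurable_continuous_onI f')
  have pdF: "pd i ?F = (\<lambda>x. real d * ?c i x)" if "i < n" for i
    using pd_chaos[OF a[unfolded d] that] by (simp add: d)
  have *: "(\<integral>x. creation i (?c i) x * f (?F x) \<partial>gaussn n)
      = (\<integral>x. ?c i x * (f' (?F x) * pd i ?F x) \<partial>gaussn n)" if i: "i < n" for i
  proof (rule creation_adjoint[OF i chaos_polys tf])
    show "tame n (\<lambda>x. f' (?F x) * pd i ?F x)"
      by (intro tame_mult tf' tame_polys pd_polys chaos_polys)
    show "((\<lambda>t. f (?F (x(i := t)))) has_real_derivative f' (?F (x(i := t))) * pd i ?F (x(i := t))) (at t)" for x t
      by (rule DERIV_chain2[OF f has_pd[OF chaos_polys]])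
    have cont: "continuous_on UNIV (\<lambda>t. w (x(i := t)))" if "w \<in> polys n" for w x
      using has_pd[OF that] by (meson DERIV_continuous continuous_at_imp_continuous_on)
    show "continuous_on UNIV (\<lambda>t. f' (?F (x(i := t))) * pd i ?F (x(i := t)))" for x
      by (intro continuous_on_mult cont[OF pd_polys[OF chaos_polys]]
          continuous_on_compose2[OF f' cont[OF chaos_polys]]) auto
  qed
  have "(\<integral>x. ?F x * f (?F x) \<partial>gaussn n) = (\<integral>x. (\<Sum>i<n. creation i (?c i) x * f (?F x)) \<partial>gaussn n)"
    by (simp add: d chaos_Suc sum_distrib_right)
  also have "\<dots> = (\<Sum>i<n. \<integral>x. creation i (?c i) x * f (?F x) \<partial>gaussn n)"
    by (intro Bochner_Integration.integral_sum tame_integrable tame_mult tf tame_polys creation_polys chaos_polys) auto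
  also have "\<dots> = (\<Sum>i<n. \<integral>x. f' (?F x) * (real d * (?c i x)\<^sup>2) \<partial>gaussn n)"
    by (intro sum.cong refl, subst *) (auto simp: pdF power2_eq_square mult_ac)
  also have "\<dots> = (\<integral>x. (\<Sum>i<n. f' (?F x) * (real d * (?c i x)\<^sup>2)) \<partial>gaussn n)"
    by (intro Bochner_Integration.integral_sum[symmetric] tame_integrable tame_mult tf' tame_const tame_power
        tame_polys chaos_polys)
  finally show ?thesis by (simp add: carre_def d sum_distrib_left)
qed

lemma chaos_second_moment:
  assumes "symmetric_array d a"
  shows "(\<integral>x. (chaos n d a x)\<^sup>2 \<partial>gaussn n) = fact d * (\<Sum>is\<in>ibox n d. (a is)\<^sup>2)"
  using chaos_inner[OF assms, of n d a] by (simp add: power2_eq_square)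

lemma contraction_full: "box_contraction n d d a a [] = (\<Sum>is\<in>ibox n d. (a is)\<^sup>2)"
  by (simp add: box_contraction_def power2_eq_square)

text \<open>The full contraction is the constant term of \<open>\<Gamma>\<close>, equal to the second moment of F; the other terms
  are centred and orthogonal.\<close>

lemma carre_variance:
  assumes a: "symmetric_array d a" and d: "d \<ge> 1"
  shows "(\<integral>x. (carre n d a x - fact d * (\<Sum>is\<in>ibox n d. (a is)\<^sup>2))\<^sup>2 \<partial>gaussn n)
    = (\<Sum>r=1..d-1. (carre_coeff d r)\<^sup>2 * fact (2 * d - 2 * r) * contraction_energy n d r a)"
proof -
  have "carre n d a x - fact d * (\<Sum>is\<in>ibox n d. (a is)\<^sup>2)
      = (\<Sum>r=1..d-1. carre_coeff d r * contraction_chaos n d r a x)" for x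
  proof -
    have "{1..d} = insert d {1..d-1}" using d by auto
    moreover have "carre_coeff d d = fact d" using d by (cases d) (auto simp: carre_coeff_def)
    moreover have "contraction_chaos n d d a x = (\<Sum>is\<in>ibox n d. (a is)\<^sup>2)"
      by (simp add: chaos_0 contraction_full)
    moreover have "d \<notin> {1..d-1}" using d by auto
    ultimately show ?thesis
      unfolding carre_expansion[OF a d] by simp
  qed
  then have "(\<integral>x. (carre n d a x - fact d * (\<Sum>is\<in>ibox n d. (a is)\<^sup>2))\<^sup>2 \<partial>gaussn n)
      = (\<integral>x. (\<Sum>r\<in>{1..d-1}. carre_coeff d r * contraction_chaos n d r a x)
          * (\<Sum>r\<in>{1..d-1}. carre_coeff d r * contraction_chaos n d r a x) \<partial>gaussn n)"
    by (simp add: power2_eq_square)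
  also have "\<dots> = (\<Sum>r\<in>{1..d-1} \<inter> {1..d-1}. carre_coeff d r * carre_coeff d r * fact (2 * d - 2 * r) * contraction_energy n d r a)"
    by (rule contraction_chaos_sums_inner) auto
  finally show ?thesis by (simp add: power2_eq_square)
qed

text \<open>Integration by parts for \<open>f y = y ^ 3\<close> gives \<open>E F ^ 4 = 3 E (F\<^sup>2 \<Gamma>)\<close>, and both factors have been
  expanded in the same orthogonal family.\<close>

lemma chaos_fourth_moment:
  assumes a: "symmetric_array d a" and d: "d \<ge> 1"
  shows "(\<integral>x. (chaos n d a x) ^ 4 \<partial>gaussn n)
    = 3 * (\<Sum>r=1..d. square_coeff d r * carre_coeff d r * fact (2 * d - 2 * r) * contraction_energy n d r a)"
proof -
  let ?F = "chaos n d a"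
  have "(\<integral>x. ?F x * ?F x ^ 3 \<partial>gaussn n) = (\<integral>x. 3 * (?F x)\<^sup>2 * carre n d a x \<partial>gaussn n)"
  proof (rule chaos_integration_by_parts[OF a d, where f = "\<lambda>y. y ^ 3" and f' = "\<lambda>y. 3 * y\<^sup>2"])
    show "((\<lambda>y. y ^ 3) has_real_derivative 3 * y\<^sup>2) (at y)" for y :: real
      using DERIV_pow[of 3 y] by simp
    show "\<bar>y ^ 3\<bar> \<le> 1 * (1 + \<bar>y\<bar>) ^ 3" for y :: real
      unfolding power_abs by (simp add: power_mono)
    show "\<bar>3 * y\<^sup>2\<bar> \<le> 3 * (1 + \<bar>y\<bar>) ^ 2" for y :: real
      using power_mono[of "\<bar>y\<bar>" "1 + \<bar>y\<bar>" 2] by simp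
    show "continuous_on UNIV (\<lambda>y::real. 3 * y\<^sup>2)"
      by (rule continuous_on_mult[OF continuous_on_const continuous_on_power[OF continuous_on_id]])
  qed
  also have "\<dots> = 3 * (\<integral>x. (?F x)\<^sup>2 * carre n d a x \<partial>gaussn n)"
    by (simp only: mult.assoc integral_mult_right_zero)
  also have "(\<integral>x. (?F x)\<^sup>2 * carre n d a x \<partial>gaussn n)
      = (\<Sum>r\<in>{..d} \<inter> {1..d}. square_coeff d r * carre_coeff d r * fact (2 * d - 2 * r) * contraction_energy n d r a)"
    unfolding chaos_square[OF a] carre_expansion[OF a d] by (rule contraction_chaos_sums_inner) auto
  also have "{..d} \<inter> {1..d} = {1..d}" by auto
  finally show ?thesis by (simp add: power_Suc[symmetric] power4_eq_xxxx power3_eq_cube mult.assoc)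
qed

text \<open>The factor relating the two expansions, d / r, is what makes the fourth cumulant dominate the
  variance of \<open>\<Gamma>\<close>.\<close>

lemma square_carre_coeff:
  assumes "1 \<le> r" "r \<le> d"
  shows "square_coeff d r = carre_coeff d r * real d / real r"
proof -
  obtain p q where [simp]: "d = Suc p" "r = Suc q" using assms by (cases d; cases r) auto
  have "real (Suc q) * real (Suc p choose Suc q) = real (Suc p) * real (p choose q)"
    unfolding of_nat_mult[symmetric] Suc_times_binomial_eq by (subst mult.commute) (rule refl)
  then have *: "real (Suc p choose Suc q) = real (Suc p) * real (p choose q) / real (Suc q)"
    by (metis nonzero_mult_div_cancel_left of_nat_neq_0)
  have alg: "(b * f) * (a * X / b)\<^sup>2 = a * f * X\<^sup>2 * a / b" if "b \<noteq> 0" for a b f X :: real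
    using that by (simp add: power2_eq_square)
  show ?thesis
    using alg[of "real (Suc q)" "fact q" "real (Suc p)" "real (p choose q)"]
    unfolding square_coeff_def carre_coeff_def \<open>d = Suc p\<close> \<open>r = Suc q\<close> * fact_Suc diff_Suc_1
    by (simp del: of_nat_Suc)
qed

lemma contraction_energy_nonneg: "contraction_energy n d r a \<ge> 0"
  by (simp add: contraction_energy_def sum_nonneg)

lemma contraction_energy_full: "contraction_energy n d d a = (\<Sum>is\<in>ibox n d. (a is)\<^sup>2)\<^sup>2"
  by (simp add: contraction_energy_def symmetrization_def contraction_full)

text \<open>The full contraction accounts for three times the squared variance of F. The remaining terms are
  those of the variance of \<open>\<Gamma>\<close>, each multiplied by 3 d / r, and r is at most d - 1.\<close>

lemma fourth_cumulant_bound: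
  assumes a: "symmetric_array d a" and d: "d \<ge> 1"
  shows "(\<Sum>r=1..d-1. (carre_coeff d r)\<^sup>2 * fact (2 * d - 2 * r) * contraction_energy n d r a)
    \<le> (real d - 1) / (3 * real d) * ((\<integral>x. (chaos n d a x) ^ 4 \<partial>gaussn n)
        - 3 * (fact d * (\<Sum>is\<in>ibox n d. (a is)\<^sup>2))\<^sup>2)"
proof -
  let ?e = "\<lambda>r. fact (2 * d - 2 * r) * contraction_energy n d r a"
  have coeff: "carre_coeff d d = fact d" "square_coeff d d = fact d"
    using d by (cases d; auto simp: carre_coeff_def square_coeff_def)+
  have "{1..d} = insert d {1..d-1}" "d \<notin> {1..d-1}" using d by auto
  then have "(\<integral>x. (chaos n d a x) ^ 4 \<partial>gaussn n)
      = 3 * (square_coeff d d * carre_coeff d d * ?e d + (\<Sum>r=1..d-1. square_coeff d r * carre_coeff d r * ?e r))"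
    unfolding chaos_fourth_moment[OF a d] by (simp only: sum.insert finite_atLeastAtMost mult.assoc) simp
  also have "square_coeff d d * carre_coeff d d * ?e d = (fact d * (\<Sum>is\<in>ibox n d. (a is)\<^sup>2))\<^sup>2"
    unfolding coeff contraction_energy_full by (simp add: power_mult_distrib power2_eq_square)
  finally have "(\<integral>x. (chaos n d a x) ^ 4 \<partial>gaussn n)
      = 3 * ((fact d * (\<Sum>is\<in>ibox n d. (a is)\<^sup>2))\<^sup>2 + (\<Sum>r=1..d-1. square_coeff d r * carre_coeff d r * ?e r))" .
  then have "(real d - 1) / (3 * real d) * ((\<integral>x. (chaos n d a x) ^ 4 \<partial>gaussn n)
        - 3 * (fact d * (\<Sum>is\<in>ibox n d. (a is)\<^sup>2))\<^sup>2)
      = (real d - 1) / (3 * real d) * (3 * (\<Sum>r=1..d-1. square_coeff d r * carre_coeff d r * ?e r))"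
    by (simp only: distrib_left add_diff_cancel_left')
  also have "\<dots> = (\<Sum>r=1..d-1. (real d - 1) / real d * (square_coeff d r * carre_coeff d r * ?e r))"
    by (simp add: sum_distrib_left mult.assoc)
  also have "\<dots> \<ge> (\<Sum>r=1..d-1. (carre_coeff d r)\<^sup>2 * ?e r)"
  proof (rule sum_mono)
    fix r assume r: "r \<in> {1..d-1}"
    then have "real r \<le> real d - 1" "real r > 0" "real d > 0" by (auto simp: of_nat_diff)
    then have "1 \<le> (real d - 1) / real r" by simp
    then have "1 \<le> (real d - 1) / real d * (real d / real r)" using \<open>real d > 0\<close> by simp
    then have "1 * ((carre_coeff d r)\<^sup>2 * ?e r)
        \<le> ((real d - 1) / real d * (real d / real r)) * ((carre_coeff d r)\<^sup>2 * ?e r)"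
      by (intro mult_right_mono mult_nonneg_nonneg) (auto simp: contraction_energy_nonneg)
    also have "\<dots> = (real d - 1) / real d * (square_coeff d r * carre_coeff d r * ?e r)"
    proof -
      have "r \<le> d" "1 \<le> r" using r by auto
      then have "square_coeff d r = carre_coeff d r * real d / real r" by (intro square_carre_coeff)
      then show ?thesis by (simp add: power2_eq_square)
    qed
    finally show "(carre_coeff d r)\<^sup>2 * ?e r \<le> (real d - 1) / real d * (square_coeff d r * carre_coeff d r * ?e r)"
      by simp
  qed
  finally show ?thesis by (simp add: mult.assoc)
qed

definition hyper_const :: "nat \<Rightarrow> real" where
  "hyper_const d = 3 * (\<Sum>r=1..d. square_coeff d r * carre_coeff d r * fact (2 * d - 2 * r))"

text \<open>Equivalence of the second and fourth moments on a fixed chaos. It is read off the formula for the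
  fourth moment, because contracting does not increase norms; the hypothesis e expresses this.\<close>

lemma hypercontractivity:
  assumes a: "symmetric_array d a" and d: "d \<ge> 1"
    and e: "\<And>r. r \<in> {1..d} \<Longrightarrow> contraction_energy n d r a \<le> (\<Sum>is\<in>ibox n d. (a is)\<^sup>2)\<^sup>2"
  shows "(\<integral>x. (chaos n d a x) ^ 4 \<partial>gaussn n) \<le> hyper_const d * (\<integral>x. (chaos n d a x)\<^sup>2 \<partial>gaussn n)\<^sup>2"
proof -
  let ?s = "\<Sum>is\<in>ibox n d. (a is)\<^sup>2"
  have H: "hyper_const d \<ge> 0"
    unfolding hyper_const_def by (auto intro!: sum_nonneg simp: square_coeff_def carre_coeff_def)
  have "(\<integral>x. (chaos n d a x) ^ 4 \<partial>gaussn n)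
      \<le> 3 * (\<Sum>r=1..d. square_coeff d r * carre_coeff d r * fact (2 * d - 2 * r) * ?s\<^sup>2)"
    unfolding chaos_fourth_moment[OF a d]
    by (intro mult_left_mono sum_mono e) (auto simp: square_coeff_def carre_coeff_def)
  also have "\<dots> = hyper_const d * ?s\<^sup>2"
    by (simp add: hyper_const_def sum_distrib_right)
  also have "\<dots> \<le> hyper_const d * (fact d * ?s)\<^sup>2"
  proof (intro mult_left_mono power_mono H)
    have "0 \<le> ?s" by (simp add: sum_nonneg)
    then show "?s \<le> fact d * ?s" using mult_right_mono[of 1 "fact d" ?s] by simp
    show "0 \<le> ?s" by fact
  qed
  finally show ?thesis by (simp add: chaos_second_moment[OF a])
qed

section \<open>Stein's equation on the real line\<close>

text \<open>For a standard normal variable Z, the mean of w(Z) over the events Z < x and Z >= x.\<close>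

definition lower :: "(real \<Rightarrow> real) \<Rightarrow> real \<Rightarrow> real" where
  "lower w x = (\<integral>y. indicator {..<x} y * w y \<partial>gauss)"

definition upper :: "(real \<Rightarrow> real) \<Rightarrow> real \<Rightarrow> real" where
  "upper w x = (\<integral>y. indicator {x..} y * w y \<partial>gauss)"

lemma integrable_lower:
  fixes w :: "real \<Rightarrow> real"
  shows "integrable gauss w \<Longrightarrow> integrable gauss (\<lambda>y. indicator {..<x} y * w y)"
  using integrable_mult_indicator[of "{..<x}" gauss w] by simp

lemma integrable_upper:
  fixes w :: "real \<Rightarrow> real"
  shows "integrable gauss w \<Longrightarrow> integrable gauss (\<lambda>y. indicator {x..} y * w y)"
  using integrable_mult_indicator[of "{x..}" gauss w] by simp

lemma lower_plus_upper:
  assumes "integrable gauss w"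
  shows "lower w x + upper w x = (\<integral>y. w y \<partial>gauss)"
  unfolding lower_def upper_def
  by (subst Bochner_Integration.integral_add[symmetric])
    (auto intro!: integrable_lower integrable_upper assms Bochner_Integration.integral_cong split: split_indicator)

lemma tendsto_lower_at_top:
  assumes "integrable gauss w"
  shows "(lower w \<longlongrightarrow> (\<integral>y. w y \<partial>gauss)) at_top"
  unfolding lower_def[abs_def]
proof (rule integral_dominated_convergence_at_top[where w = "\<lambda>y. \<bar>w y\<bar>"])
  show "AE y in gauss. ((\<lambda>x. indicator {..<x} y * w y) \<longlongrightarrow> w y) at_top"
    by (intro AE_I2 tendsto_eventually eventually_mono[OF eventually_gt_at_top]) (auto split: split_indicator)
qed (use assms in \<open>auto split: split_indicator\<close>)

lemma tendsto_lower_at_bot: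
  assumes "integrable gauss w"
  shows "(lower w \<longlongrightarrow> 0) at_bot"
  unfolding filterlim_at_bot_mirror
proof -
  have "((\<lambda>x. \<integral>y. indicator {..<- x} y * w y \<partial>gauss) \<longlongrightarrow> (\<integral>y. 0 \<partial>gauss)) at_top"
  proof (rule integral_dominated_convergence_at_top[where w = "\<lambda>y. \<bar>w y\<bar>"])
    have "\<forall>\<^sub>F x in at_top. indicator {..<- x} y * w y = 0" for y
      using eventually_ge_at_top[of "- y"] by eventually_elim (auto split: split_indicator)
    then show "AE y in gauss. ((\<lambda>x. indicator {..<- x} y * w y) \<longlongrightarrow> 0) at_top"
      by (intro AE_I2 tendsto_eventually)
  qed (use assms in \<open>auto split: split_indicator\<close>)
  then show "((\<lambda>x. lower w (- x)) \<longlongrightarrow> 0) at_top" by (simp add: lower_def)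
qed

lemma continuous_on_std_normal_density: "continuous_on S std_normal_density"
  using DERIV_std_normal_density by (meson DERIV_continuous continuous_at_imp_continuous_on)

lemma DERIV_lower:
  assumes int: "integrable gauss w" and c: "continuous_on UNIV w"
  shows "(lower w has_real_derivative std_normal_density x * w x) (at x)"
proof -
  let ?h = "\<lambda>y. std_normal_density y * w y"
  have [measurable]: "w \<in> borel_measurable borel" using c by (rule borel_measurable_continuous_onI)
  have intl: "integrable lborel ?h"
    using int unfolding gauss_def by (simp add: integrable_density)
  have ch: "continuous_on S ?h" for S
    by (intro continuous_on_mult continuous_on_std_normal_density continuous_on_subset[OF c]) auto
  have split: "lower w y = lower w (x - 1) + integral {x - 1..y} ?h" if "x - 1 \<le> y" for y
  proof -
    have "integral {x - 1..y} ?h = (LINT z:{x - 1..y}|lborel. ?h z)"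
      by (rule set_borel_integral_eq_integral(2)[symmetric])
        (simp add: set_integrable_def integrable_mult_indicator[OF _ intl, simplified])
    also have "\<dots> = (\<integral>z. ?h z * indicator {x - 1..<y} z \<partial>lborel)"
      unfolding set_lebesgue_integral_def
      using AE_lborel_singleton[of y]
      by (intro integral_cong_AE) (auto split: split_indicator elim!: eventually_mono)
    also have "\<dots> = (\<integral>z. indicator {x - 1..<y} z * w z \<partial>gauss)"
      by (subst integral_gauss) (auto simp: mult_ac)
    also have "lower w (x - 1) + \<dots> = lower w y"
      unfolding lower_def
    proof (subst Bochner_Integration.integral_add[symmetric])
      show "integrable gauss (\<lambda>z. indicator {x - 1..<y} z * w z)"
        using integrable_mult_indicator[of "{x - 1..<y}" gauss w] int by simp
    qed (use that in \<open>auto intro!: integrable_lower int Bochner_Integration.integral_cong split: split_indicator\<close>)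
    finally show ?thesis by simp
  qed
  have "((\<lambda>y. integral {x - 1..y} ?h) has_real_derivative ?h x) (at x within {x - 1..x + 1})"
    by (rule integral_has_real_derivative[OF ch]) auto
  moreover have "at x within {x - 1..x + 1} = at x"
    by (rule at_within_interior) auto
  ultimately have "((\<lambda>y. lower w (x - 1) + integral {x - 1..y} ?h) has_real_derivative 0 + ?h x) (at x)"
    by (intro DERIV_add) auto
  then have D: "((\<lambda>y. lower w (x - 1) + integral {x - 1..y} ?h) has_real_derivative ?h x) (at x)" by simp
  show ?thesis
    by (rule has_field_derivative_transform_within_open[OF D, of "{x - 1<..}"]) (auto intro!: split[symmetric])
qed

text \<open>Both sides have the same derivative and the same limit at minus infinity.\<close>

lemma lower_eq_antiderivative:
  assumes int: "integrable gauss w" and c: "continuous_on UNIV w"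
    and K: "\<And>x. (K has_real_derivative std_normal_density x * w x) (at x)" and K0: "(K \<longlongrightarrow> 0) at_bot"
  shows "lower w x = K x"
proof -
  have "((\<lambda>x. lower w x - K x) has_real_derivative 0) (at x)" for x
    using DERIV_diff[OF DERIV_lower[OF int c] K] by simp
  then obtain a where a: "\<And>x. lower w x - K x = a"
    by (metis DERIV_isconst_all)
  have "((\<lambda>x. lower w x - K x) \<longlongrightarrow> 0 - 0) at_bot"
    by (intro tendsto_diff tendsto_lower_at_bot int K0)
  then have "a = 0" unfolding a by (simp add: tendsto_const_iff)
  then show ?thesis using a[of x] by simp
qed

lemma integrable_gauss_power: "integrable gauss (\<lambda>y. y ^ k)"
  by (rule integrable_gauss_poly_growth[where C = 1 and k = k]) (auto simp: power_abs intro!: power_mono)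

lemma integrable_gauss_const: "integrable gauss (\<lambda>_. c :: real)"
  by (rule integrable_gauss_poly_growth[where C = "\<bar>c\<bar>" and k = 0]) auto

lemma std_normal_density_poly_at_bot:
  "((\<lambda>x. - std_normal_density x) \<longlongrightarrow> 0) at_bot"
  "((\<lambda>x. - (x\<^sup>2 + 2) * std_normal_density x) \<longlongrightarrow> 0) at_bot"
  unfolding std_normal_density_def by real_asymp+

lemma lower_id: "lower (\<lambda>y. y) x = - std_normal_density x"
proof (rule lower_eq_antiderivative)
  show "((\<lambda>x. - std_normal_density x) has_real_derivative std_normal_density x * x) (at x)" for x
    using DERIV_minus[OF DERIV_std_normal_density[of x]] by (simp add: mult.commute)
qed (use integrable_gauss_power[of 1] std_normal_density_poly_at_bot in \<open>auto intro: continuous_intros\<close>)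

lemma lower_cube: "lower (\<lambda>y. y ^ 3) x = - (x\<^sup>2 + 2) * std_normal_density x"
proof (rule lower_eq_antiderivative)
  have "((\<lambda>x::real. - (x\<^sup>2 + 2)) has_real_derivative - (2 * x)) (at x)" for x :: real
    by (auto intro!: derivative_eq_intros)
  from DERIV_mult'[OF this DERIV_std_normal_density]
  show "((\<lambda>x. - (x\<^sup>2 + 2) * std_normal_density x) has_real_derivative std_normal_density x * x ^ 3) (at x)" for x
    by (rule DERIV_cong) (simp add: power2_eq_square power3_eq_cube algebra_simps)
qed (use integrable_gauss_power[of 3] std_normal_density_poly_at_bot in \<open>auto intro!: continuous_on_power continuous_on_id\<close>)

lemma gauss_odd_moments: "(\<integral>y. y \<partial>gauss) = 0" "(\<integral>y. y ^ 3 \<partial>gauss) = 0"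
proof -
  show 1: "(\<integral>y. y \<partial>gauss) = 0"
    using gauss_integration_by_parts[of "\<lambda>_. 1" "\<lambda>_. 0" 1 0 0 0] by simp
  have "(\<integral>y. y * y ^ 2 \<partial>gauss) = (\<integral>y. 2 * y \<partial>gauss)"
  proof (rule gauss_integration_by_parts[where v = "\<lambda>y. y ^ 2" and v' = "\<lambda>y. 2 * y"])
    show "((\<lambda>y. y ^ 2) has_real_derivative 2 * y) (at y)" for y :: real
      using DERIV_pow[of 2 y] by simp
    show "\<bar>y ^ 2\<bar> \<le> 1 * (1 + \<bar>y\<bar>) ^ 2" for y :: real
      using power_mono[of "\<bar>y\<bar>" "1 + \<bar>y\<bar>" 2] by simp
    show "\<bar>2 * y\<bar> \<le> 2 * (1 + \<bar>y\<bar>) ^ 1" for y :: real by simp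
  qed (intro continuous_on_mult continuous_on_const continuous_on_id)
  then show "(\<integral>y. y ^ 3 \<partial>gauss) = 0" using 1 by (simp add: power3_eq_cube power2_eq_square mult.assoc)
qed

abbreviation "normal_cdf \<equiv> lower (\<lambda>_. 1)"

lemma upper_one: "upper (\<lambda>_. 1) x = 1 - normal_cdf x"
  using lower_plus_upper[OF integrable_gauss_const[of 1], of x] prob_space.prob_space[OF prob_space_gauss] by simp

lemma upper_id: "upper (\<lambda>y. y) x = std_normal_density x"
  using lower_plus_upper[OF integrable_gauss_power[of 1], of x] lower_id[of x] gauss_odd_moments by simp

lemma upper_cube: "upper (\<lambda>y. y ^ 3) x = (x\<^sup>2 + 2) * std_normal_density x"
  using lower_plus_upper[OF integrable_gauss_power[of 3], of x] lower_cube[of x] gauss_odd_moments by (simp add: algebra_simps)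

lemma lower_mono:
  assumes "integrable gauss v" "integrable gauss w" "\<And>y. y < x \<Longrightarrow> v y \<le> w y"
  shows "lower v x \<le> lower w x"
  unfolding lower_def
  by (rule integral_mono) (use assms in \<open>auto intro: integrable_lower split: split_indicator\<close>)

lemma upper_mono:
  assumes "integrable gauss v" "integrable gauss w" "\<And>y. y \<ge> x \<Longrightarrow> v y \<le> w y"
  shows "upper v x \<le> upper w x"
  unfolding upper_def
  by (rule integral_mono) (use assms in \<open>auto intro: integrable_upper split: split_indicator\<close>)

lemma lower_cmult: "lower (\<lambda>y. c * w y) x = c * lower w x"
  unfolding lower_def by (simp add: mult.left_commute)

lemma upper_cmult: "upper (\<lambda>y. c * w y) x = c * upper w x"
  unfolding upper_def by (simp add: mult.left_commute)

lemma lower_add: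
  assumes "integrable gauss v" "integrable gauss w"
  shows "lower (\<lambda>y. v y + w y) x = lower v x + lower w x"
  unfolding lower_def
  by (subst Bochner_Integration.integral_add[symmetric]) (auto intro: integrable_lower assms simp: distrib_left)

lemma upper_add:
  assumes "integrable gauss v" "integrable gauss w"
  shows "upper (\<lambda>y. v y + w y) x = upper v x + upper w x"
  unfolding upper_def
  by (subst Bochner_Integration.integral_add[symmetric]) (auto intro: integrable_upper assms simp: distrib_left)

lemma abs_lower_le:
  assumes v: "integrable gauss v" and w: "integrable gauss w" and "\<And>y. y < x \<Longrightarrow> \<bar>v y\<bar> \<le> w y"
  shows "\<bar>lower v x\<bar> \<le> lower w x"
proof -
  have "lower v x \<le> lower w x" by (rule lower_mono[OF v w]) (use assms(3) in force)
  moreover have "lower (\<lambda>y. (-1) * v y) x \<le> lower w x"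
    by (rule lower_mono[OF _ w]) (use assms(3) v in \<open>force+\<close>)
  ultimately show ?thesis by (simp only: lower_cmult)
qed

lemma abs_upper_le:
  assumes v: "integrable gauss v" and w: "integrable gauss w" and "\<And>y. y \<ge> x \<Longrightarrow> \<bar>v y\<bar> \<le> w y"
  shows "\<bar>upper v x\<bar> \<le> upper w x"
proof -
  have "upper v x \<le> upper w x" by (rule upper_mono[OF v w]) (use assms(3) in force)
  moreover have "upper (\<lambda>y. (-1) * v y) x \<le> upper w x"
    by (rule upper_mono[OF _ w]) (use assms(3) v in \<open>force+\<close>)
  ultimately show ?thesis by (simp only: upper_cmult)
qed

lemma integrable_gauss_cubic: "integrable gauss (\<lambda>y. b * y + c * y ^ 3)"
  using integrable_gauss_power[of 1] integrable_gauss_power[of 3]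
  by (intro Bochner_Integration.integrable_add integrable_mult_right) auto

lemma lower_cubic:
  "lower (\<lambda>y. a * 1 + (b * y + c * y ^ 3)) x
    = a * normal_cdf x - b * std_normal_density x - c * (x\<^sup>2 + 2) * std_normal_density x"
proof -
  have i: "integrable gauss (\<lambda>y::real. y)" using integrable_gauss_power[of 1] by simp
  have "lower (\<lambda>y. a * 1 + (b * y + c * y ^ 3)) x = lower (\<lambda>y. a * 1) x + lower (\<lambda>y. b * y + c * y ^ 3) x"
    by (rule lower_add[OF integrable_mult_right[OF integrable_gauss_const] integrable_gauss_cubic])
  also have "lower (\<lambda>y. b * y + c * y ^ 3) x = lower (\<lambda>y. b * y) x + lower (\<lambda>y. c * y ^ 3) x"
    by (rule lower_add[OF integrable_mult_right[OF i] integrable_mult_right[OF integrable_gauss_power]])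
  finally show ?thesis unfolding lower_cmult lower_id lower_cube by (simp add: algebra_simps)
qed

lemma upper_cubic:
  "upper (\<lambda>y. a * 1 + (b * y + c * y ^ 3)) x
    = a * (1 - normal_cdf x) + b * std_normal_density x + c * (x\<^sup>2 + 2) * std_normal_density x"
proof -
  have i: "integrable gauss (\<lambda>y::real. y)" using integrable_gauss_power[of 1] by simp
  have "upper (\<lambda>y. a * 1 + (b * y + c * y ^ 3)) x = upper (\<lambda>y. a * 1) x + upper (\<lambda>y. b * y + c * y ^ 3) x"
    by (rule upper_add[OF integrable_mult_right[OF integrable_gauss_const] integrable_gauss_cubic])
  also have "upper (\<lambda>y. b * y + c * y ^ 3) x = upper (\<lambda>y. b * y) x + upper (\<lambda>y. c * y ^ 3) x"
    by (rule upper_add[OF integrable_mult_right[OF i] integrable_mult_right[OF integrable_gauss_power]])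
  finally show ?thesis unfolding upper_cmult upper_one upper_id upper_cube by (simp add: algebra_simps)
qed

text \<open>The solution of Stein's equation for g; its derivative is read off the equation.\<close>

definition stein :: "(real \<Rightarrow> real) \<Rightarrow> real \<Rightarrow> real" where
  "stein g x = lower (\<lambda>y. g y - (\<integral>z. g z \<partial>gauss)) x / std_normal_density x"

definition stein_deriv :: "(real \<Rightarrow> real) \<Rightarrow> real \<Rightarrow> real" where
  "stein_deriv g x = x * stein g x + (g x - (\<integral>z. g z \<partial>gauss))"

lemma std_normal_density_pos: "std_normal_density x > 0"
  by (rule normal_density_pos) simp

lemma integrable_centred:
  fixes g :: "real \<Rightarrow> real"
  shows "integrable gauss g \<Longrightarrow> integrable gauss (\<lambda>y. g y - c)"
  by (intro Bochner_Integration.integrable_diff integrable_gauss_const)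

lemma DERIV_stein:
  assumes "integrable gauss g" "continuous_on UNIV g"
  shows "(stein g has_real_derivative stein_deriv g x) (at x)"
proof -
  let ?c = "\<integral>z. g z \<partial>gauss" and ?p = std_normal_density
  have p: "?p x \<noteq> 0" using std_normal_density_pos[of x] by simp
  have "(lower (\<lambda>y. g y - ?c) has_real_derivative ?p x * (g x - ?c)) (at x)"
    by (intro DERIV_lower integrable_centred assms continuous_on_diff continuous_on_const)
  from DERIV_divide[OF this DERIV_std_normal_density p]
  have "((\<lambda>x. lower (\<lambda>y. g y - ?c) x / ?p x) has_real_derivative
      (?p x * (g x - ?c) * ?p x - lower (\<lambda>y. g y - ?c) x * (- x * ?p x)) / (?p x * ?p x)) (at x)" .
  moreover have "(?p x * (g x - ?c) * ?p x - lower (\<lambda>y. g y - ?c) x * (- x * ?p x)) / (?p x * ?p x) = stein_deriv g x"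
    using p by (simp add: stein_deriv_def stein_def field_simps)
  ultimately show ?thesis by (simp add: stein_def[abs_def])
qed

lemma continuous_stein_deriv:
  assumes "integrable gauss g" "continuous_on UNIV g"
  shows "continuous_on UNIV (stein_deriv g)"
proof -
  have "continuous_on UNIV (stein g)"
    using DERIV_stein[OF assms] by (meson DERIV_continuous continuous_at_imp_continuous_on)
  then show ?thesis
    unfolding stein_deriv_def[abs_def] by (intro continuous_intros assms(2))
qed

lemma lower_centred:
  assumes "integrable gauss g"
  shows "lower (\<lambda>y. g y - (\<integral>z. g z \<partial>gauss)) x = - upper (\<lambda>y. g y - (\<integral>z. g z \<partial>gauss)) x"
proof -
  have "(\<integral>y. g y - (\<integral>z. g z \<partial>gauss) \<partial>gauss) = 0"
    using assms prob_space.prob_space[OF prob_space_gauss]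
    by (subst Bochner_Integration.integral_diff) (auto intro: integrable_gauss_const)
  then show ?thesis using lower_plus_upper[OF integrable_centred[OF assms], of "\<integral>z. g z \<partial>gauss" x] by simp
qed

text \<open>Stein's equation reduces the claim to \<open>\<bar>x * stein g x\<bar> \<le> 1\<close>. Since g is centred, the defining
  integral can be taken over the side of x away from the origin, where the modulus of x is at most
  that of the integration variable, and the integral of the latter is the density at x.\<close>

lemma stein_deriv_bound_bounded:
  assumes g: "integrable gauss g" and b: "\<And>y. \<bar>g y - (\<integral>z. g z \<partial>gauss)\<bar> \<le> 1"
  shows "\<bar>stein_deriv g x\<bar> \<le> 2"
proof -
  let ?c = "\<integral>z. g z \<partial>gauss" and ?p = std_normal_density
  note ig = integrable_centred[OF g]
  have id: "integrable gauss (\<lambda>y. y)" using integrable_gauss_power[of 1] by simp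
  have "\<bar>x * lower (\<lambda>y. g y - ?c) x\<bar> \<le> ?p x"
  proof (cases "x \<ge> 0")
    case True
    have "\<bar>upper (\<lambda>y. x * (g y - ?c)) x\<bar> \<le> upper (\<lambda>y. y) x"
    proof (rule abs_upper_le[OF _ id])
      show "\<bar>x * (g y - ?c)\<bar> \<le> y" if "x \<le> y" for y
        using mult_mono[of x y "\<bar>g y - ?c\<bar>" 1] that True b[of y] by (simp add: abs_mult)
    qed (intro integrable_mult_right ig)
    then show ?thesis unfolding upper_cmult upper_id lower_centred[OF g] by simp
  next
    case False
    have "\<bar>lower (\<lambda>y. x * (g y - ?c)) x\<bar> \<le> lower (\<lambda>y. (-1) * y) x"
    proof (rule abs_lower_le)
      show "\<bar>x * (g y - ?c)\<bar> \<le> (-1) * y" if "y < x" for y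
        using mult_mono[of "- x" "- y" "\<bar>g y - ?c\<bar>" 1] that False b[of y] by (simp add: abs_mult)
    qed (intro integrable_mult_right ig id)+
    then show ?thesis unfolding lower_cmult lower_id by simp
  qed
  then have "\<bar>x * stein g x\<bar> \<le> 1"
    unfolding stein_def times_divide_eq_right abs_divide
    using std_normal_density_pos[of x] by (simp add: divide_le_eq_1)
  then show ?thesis unfolding stein_deriv_def using b[of x] by linarith
qed

text \<open>This is \<open>E (Z - x)\<^sup>+\<close> for a standard normal variable Z.\<close>

definition mills_gap :: "real \<Rightarrow> real" where
  "mills_gap x = std_normal_density x - x * (1 - normal_cdf x)"

lemma mills_gap_nonneg: "mills_gap x \<ge> 0"
proof -
  have "upper (\<lambda>y. x * 1) x \<le> upper (\<lambda>y. y) x"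
    using integrable_gauss_power[of 1] by (intro upper_mono) (auto intro: integrable_gauss_const)
  then show ?thesis unfolding upper_cmult upper_id upper_one by (simp add: mills_gap_def)
qed

lemma DERIV_normal_cdf: "(normal_cdf has_real_derivative std_normal_density x) (at x)"
  using DERIV_lower[OF integrable_gauss_const continuous_on_const, of 1 x] by simp

lemma normal_cdf_at_top: "(normal_cdf \<longlongrightarrow> 1) at_top"
  using tendsto_lower_at_top[OF integrable_gauss_const, of 1] prob_space.prob_space[OF prob_space_gauss] by simp

text \<open>Symmetry of the normal law: the sum of the two values has derivative zero and tends to 1.\<close>

lemma normal_cdf_minus: "normal_cdf (- x) = 1 - normal_cdf x"
proof -
  have D: "((\<lambda>x. normal_cdf x + normal_cdf (- x)) has_real_derivative 0) (at x)" for x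
  proof -
    have "((\<lambda>x. normal_cdf (- x)) has_real_derivative std_normal_density (- x) * (- 1)) (at x)"
      by (rule DERIV_chain2[OF DERIV_normal_cdf]) (auto intro!: derivative_eq_intros)
    from DERIV_add[OF DERIV_normal_cdf this] show ?thesis by (simp add: std_normal_density_def)
  qed
  define c where "c = normal_cdf 0 + normal_cdf (- 0)"
  have a: "normal_cdf x + normal_cdf (- x) = c" for x
    using D DERIV_isconst_all[of "\<lambda>x. normal_cdf x + normal_cdf (- x)" x 0] unfolding c_def by blast
  have "((\<lambda>x. normal_cdf (- x)) \<longlongrightarrow> 0) at_top"
    using tendsto_lower_at_bot[OF integrable_gauss_const, of 1] by (simp add: filterlim_at_bot_mirror)
  then have "((\<lambda>x. normal_cdf x + normal_cdf (- x)) \<longlongrightarrow> 1 + 0) at_top"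
    by (intro tendsto_add normal_cdf_at_top)
  then have "c = 1" unfolding a by (simp add: tendsto_const_iff)
  then show ?thesis using a[of x] by simp
qed

lemma mills_gap_minus: "mills_gap (- x) = mills_gap x + x"
  by (simp add: mills_gap_def normal_cdf_minus std_normal_density_def algebra_simps)

text \<open>Birnbaum's bound for the Mills ratio: the difference of the two sides is decreasing and tends to
  zero at infinity.\<close>

lemma normal_tail_lower_bound:
  assumes "x \<ge> 0"
  shows "(sqrt (x\<^sup>2 + 4) - x) / 2 * std_normal_density x \<le> 1 - normal_cdf x"
proof -
  define u where "u = (\<lambda>x. (sqrt (x\<^sup>2 + 4) - x) / 2)"
  let ?p = std_normal_density
  let ?D = "\<lambda>x. 1 - normal_cdf x - u x * ?p x"
  have D: "\<exists>D'. (?D has_real_derivative D') (at y) \<and> D' \<le> 0" for y :: real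
  proof -
    define s where "s = sqrt (y\<^sup>2 + 4)"
    have s: "s > 0" "s\<^sup>2 = y\<^sup>2 + 4" "s \<ge> \<bar>y\<bar>"
      unfolding s_def by (auto intro!: add_nonneg_pos real_le_rsqrt)
    have pos: "4 + y\<^sup>2 > 0" by (simp add: add_pos_nonneg)
    have du: "(u has_real_derivative (y / s - 1) / 2) (at y)"
      unfolding u_def s_def
      by (auto intro!: derivative_eq_intros simp: field_simps) (use pos in linarith)+
    have "(?D has_real_derivative 0 - ?p y - (u y * (- y * ?p y) + (y / s - 1) / 2 * ?p y)) (at y)"
      by (intro DERIV_diff DERIV_const DERIV_normal_cdf DERIV_mult' du DERIV_std_normal_density)
    moreover have "0 - ?p y - (u y * (- y * ?p y) + (y / s - 1) / 2 * ?p y)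
        = ?p y * (- 1 + (s - y) / 2 * y + (1 - y / s) / 2)"
      by (simp add: u_def s_def algebra_simps add_divide_distrib diff_divide_distrib)
    moreover have "- 1 + (s - y) / 2 * y + (1 - y / s) / 2 \<le> 0"
    proof -
      define v where "v = (s - y) / 2"
      have v: "v \<ge> 0" "v + y \<le> s" "v * (v + y) = 1"
        using s by (auto simp: v_def power2_eq_square field_simps)
      have "1 \<le> v * s" using mult_left_mono[OF v(2,1)] v(3) by simp
      then have "v \<le> v * v * s" using mult_left_mono[of 1 "v * s" v] v(1) by (simp add: mult.assoc)
      then have "v / s \<le> v * v" using s(1) by (simp add: divide_le_eq)
      moreover have "(1 - y / s) / 2 = v / s" using s(1) by (simp add: v_def field_simps)
      moreover have "- 1 + v * y = - (v * v)" using v(3) by (simp add: algebra_simps)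
      ultimately show ?thesis unfolding v_def[symmetric] by linarith
    qed
    ultimately have "(?D has_real_derivative ?p y * (- 1 + (s - y) / 2 * y + (1 - y / s) / 2)) (at y)"
      "?p y * (- 1 + (s - y) / 2 * y + (1 - y / s) / 2) \<le> 0"
      using std_normal_density_pos[of y] by (simp_all only: mult_nonneg_nonpos less_imp_le)
    then show ?thesis by blast
  qed
  have lim: "(?D \<longlongrightarrow> 1 - 1 - 0) at_top"
  proof (intro tendsto_diff tendsto_const normal_cdf_at_top)
    show "((\<lambda>x. u x * ?p x) \<longlongrightarrow> 0) at_top"
      unfolding u_def std_normal_density_def by real_asymp
  qed
  have "?D x \<ge> 0"
  proof (rule tendsto_upperbound[OF lim[simplified]])
    show "\<forall>\<^sub>F y in at_top. ?D y \<le> ?D x"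
      using eventually_ge_at_top[of x]
      by eventually_elim (rule DERIV_nonpos_imp_nonincreasing, use D in auto)
  qed simp
  then show ?thesis by (simp add: u_def)
qed

lemma std_normal_density_le: "std_normal_density x \<le> 41 / 100"
proof -
  (* Since pi > 3, the square root of 2 pi exceeds 2.44, and 1 / 2.44 is less than 0.41. *)
  have "(244 / 100)\<^sup>2 \<le> 2 * pi" using pi_gt3 by (simp add: power2_eq_square)
  then have "244 / 100 \<le> sqrt (2 * pi)" by (rule real_le_rsqrt)
  then have "1 / sqrt (2 * pi) \<le> 1 / (244 / 100)" by (intro divide_left_mono) auto
  then have "1 / sqrt (2 * pi) * exp (- x\<^sup>2 / 2) \<le> 41 / 100 * 1"
    by (intro mult_mono) auto
  then show ?thesis by (simp add: std_normal_density_def)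
qed

lemma mills_gap_le_density: "x \<ge> 0 \<Longrightarrow> mills_gap x \<le> std_normal_density x"
proof -
  assume x: "x \<ge> 0"
  have "upper (\<lambda>_. 0) x \<le> upper (\<lambda>_. 1) x" by (intro upper_mono integrable_gauss_const) auto
  then have "1 - normal_cdf x \<ge> 0" by (simp add: upper_one) (simp add: upper_def)
  then show ?thesis using x by (simp add: mills_gap_def)
qed

text \<open>With u as in Birnbaum's bound, \<open>u * (u + x) = 1\<close> and \<open>mills_gap x \<le> u\<^sup>2 * std_normal_density x\<close>,
  so that everything reduces to a polynomial inequality for u in the unit interval.\<close>

lemma mills_gap_product_aux:
  assumes x: "x \<ge> 0"
  shows "2 * mills_gap x * (mills_gap x + x) \<le> std_normal_density x"
    and "2 * x\<^sup>2 * mills_gap x \<le> 2 * std_normal_density x"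
proof -
  let ?p = "std_normal_density x"
  define s where "s = sqrt (x\<^sup>2 + 4)"
  define u where "u = (s - x) / 2"
  have s: "s\<^sup>2 = x\<^sup>2 + 4" "s \<ge> 0" unfolding s_def by auto
  have "s \<ge> x" unfolding s_def using x by (intro real_le_rsqrt) auto
  have "s \<le> x + 2" unfolding s_def using x by (intro real_le_lsqrt) (auto simp: power2_eq_square algebra_simps)
  have u: "u \<ge> 0" "u \<le> 1" "u * (u + x) = 1"
    using s \<open>s \<ge> x\<close> \<open>s \<le> x + 2\<close> by (auto simp: u_def power2_eq_square field_simps)
  have p: "?p > 0" by (rule std_normal_density_pos)
  have "u * ?p \<le> 1 - normal_cdf x"
    using normal_tail_lower_bound[OF x] by (simp add: u_def s_def)
  then have "x * (u * ?p) \<le> x * (1 - normal_cdf x)" using x by (rule mult_left_mono)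
  moreover have "?p - x * (u * ?p) = u\<^sup>2 * ?p"
    using u(3) by (simp add: power2_eq_square algebra_simps) (metis mult.assoc mult.commute distrib_left mult_1)
  ultimately have A: "mills_gap x \<le> u\<^sup>2 * ?p" unfolding mills_gap_def by linarith
  have "u\<^sup>2 * ?p \<le> u\<^sup>2 * (41 / 100)" by (intro mult_left_mono std_normal_density_le) auto
  then have A': "mills_gap x + x \<le> u\<^sup>2 * (41 / 100) + x" using A by linarith
  (* The cube function lies above its tangents on the positive axis. The tangent at 0.73, near the maximum of
     the left-hand side, settles u <= 0.9, and the tangent at 0.9 the rest of the interval. *)
  have tangent: "0 \<le> u ^ 3 - 3 * t\<^sup>2 * u + 2 * t ^ 3" if "t \<ge> 0" for t
  proof -
    have "0 \<le> (u - t)\<^sup>2 * (u + 2 * t)" using u that by (intro mult_nonneg_nonneg) auto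
    also have "\<dots> = u ^ 3 - 3 * t\<^sup>2 * u + 2 * t ^ 3"
      by (simp add: power2_eq_square power3_eq_cube algebra_simps)
    finally show ?thesis .
  qed
  have poly: "2 * u - 2 * u ^ 3 + 82 / 100 * u ^ 4 \<le> 1"
  proof (cases "u \<le> 9 / 10")
    case True
    have "u ^ 4 \<le> 9 / 10 * u ^ 3"
      using mult_right_mono[OF True, of "u ^ 3"] u(1) by (simp add: power_Suc[symmetric])
    moreover have "0 \<le> u ^ 3 - 3 * (73 / 100)\<^sup>2 * u + 2 * (73 / 100) ^ 3" by (rule tangent) simp
    ultimately show ?thesis using u unfolding power_divide by simp
  next
    case False
    have "u ^ 4 \<le> 1 * u ^ 3"
      using mult_right_mono[OF u(2), of "u ^ 3"] u(1) by (simp add: power_Suc[symmetric])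
    moreover have "0 \<le> u ^ 3 - 3 * (9 / 10)\<^sup>2 * u + 2 * (9 / 10) ^ 3" by (rule tangent) simp
    ultimately show ?thesis using u False unfolding power_divide by simp
  qed
  have "2 * mills_gap x * (mills_gap x + x) \<le> 2 * (u\<^sup>2 * ?p) * (u\<^sup>2 * (41 / 100) + x)"
    using A A' mills_gap_nonneg[of x] x u p by (intro mult_mono) auto
  also have "\<dots> = ?p * (2 * u * (u * x) + 82 / 100 * u ^ 4)"
    by (simp add: power2_eq_square power4_eq_xxxx algebra_simps)
  also have "u * x = 1 - u\<^sup>2" using u(3) by (simp add: power2_eq_square algebra_simps)
  also have "2 * u * (1 - u\<^sup>2) + 82 / 100 * u ^ 4 = 2 * u - 2 * u ^ 3 + 82 / 100 * u ^ 4"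
    by (simp add: power2_eq_square power3_eq_cube algebra_simps)
  also have "?p * \<dots> \<le> ?p * 1" using p by (intro mult_left_mono poly) auto
  finally show "2 * mills_gap x * (mills_gap x + x) \<le> ?p" by simp
  have "u * u + u * x = 1" using u(3) by (simp only: distrib_left)
  moreover have "0 \<le> u * u" by simp
  ultimately have "x * u \<le> 1" unfolding mult.commute[of x u] by linarith
  then have "(x * u)\<^sup>2 \<le> 1" using x u by (intro power_le_one) auto
  then have "(x * u)\<^sup>2 * ?p \<le> 1 * ?p" using p by (intro mult_right_mono) auto
  moreover have "2 * x\<^sup>2 * mills_gap x \<le> 2 * x\<^sup>2 * (u\<^sup>2 * ?p)" by (intro mult_left_mono A) auto
  ultimately show "2 * x\<^sup>2 * mills_gap x \<le> 2 * ?p" by (simp add: power_mult_distrib)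
qed

text \<open>Reflecting x exchanges the two factors \<open>mills_gap x\<close> and \<open>mills_gap x + x\<close>, so that only
  nonnegative x need to be considered.\<close>

lemma mills_gap_product:
  "2 * mills_gap x * (mills_gap x + x) \<le> std_normal_density x"
  "x\<^sup>2 * (2 * mills_gap x * (mills_gap x + x)) + std_normal_density x * (2 * mills_gap x + 2 * (mills_gap x + x))
     \<le> std_normal_density x * (4 * \<bar>x\<bar> + 3)"
proof -
  let ?P = "\<lambda>x. 2 * mills_gap x * (mills_gap x + x)"
  let ?p = std_normal_density
  have pos: "?P x \<le> ?p x \<and> x\<^sup>2 * ?P x + ?p x * (2 * mills_gap x + 2 * (mills_gap x + x)) \<le> ?p x * (4 * \<bar>x\<bar> + 3)"
    if x: "x \<ge> 0" for x
  proof
    show "?P x \<le> ?p x" by (rule mills_gap_product_aux(1)[OF x])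
    have A: "0 \<le> mills_gap x" "mills_gap x \<le> 41 / 100"
      using mills_gap_nonneg[of x] mills_gap_le_density[OF x] std_normal_density_le[of x] by auto
    have "x\<^sup>2 * ?P x = (2 * x\<^sup>2 * mills_gap x) * (mills_gap x + x)" by simp
    also have "\<dots> \<le> (2 * ?p x) * (mills_gap x + x)"
      using A x by (intro mult_right_mono mills_gap_product_aux(2)) auto
    finally have "x\<^sup>2 * ?P x + ?p x * (2 * mills_gap x + 2 * (mills_gap x + x))
        \<le> ?p x * (2 * (mills_gap x + x) + (2 * mills_gap x + 2 * (mills_gap x + x)))"
      by (simp add: algebra_simps)
    also have "\<dots> \<le> ?p x * (4 * \<bar>x\<bar> + 3)"
      using A x std_normal_density_pos[of x] by (intro mult_left_mono) auto
    finally show "x\<^sup>2 * ?P x + ?p x * (2 * mills_gap x + 2 * (mills_gap x + x)) \<le> ?p x * (4 * \<bar>x\<bar> + 3)" .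
  qed
  have "?P x \<le> ?p x \<and> x\<^sup>2 * ?P x + ?p x * (2 * mills_gap x + 2 * (mills_gap x + x)) \<le> ?p x * (4 * \<bar>x\<bar> + 3)"
  proof (cases "x \<ge> 0")
    case False
    have "?p (- x) = ?p x" by (simp add: std_normal_density_def)
    with pos[of "- x"] False show ?thesis by (simp add: mills_gap_minus algebra_simps)
  qed (rule pos)
  then show "?P x \<le> ?p x" "x\<^sup>2 * ?P x + ?p x * (2 * mills_gap x + 2 * (mills_gap x + x)) \<le> ?p x * (4 * \<bar>x\<bar> + 3)"
    by blast+
qed

text \<open>Subtracting the constant g(x) from g inside the integrals expresses the derivative through the
  increments of g at x only, with the nonnegative weights \<open>E (Z - x)\<^sup>+\<close> and \<open>E (x - Z)\<^sup>+\<close>.\<close>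

lemma stein_deriv_formula:
  assumes g: "integrable gauss g"
  shows "std_normal_density x * stein_deriv g x
    = - (mills_gap x * lower (\<lambda>y. g y - g x) x + (mills_gap x + x) * upper (\<lambda>y. g y - g x) x)"
proof -
  let ?c = "\<integral>z. g z \<partial>gauss" and ?p = "std_normal_density x"
  let ?L = "lower (\<lambda>y. g y - g x) x" and ?U = "upper (\<lambda>y. g y - g x) x"
  have K: "?L + ?U = ?c - g x"
    using lower_plus_upper[OF integrable_centred[OF g], of "g x" x] g prob_space.prob_space[OF prob_space_gauss]
    by (simp add: integrable_gauss_const)
  have gx: "g x - ?c = - (?L + ?U)" using K by simp
  have "lower (\<lambda>y. (g y - g x) + (g x - ?c)  * 1) x = ?L + (g x - ?c) * normal_cdf x"
    unfolding lower_add[OF integrable_centred[OF g] integrable_mult_right[OF integrable_gauss_const]] lower_cmult ..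
  moreover have "(\<lambda>y. (g y - g x) + (g x - ?c) * 1) = (\<lambda>y. g y - ?c)" by auto
  ultimately have l: "lower (\<lambda>y. g y - ?c) x = ?L + - (?L + ?U) * normal_cdf x"
    by (simp only: gx)
  have sd: "?p * stein_deriv g x = x * lower (\<lambda>y. g y - ?c) x + ?p * (g x - ?c)"
    using std_normal_density_pos[of x] by (simp add: stein_deriv_def stein_def field_simps)
  show ?thesis
    unfolding sd l gx mills_gap_def by (simp add: algebra_simps)
qed

text \<open>In the formula for the derivative the increments of g are dominated by those of the increasing
  function \<open>\<alpha> * y + \<beta> * y ^ 3\<close>, whose integrals are explicit. For \<open>\<beta> = 0\<close> this is the bound for
  Lipschitz functions; the cubic term covers functions with bounded third derivative and costs only
  linear growth.\<close>

lemma stein_deriv_bound: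
  assumes g: "integrable gauss g" and ab: "\<alpha> \<ge> 0" "\<beta> \<ge> 0"
    and osc: "\<And>x y. \<bar>g y - g x\<bar> \<le> \<alpha> * \<bar>y - x\<bar> + \<beta> * \<bar>y ^ 3 - x ^ 3\<bar>"
  shows "\<bar>stein_deriv g x\<bar> \<le> \<alpha> + \<beta> * (4 * \<bar>x\<bar> + 3)"
proof -
  let ?p = "std_normal_density x" and ?A = "mills_gap x" and ?B = "mills_gap x + x"
  have p: "?p > 0" by (rule std_normal_density_pos)
  have A: "?A \<ge> 0" and B: "?B \<ge> 0"
    using mills_gap_nonneg[of x] mills_gap_nonneg[of "- x"] by (auto simp: mills_gap_minus)
  have ik: "integrable gauss (\<lambda>y. g y - g x)" by (rule integrable_centred[OF g])
  have id: "integrable gauss (\<lambda>y. y)" using integrable_gauss_power[of 1] by simp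
  note i = integrable_gauss_const integrable_gauss_power[of 3] id
  define C where "C = \<alpha> * x + \<beta> * x ^ 3"
  have L: "\<bar>lower (\<lambda>y. g y - g x) x\<bar> \<le> \<alpha> * ?B + \<beta> * (x\<^sup>2 * ?B + 2 * ?p)"
  proof -
    have "\<bar>lower (\<lambda>y. g y - g x) x\<bar> \<le> lower (\<lambda>y. C * 1 + ((- \<alpha>) * y + (- \<beta>) * y ^ 3)) x"
    proof (rule abs_lower_le[OF ik])
      show "\<bar>g y - g x\<bar> \<le> C * 1 + ((- \<alpha>) * y + (- \<beta>) * y ^ 3)" if "y < x" for y
        using osc[of y x] that power_mono_odd[of 3 y x] by (simp add: C_def algebra_simps)
    qed (intro Bochner_Integration.integrable_add integrable_mult_right i)
    also have "\<dots> = C * normal_cdf x + \<alpha> * ?p + \<beta> * (x\<^sup>2 + 2) * ?p"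
      unfolding lower_cubic by (simp add: algebra_simps)
    also have "\<dots> = \<alpha> * ?B + \<beta> * (x\<^sup>2 * ?B + 2 * ?p)"
      by (simp add: C_def mills_gap_def power2_eq_square power3_eq_cube algebra_simps)
    finally show ?thesis .
  qed
  have U: "\<bar>upper (\<lambda>y. g y - g x) x\<bar> \<le> \<alpha> * ?A + \<beta> * (x\<^sup>2 * ?A + 2 * ?p)"
  proof -
    have "\<bar>upper (\<lambda>y. g y - g x) x\<bar> \<le> upper (\<lambda>y. (- C) * 1 + (\<alpha> * y + \<beta> * y ^ 3)) x"
    proof (rule abs_upper_le[OF ik])
      show "\<bar>g y - g x\<bar> \<le> (- C) * 1 + (\<alpha> * y + \<beta> * y ^ 3)" if "x \<le> y" for y
        using osc[of y x] that power_mono_odd[of 3 x y] by (simp add: C_def algebra_simps)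
    qed (intro Bochner_Integration.integrable_add integrable_mult_right i)
    also have "\<dots> = - C * (1 - normal_cdf x) + \<alpha> * ?p + \<beta> * (x\<^sup>2 + 2) * ?p"
      unfolding upper_cubic by (simp add: algebra_simps)
    also have "\<dots> = \<alpha> * ?A + \<beta> * (x\<^sup>2 * ?A + 2 * ?p)"
      by (simp add: C_def mills_gap_def power2_eq_square power3_eq_cube algebra_simps)
    finally show ?thesis .
  qed
  have "?p * \<bar>stein_deriv g x\<bar> = \<bar>?p * stein_deriv g x\<bar>" using p by (simp add: abs_mult)
  also have "\<dots> \<le> ?A * \<bar>lower (\<lambda>y. g y - g x) x\<bar> + ?B * \<bar>upper (\<lambda>y. g y - g x) x\<bar>"
    unfolding stein_deriv_formula[OF g] abs_minus_cancel
    by (rule order_trans[OF abs_triangle_ineq]) (use A B in \<open>simp add: abs_mult\<close>)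
  also have "\<dots> \<le> ?A * (\<alpha> * ?B + \<beta> * (x\<^sup>2 * ?B + 2 * ?p)) + ?B * (\<alpha> * ?A + \<beta> * (x\<^sup>2 * ?A + 2 * ?p))"
    using A B by (intro add_mono mult_left_mono L U) auto
  also have "\<dots> = \<alpha> * (2 * ?A * ?B) + \<beta> * (x\<^sup>2 * (2 * ?A * ?B) + ?p * (2 * ?A + 2 * ?B))"
    by (simp add: algebra_simps)
  also have "\<dots> \<le> \<alpha> * ?p + \<beta> * (?p * (4 * \<bar>x\<bar> + 3))"
    using ab by (intro add_mono mult_left_mono mills_gap_product) auto
  also have "\<dots> = ?p * (\<alpha> + \<beta> * (4 * \<bar>x\<bar> + 3))" by (simp add: algebra_simps)
  finally show ?thesis using p by simp
qed

section \<open>Square-summable arrays\<close>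

abbreviation index_lists :: "nat \<Rightarrow> nat list set" where
  "index_lists m \<equiv> {is. length is = m}"

text \<open>A tensor enters the functionals only through its values on basis vectors, and these form a
  square-summable array indexed by lists. The Hilbert space can then be forgotten.\<close>

definition sq_summable :: "nat \<Rightarrow> (nat list \<Rightarrow> real) \<Rightarrow> bool" where
  "sq_summable m c \<longleftrightarrow> (\<lambda>is. (c is)\<^sup>2) summable_on index_lists m"

definition l2 :: "nat \<Rightarrow> (nat list \<Rightarrow> real) \<Rightarrow> real" where
  "l2 m c = sqrt (\<Sum>\<^sub>\<infinity>is\<in>index_lists m. (c is)\<^sup>2)"

lemma l2_nonneg: "l2 m c \<ge> 0"
  by (simp add: l2_def infsum_nonneg)

lemma l2_square: "(l2 m c)\<^sup>2 = (\<Sum>\<^sub>\<infinity>is\<in>index_lists m. (c is)\<^sup>2)"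
  by (simp add: l2_def infsum_nonneg)

lemma L2_set_le_l2:
  assumes "sq_summable m c" "finite S" "S \<subseteq> index_lists m"
  shows "L2_set c S \<le> l2 m c"
  unfolding L2_set_def l2_def
  using assms by (intro real_sqrt_le_mono finite_sum_le_infsum) (auto simp: sq_summable_def)

lemma l2_leI:
  assumes K: "K \<ge> 0" and b: "\<And>S. finite S \<Longrightarrow> S \<subseteq> index_lists m \<Longrightarrow> (\<Sum>is\<in>S. (c is)\<^sup>2) \<le> K\<^sup>2"
  shows "sq_summable m c" "l2 m c \<le> K"
proof -
  show s: "sq_summable m c"
    unfolding sq_summable_def
    by (rule nonneg_bdd_above_summable_on) (auto intro!: bdd_aboveI[of _ "K\<^sup>2"] b)
  have "(\<Sum>\<^sub>\<infinity>is\<in>index_lists m. (c is)\<^sup>2) \<le> K\<^sup>2"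
    using s b unfolding sq_summable_def by (intro infsum_le_finite_sums) auto
  then show "l2 m c \<le> K" unfolding l2_def using K by (intro real_le_lsqrt) (auto intro: infsum_nonneg)
qed

lemma l2_leI_L2_set:
  assumes K: "K \<ge> 0" and b: "\<And>S. finite S \<Longrightarrow> S \<subseteq> index_lists m \<Longrightarrow> L2_set c S \<le> K"
  shows "sq_summable m c" "l2 m c \<le> K"
proof -
  have "(\<Sum>is\<in>S. (c is)\<^sup>2) \<le> K\<^sup>2" if "finite S" "S \<subseteq> index_lists m" for S
    using power_mono[OF b[OF that] L2_set_nonneg, of 2] by (simp add: L2_set_def sum_nonneg)
  from l2_leI[OF K this] show "sq_summable m c" "l2 m c \<le> K" by auto
qed

lemma l2_cong: "(\<And>is. length is = m \<Longrightarrow> c is = c' is) \<Longrightarrow> l2 m c = l2 m c'"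
  unfolding l2_def by (intro arg_cong[of _ _ sqrt] infsum_cong) auto

lemma sq_summable_cong: "(\<And>is. length is = m \<Longrightarrow> c is = c' is) \<Longrightarrow> sq_summable m c = sq_summable m c'"
  unfolding sq_summable_def by (intro summable_on_cong) auto

lemma l2_triangle:
  assumes "sq_summable m c" "sq_summable m c'"
  shows "sq_summable m (\<lambda>is. c is + c' is)" "l2 m (\<lambda>is. c is + c' is) \<le> l2 m c + l2 m c'"
proof -
  have "L2_set (\<lambda>is. c is + c' is) S \<le> l2 m c + l2 m c'" if "finite S" "S \<subseteq> index_lists m" for S
    using L2_set_triangle_ineq[of c c' S] L2_set_le_l2[OF assms(1) that] L2_set_le_l2[OF assms(2) that]
    by linarith
  from l2_leI_L2_set[OF _ this] show "sq_summable m (\<lambda>is. c is + c' is)"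
    "l2 m (\<lambda>is. c is + c' is) \<le> l2 m c + l2 m c'"
    by (auto simp: l2_nonneg)
qed

lemma sq_summable_zero: "sq_summable m (\<lambda>_. 0)"
  by (simp add: sq_summable_def)

lemma l2_zero: "l2 m (\<lambda>_. 0) = 0"
  by (simp add: l2_def)

lemma sq_summable_cmult: "sq_summable m c \<Longrightarrow> sq_summable m (\<lambda>is. k * c is)"
  unfolding sq_summable_def power_mult_distrib by (rule summable_on_cmult_right)

lemma l2_cmult: "l2 m (\<lambda>is. k * c is) = \<bar>k\<bar> * l2 m c"
  by (simp add: l2_def power_mult_distrib infsum_cmult_right' real_sqrt_mult)

lemma sq_summable_diff:
  assumes "sq_summable m c" "sq_summable m c'"
  shows "sq_summable m (\<lambda>is. c is - c' is)"
  using l2_triangle(1)[OF assms(1) sq_summable_cmult[OF assms(2), of "-1"]] by simp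

lemma l2_minus_commute: "l2 m (\<lambda>is. c is - c' is) = l2 m (\<lambda>is. c' is - c is)"
  by (simp add: l2_def power2_commute)

lemma l2_diff_le:
  assumes "sq_summable m c" "sq_summable m c'"
  shows "\<bar>l2 m c - l2 m c'\<bar> \<le> l2 m (\<lambda>is. c is - c' is)"
  using l2_triangle(2)[OF sq_summable_diff[OF assms] assms(2)]
    l2_triangle(2)[OF sq_summable_diff[OF assms(2,1)] assms(1)]
  by (auto simp: l2_minus_commute[of m c c'])

lemma l2_sum:
  assumes "finite K" "\<And>k. k \<in> K \<Longrightarrow> sq_summable m (c k)"
  shows "sq_summable m (\<lambda>is. \<Sum>k\<in>K. c k is)" "l2 m (\<lambda>is. \<Sum>k\<in>K. c k is) \<le> (\<Sum>k\<in>K. l2 m (c k))"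
proof -
  have "sq_summable m (\<lambda>is. \<Sum>k\<in>K. c k is) \<and> l2 m (\<lambda>is. \<Sum>k\<in>K. c k is) \<le> (\<Sum>k\<in>K. l2 m (c k))"
    using assms
  proof (induction K rule: finite_induct)
    case empty
    then show ?case by (simp add: sq_summable_zero l2_zero)
  next
    case (insert k K)
    then show ?case
      using l2_triangle[of m "c k" "\<lambda>is. \<Sum>k\<in>K. c k is"] by auto
  qed
  then show "sq_summable m (\<lambda>is. \<Sum>k\<in>K. c k is)" "l2 m (\<lambda>is. \<Sum>k\<in>K. c k is) \<le> (\<Sum>k\<in>K. l2 m (c k))"
    by auto
qed

lemma bij_betw_permute_list:
  assumes "\<pi> permutes {..<m}"
  shows "bij_betw (permute_list \<pi>) (index_lists m) (index_lists m)"
proof (rule bij_betw_byWitness[where f' = "permute_list (inv \<pi>)"])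
  have *: "inv \<pi> permutes {..<m}" using assms by (rule permutes_inv)
  show "\<forall>xs\<in>index_lists m. permute_list (inv \<pi>) (permute_list \<pi> xs) = xs"
  proof
    fix xs assume "xs \<in> index_lists m"
    then show "permute_list (inv \<pi>) (permute_list \<pi> xs) = xs"
      using permute_list_compose[of "inv \<pi>" xs \<pi>] * permutes_inv_o[OF assms] by simp
  qed
  show "\<forall>xs\<in>index_lists m. permute_list \<pi> (permute_list (inv \<pi>) xs) = xs"
  proof
    fix xs assume "xs \<in> index_lists m"
    then show "permute_list \<pi> (permute_list (inv \<pi>) xs) = xs"
      using permute_list_compose[of \<pi> xs "inv \<pi>"] assms permutes_inv_o[OF assms] by simp
  qed
qed auto

lemma l2_permute:
  assumes "\<pi> permutes {..<m}"
  shows "sq_summable m (\<lambda>is. c (permute_list \<pi> is)) = sq_summable m c"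
    "l2 m (\<lambda>is. c (permute_list \<pi> is)) = l2 m c"
  using summable_on_reindex_bij_betw[OF bij_betw_permute_list[OF assms], of "\<lambda>is. (c is)\<^sup>2"]
    infsum_reindex_bij_betw[OF bij_betw_permute_list[OF assms], of "\<lambda>is. (c is)\<^sup>2"]
  by (simp_all add: sq_summable_def l2_def)

text \<open>Permuting the indices preserves the norm, and the symmetrization is a mean of such permutations.\<close>

lemma l2_symmetrization:
  assumes "sq_summable m c"
  shows "sq_summable m (symmetrization m c)" "l2 m (symmetrization m c) \<le> l2 m c"
proof -
  let ?P = "{\<pi>. \<pi> permutes {..<m}}"
  let ?s = "\<lambda>is. (1 / fact m) * (\<Sum>\<pi>\<in>?P. c (permute_list \<pi> is))"
  have fin: "finite ?P" by (rule finite_permutations) simp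
  have eq: "symmetrization m c is = ?s is" if "length is = m" for "is"
    using that by (simp add: symmetrization_def)
  have s: "sq_summable m (\<lambda>is. c (permute_list \<pi> is))" if "\<pi> \<in> ?P" for \<pi>
    using l2_permute(1)[of \<pi> m c] that assms by simp
  have "sq_summable m ?s" by (rule sq_summable_cmult[OF l2_sum(1)[OF fin s]])
  then show "sq_summable m (symmetrization m c)"
    using sq_summable_cong[of m "symmetrization m c" ?s, OF eq] by blast
  have "l2 m (symmetrization m c) = l2 m ?s" by (rule l2_cong) (rule eq)
  also have "\<dots> = (1 / fact m) * l2 m (\<lambda>is. \<Sum>\<pi>\<in>?P. c (permute_list \<pi> is))"
    unfolding l2_cmult by simp
  also have "\<dots> \<le> (1 / fact m) * (\<Sum>\<pi>\<in>?P. l2 m (\<lambda>is. c (permute_list \<pi> is)))"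
    by (intro mult_left_mono l2_sum(2)[OF fin s]) auto
  also have "(\<Sum>\<pi>\<in>?P. l2 m (\<lambda>is. c (permute_list \<pi> is))) = fact m * l2 m c"
    by (simp add: l2_permute(2) card_permutations)
  finally show "l2 m (symmetrization m c) \<le> l2 m c" by simp
qed

lemma symmetrization_diff:
  "symmetrization m (\<lambda>xs. c xs - c' xs) xs = symmetrization m c xs - symmetrization m c' xs"
  by (simp add: symmetrization_def sum_subtractf diff_divide_distrib)

lemma infsum_Cauchy_Schwarz:
  fixes u v :: "'a \<Rightarrow> real"
  assumes "(\<lambda>i. (u i)\<^sup>2) summable_on A" "(\<lambda>i. (v i)\<^sup>2) summable_on A"
  shows "(\<lambda>i. u i * v i) summable_on A"
    "(\<Sum>\<^sub>\<infinity>i\<in>A. u i * v i)\<^sup>2 \<le> (\<Sum>\<^sub>\<infinity>i\<in>A. (u i)\<^sup>2) * (\<Sum>\<^sub>\<infinity>i\<in>A. (v i)\<^sup>2)"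
proof -
  let ?K = "sqrt ((\<Sum>\<^sub>\<infinity>i\<in>A. (u i)\<^sup>2) * (\<Sum>\<^sub>\<infinity>i\<in>A. (v i)\<^sup>2))"
  have b: "(\<Sum>i\<in>S. \<bar>u i * v i\<bar>) \<le> ?K" if "finite S" "S \<subseteq> A" for S
  proof -
    have "(\<Sum>i\<in>S. \<bar>u i * v i\<bar>) \<le> L2_set u S * L2_set v S"
      using L2_set_mult_ineq[of u v S] by (simp add: abs_mult)
    also have "\<dots> \<le> sqrt (\<Sum>\<^sub>\<infinity>i\<in>A. (u i)\<^sup>2) * sqrt (\<Sum>\<^sub>\<infinity>i\<in>A. (v i)\<^sup>2)"
      unfolding L2_set_def using that assms
      by (intro mult_mono real_sqrt_le_mono finite_sum_le_infsum) (auto intro: infsum_nonneg sum_nonneg)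
    finally show ?thesis by (simp add: real_sqrt_mult)
  qed
  have abs: "(\<lambda>i. \<bar>u i * v i\<bar>) summable_on A"
    by (rule nonneg_bdd_above_summable_on) (auto intro!: bdd_aboveI[of _ ?K] b)
  then have abs': "(\<lambda>i. norm (u i * v i)) summable_on A" by simp
  then show "(\<lambda>i. u i * v i) summable_on A" by (rule abs_summable_summable)
  have "\<bar>\<Sum>\<^sub>\<infinity>i\<in>A. u i * v i\<bar> \<le> (\<Sum>\<^sub>\<infinity>i\<in>A. \<bar>u i * v i\<bar>)"
    using norm_infsum_bound[OF abs'] by simp
  also have "\<dots> \<le> ?K" by (rule infsum_le_finite_sums[OF abs b])
  finally have "\<bar>\<Sum>\<^sub>\<infinity>i\<in>A. u i * v i\<bar>\<^sup>2 \<le> ?K\<^sup>2" by (intro power_mono) auto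
  then show "(\<Sum>\<^sub>\<infinity>i\<in>A. u i * v i)\<^sup>2 \<le> (\<Sum>\<^sub>\<infinity>i\<in>A. (u i)\<^sup>2) * (\<Sum>\<^sub>\<infinity>i\<in>A. (v i)\<^sup>2)"
    by (simp add: infsum_nonneg)
qed

definition arr_contraction ::
    "nat \<Rightarrow> nat \<Rightarrow> (nat list \<Rightarrow> real) \<Rightarrow> (nat list \<Rightarrow> real) \<Rightarrow> nat list \<Rightarrow> real" where
  "arr_contraction p r f g zs
    = (\<Sum>\<^sub>\<infinity>is\<in>index_lists r. f (is @ take (p - r) zs) * g (is @ drop (p - r) zs))"

lemma sq_summable_append:
  assumes f: "sq_summable p f" and r: "r + length xs = p"
  shows "(\<lambda>is. (f (is @ xs))\<^sup>2) summable_on index_lists r"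
proof -
  have "(\<lambda>is. (f is)\<^sup>2) summable_on (\<lambda>is. is @ xs) ` index_lists r"
    using f r unfolding sq_summable_def by (rule_tac summable_on_subset_banach) auto
  moreover have "inj_on (\<lambda>is. is @ xs) (index_lists r)" by (auto simp: inj_on_def)
  ultimately show ?thesis by (simp add: summable_on_reindex o_def)
qed

lemma infsum_finite_sum:
  fixes w :: "'b \<Rightarrow> 'a \<Rightarrow> real"
  assumes "finite X" "\<And>x. x \<in> X \<Longrightarrow> w x summable_on A"
  shows "(\<lambda>i. \<Sum>x\<in>X. w x i) summable_on A"
    "(\<Sum>\<^sub>\<infinity>i\<in>A. \<Sum>x\<in>X. w x i) = (\<Sum>x\<in>X. \<Sum>\<^sub>\<infinity>i\<in>A. w x i)"
proof -
  have "(\<lambda>i. \<Sum>x\<in>X. w x i) summable_on A \<and> (\<Sum>\<^sub>\<infinity>i\<in>A. \<Sum>x\<in>X. w x i) = (\<Sum>x\<in>X. \<Sum>\<^sub>\<infinity>i\<in>A. w x i)"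
    using assms
    by (induction X rule: finite_induct) (auto intro: summable_on_add simp: infsum_add)
  then show "(\<lambda>i. \<Sum>x\<in>X. w x i) summable_on A"
    "(\<Sum>\<^sub>\<infinity>i\<in>A. \<Sum>x\<in>X. w x i) = (\<Sum>x\<in>X. \<Sum>\<^sub>\<infinity>i\<in>A. w x i)" by auto
qed

text \<open>The lists split into an initial and a final segment are pairwise different, so this is a sum of the
  squares of f over distinct lists.\<close>

lemma sum_infsum_append_le:
  assumes f: "sq_summable p f" and X: "finite X" "X \<subseteq> index_lists (p - r)" and r: "r \<le> p"
  shows "(\<Sum>xs\<in>X. \<Sum>\<^sub>\<infinity>is\<in>index_lists r. (f (is @ xs))\<^sup>2) \<le> (l2 p f)\<^sup>2"
proof -
  have s: "(\<lambda>is. (f (is @ xs))\<^sup>2) summable_on index_lists r" if "xs \<in> X" for xs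
    by (rule sq_summable_append[OF f]) (use that X r in auto)
  have "(\<Sum>xs\<in>X. \<Sum>\<^sub>\<infinity>is\<in>index_lists r. (f (is @ xs))\<^sup>2)
      = (\<Sum>\<^sub>\<infinity>is\<in>index_lists r. \<Sum>xs\<in>X. (f (is @ xs))\<^sup>2)"
    by (rule infsum_finite_sum(2)[symmetric, OF X(1)]) (rule s)
  also have "\<dots> \<le> (l2 p f)\<^sup>2"
  proof (rule infsum_le_finite_sums)
    show "(\<lambda>is. \<Sum>xs\<in>X. (f (is @ xs))\<^sup>2) summable_on index_lists r"
      by (rule infsum_finite_sum(1)[OF X(1)]) (rule s)
    fix T assume T: "finite T" "T \<subseteq> index_lists r"
    have inj: "inj_on (\<lambda>(is, xs). is @ xs) (T \<times> X)"
      using T(2) by (auto simp: inj_on_def subset_iff)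
    have "(\<Sum>is\<in>T. \<Sum>xs\<in>X. (f (is @ xs))\<^sup>2) = (\<Sum>ys\<in>(\<lambda>(is, xs). is @ xs) ` (T \<times> X). (f ys)\<^sup>2)"
      by (subst sum.reindex[OF inj]) (simp add: sum.cartesian_product case_prod_beta)
    also have "\<dots> \<le> (l2 p f)\<^sup>2"
      unfolding l2_square using f T X r
      by (intro finite_sum_le_infsum) (auto simp: sq_summable_def subset_iff)
    finally show "(\<Sum>is\<in>T. \<Sum>xs\<in>X. (f (is @ xs))\<^sup>2) \<le> (l2 p f)\<^sup>2" .
  qed
  finally show ?thesis .
qed

text \<open>Cauchy-Schwarz in the contracted indices bounds each squared entry by a product of a quantity that
  depends on the free indices of f and one that depends on those of g.\<close>

lemma l2_arr_contraction:
  assumes f: "sq_summable p f" and g: "sq_summable p g" and r: "r \<le> p"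
  shows "sq_summable (2 * p - 2 * r) (arr_contraction p r f g)"
    "l2 (2 * p - 2 * r) (arr_contraction p r f g) \<le> l2 p f * l2 p g"
proof -
  let ?m = "p - r"
  have "(\<Sum>zs\<in>S. (arr_contraction p r f g zs)\<^sup>2) \<le> (l2 p f * l2 p g)\<^sup>2"
    if S: "finite S" "S \<subseteq> index_lists (2 * p - 2 * r)" for S
  proof -
    define X Y where "X = take ?m ` S" and "Y = drop ?m ` S"
    have X: "finite X" "X \<subseteq> index_lists ?m" and Y: "finite Y" "Y \<subseteq> index_lists ?m"
      using S r by (auto simp: X_def Y_def)
    let ?F = "\<lambda>xs. \<Sum>\<^sub>\<infinity>is\<in>index_lists r. (f (is @ xs))\<^sup>2"
    let ?G = "\<lambda>ys. \<Sum>\<^sub>\<infinity>is\<in>index_lists r. (g (is @ ys))\<^sup>2"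
    have inj: "inj_on (\<lambda>zs. (take ?m zs, drop ?m zs)) S"
    proof (rule inj_onI)
      fix zs ws assume "(take ?m zs, drop ?m zs) = (take ?m ws, drop ?m ws)"
      then have "take ?m zs @ drop ?m zs = take ?m ws @ drop ?m ws" by simp
      then show "zs = ws" unfolding append_take_drop_id .
    qed
    have "(\<Sum>zs\<in>S. (arr_contraction p r f g zs)\<^sup>2) \<le> (\<Sum>zs\<in>S. ?F (take ?m zs) * ?G (drop ?m zs))"
      unfolding arr_contraction_def
      by (intro sum_mono infsum_Cauchy_Schwarz(2) sq_summable_append[OF f] sq_summable_append[OF g])
        (use S r in \<open>auto simp: subset_iff\<close>)
    also have "\<dots> = (\<Sum>(xs, ys)\<in>(\<lambda>zs. (take ?m zs, drop ?m zs)) ` S. ?F xs * ?G ys)"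
      by (subst sum.reindex[OF inj]) simp
    also have "\<dots> \<le> (\<Sum>(xs, ys)\<in>X \<times> Y. ?F xs * ?G ys)"
      using X Y by (intro sum_mono2) (auto simp: X_def Y_def intro!: mult_nonneg_nonneg infsum_nonneg)
    also have "\<dots> = (\<Sum>xs\<in>X. ?F xs) * (\<Sum>ys\<in>Y. ?G ys)"
      by (simp add: sum_product sum.cartesian_product)
    also have "\<dots> \<le> (l2 p f)\<^sup>2 * (l2 p g)\<^sup>2"
      by (intro mult_mono sum_infsum_append_le f g X Y r) (auto intro!: sum_nonneg infsum_nonneg)
    finally show ?thesis by (simp add: power_mult_distrib)
  qed
  from l2_leI[OF _ this] show "sq_summable (2 * p - 2 * r) (arr_contraction p r f g)"
    "l2 (2 * p - 2 * r) (arr_contraction p r f g) \<le> l2 p f * l2 p g"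
    by (auto intro: mult_nonneg_nonneg l2_nonneg)
qed

lemma arr_contraction_diff:
  assumes f: "sq_summable p f" and g: "sq_summable p g" and r: "r \<le> p" and zs: "length zs = 2 * p - 2 * r"
  shows "arr_contraction p r f f zs - arr_contraction p r g g zs
    = arr_contraction p r (\<lambda>is. f is - g is) f zs + arr_contraction p r g (\<lambda>is. f is - g is) zs"
proof -
  let ?x = "take (p - r) zs" and ?y = "drop (p - r) zs"
  have l: "r + length ?x = p" "r + length ?y = p" using zs r by auto
  have s: "(\<lambda>is. u (is @ ?x) * v (is @ ?y)) summable_on index_lists r"
    if "sq_summable p u" "sq_summable p v" for u v
    by (rule infsum_Cauchy_Schwarz(1)[OF sq_summable_append[OF that(1) l(1)] sq_summable_append[OF that(2) l(2)]])
  note d = sq_summable_diff[OF f g]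
  have "arr_contraction p r (\<lambda>is. f is - g is) f zs + arr_contraction p r g (\<lambda>is. f is - g is) zs
     = (\<Sum>\<^sub>\<infinity>is\<in>index_lists r. (f (is @ ?x) - g (is @ ?x)) * f (is @ ?y) + g (is @ ?x) * (f (is @ ?y) - g (is @ ?y)))"
    unfolding arr_contraction_def by (rule infsum_add[symmetric]) (use s[OF d f] s[OF g d] in auto)
  also have "\<dots> = (\<Sum>\<^sub>\<infinity>is\<in>index_lists r. f (is @ ?x) * f (is @ ?y) + (-1) * (g (is @ ?x) * g (is @ ?y)))"
    by (intro infsum_cong) (simp add: algebra_simps)
  also have "\<dots> = (\<Sum>\<^sub>\<infinity>is\<in>index_lists r. f (is @ ?x) * f (is @ ?y)) + (\<Sum>\<^sub>\<infinity>is\<in>index_lists r. (-1) * (g (is @ ?x) * g (is @ ?y)))"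
    by (intro infsum_add summable_on_cmult_right s f g)
  finally show ?thesis
    unfolding arr_contraction_def infsum_cmult_right' by simp
qed

definition sym_contraction_norm :: "nat \<Rightarrow> nat \<Rightarrow> (nat list \<Rightarrow> real) \<Rightarrow> real" where
  "sym_contraction_norm d r a = l2 (2 * d - 2 * r) (symmetrization (2 * d - 2 * r) (arr_contraction d r a a))"

lemma sym_contraction_norm_nonneg: "sym_contraction_norm d r a \<ge> 0"
  by (simp add: sym_contraction_norm_def l2_nonneg)

lemma sym_contraction_norm_le:
  assumes "sq_summable d a" "r \<le> d"
  shows "sym_contraction_norm d r a \<le> (l2 d a)\<^sup>2"
  using l2_symmetrization(2)[OF l2_arr_contraction(1)[OF assms(1,1,2)]] l2_arr_contraction(2)[OF assms(1,1,2)]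
  by (simp add: sym_contraction_norm_def power2_eq_square)

text \<open>The contraction is bilinear and bounded, hence locally Lipschitz.\<close>

lemma sym_contraction_norm_diff:
  assumes a: "sq_summable d a" and b: "sq_summable d b" and r: "r \<le> d"
  shows "\<bar>sym_contraction_norm d r a - sym_contraction_norm d r b\<bar> \<le> l2 d (\<lambda>is. a is - b is) * (l2 d a + l2 d b)"
proof -
  let ?m = "2 * d - 2 * r"
  let ?c = "\<lambda>a. arr_contraction d r a a" and ?D = "\<lambda>is. a is - b is"
  note d = sq_summable_diff[OF a b]
  note sa = l2_arr_contraction(1)[OF a a r] and sb = l2_arr_contraction(1)[OF b b r]
  note s1 = l2_arr_contraction[OF d a r] and s2 = l2_arr_contraction[OF b d r]
  have "\<bar>sym_contraction_norm d r a - sym_contraction_norm d r b\<bar>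
      \<le> l2 ?m (\<lambda>zs. symmetrization ?m (?c a) zs - symmetrization ?m (?c b) zs)"
    unfolding sym_contraction_norm_def by (intro l2_diff_le l2_symmetrization(1) sa sb)
  also have "\<dots> = l2 ?m (symmetrization ?m (\<lambda>zs. ?c a zs - ?c b zs))"
    by (rule l2_cong) (simp only: symmetrization_diff)
  also have "\<dots> \<le> l2 ?m (\<lambda>zs. ?c a zs - ?c b zs)"
    by (intro l2_symmetrization(2) sq_summable_diff sa sb)
  also have "\<dots> = l2 ?m (\<lambda>zs. arr_contraction d r ?D a zs + arr_contraction d r b ?D zs)"
    by (rule l2_cong) (rule arr_contraction_diff[OF a b r])
  also have "\<dots> \<le> l2 ?m (arr_contraction d r ?D a) + l2 ?m (arr_contraction d r b ?D)"
    by (rule l2_triangle[OF s1(1) s2(1)])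
  also have "\<dots> \<le> l2 d ?D * l2 d a + l2 d b * l2 d ?D"
    by (intro add_mono s1 s2)
  finally show ?thesis by (simp add: algebra_simps)
qed

text \<open>The functional T1 in terms of the coordinates of the kernel.\<close>

definition stein_discrepancy :: "nat \<Rightarrow> (nat list \<Rightarrow> real) \<Rightarrow> real" where
  "stein_discrepancy d a = sqrt (\<Sum>r=1..d-1. (carre_coeff d r)\<^sup>2 * fact (2 * d - 2 * r) * (sym_contraction_norm d r a)\<^sup>2)"

lemma l2_tendsto:
  assumes sa: "sq_summable d a" and sb: "\<And>A. sq_summable d (b A)"
    and lim: "((\<lambda>A. l2 d (\<lambda>is. a is - b A is)) \<longlongrightarrow> 0) \<F>"
  shows "((\<lambda>A. l2 d (b A)) \<longlongrightarrow> l2 d a) \<F>"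
proof -
  have "((\<lambda>A. l2 d (b A) - l2 d a) \<longlongrightarrow> 0) \<F>"
    by (rule Lim_null_comparison[OF _ lim])
      (use l2_diff_le[OF sa sb] in \<open>simp add: abs_minus_commute\<close>)
  then show ?thesis by (simp add: LIM_zero_iff)
qed

lemma stein_discrepancy_tendsto:
  assumes sa: "sq_summable d a" and sb: "\<And>A. sq_summable d (b A)"
    and lim: "((\<lambda>A. l2 d (\<lambda>is. a is - b A is)) \<longlongrightarrow> 0) \<F>"
  shows "((\<lambda>A. stein_discrepancy d (b A)) \<longlongrightarrow> stein_discrepancy d a) \<F>"
  unfolding stein_discrepancy_def
proof (intro tendsto_real_sqrt tendsto_sum tendsto_mult tendsto_const tendsto_power)
  fix r assume "r \<in> {1..d-1}"
  then have r: "r \<le> d" by auto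
  have "((\<lambda>A. l2 d (\<lambda>is. a is - b A is) * (l2 d a + l2 d (b A))) \<longlongrightarrow> 0 * (l2 d a + l2 d a)) \<F>"
    by (intro tendsto_intros lim l2_tendsto sa sb)
  then have lim': "((\<lambda>A. l2 d (\<lambda>is. a is - b A is) * (l2 d a + l2 d (b A))) \<longlongrightarrow> 0) \<F>" by simp
  have "((\<lambda>A. sym_contraction_norm d r (b A) - sym_contraction_norm d r a) \<longlongrightarrow> 0) \<F>"
    by (rule Lim_null_comparison[OF _ lim'])
      (use sym_contraction_norm_diff[OF sa sb r] in \<open>simp add: abs_minus_commute\<close>)
  then show "((\<lambda>A. sym_contraction_norm d r (b A)) \<longlongrightarrow> sym_contraction_norm d r a) \<F>"
    by (simp add: LIM_zero_iff)
qed

text \<open>For arrays that vanish outside the first n coordinates the infinite sums over lists reduce to the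
  finite sums of the polynomial setting.\<close>

definition supported :: "nat \<Rightarrow> nat \<Rightarrow> (nat list \<Rightarrow> real) \<Rightarrow> bool" where
  "supported n d a \<longleftrightarrow> (\<forall>is. length is = d \<longrightarrow> \<not> set is \<subseteq> {..<n} \<longrightarrow> a is = 0)"

lemma supportedD: "supported n d a \<Longrightarrow> length is = d \<Longrightarrow> \<not> set is \<subseteq> {..<n} \<Longrightarrow> a is = 0"
  by (simp add: supported_def)

lemma infsum_supported:
  assumes "\<And>is. length is = m \<Longrightarrow> \<not> set is \<subseteq> {..<n} \<Longrightarrow> w is = (0 :: real)"
  shows "(\<Sum>\<^sub>\<infinity>is\<in>index_lists m. w is) = (\<Sum>is\<in>ibox n m. w is)"
proof -
  have "(\<Sum>\<^sub>\<infinity>is\<in>index_lists m. w is) = (\<Sum>\<^sub>\<infinity>is\<in>ibox n m. w is)"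
    by (rule infsum_cong_neutral) (use assms in \<open>auto simp: ibox_def\<close>)
  then show ?thesis by simp
qed

lemma supported_sq_summable:
  assumes "supported n d a" shows "sq_summable d a"
proof -
  have "(\<lambda>is. (a is)\<^sup>2) summable_on ibox n d" by (rule summable_on_finite) simp
  also have "?this \<longleftrightarrow> (\<lambda>is. (a is)\<^sup>2) summable_on index_lists d"
    by (rule summable_on_cong_neutral) (use assms in \<open>auto simp: ibox_def supported_def\<close>)
  finally show ?thesis by (simp add: sq_summable_def)
qed

lemma supported_l2: "supported n d a \<Longrightarrow> (l2 d a)\<^sup>2 = (\<Sum>is\<in>ibox n d. (a is)\<^sup>2)"
  unfolding l2_square by (rule infsum_supported) (auto simp: supported_def)

lemma supported_arr_contraction:
  assumes a: "supported n d a" and r: "r \<le> d" and zs: "length zs = 2 * d - 2 * r"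
  shows "arr_contraction d r a a zs = box_contraction n d r a a zs"
  unfolding arr_contraction_def box_contraction_def
proof (rule infsum_supported)
  fix "is" :: "nat list" assume "length is = r" "\<not> set is \<subseteq> {..<n}"
  then have "a (is @ take (d - r) zs) = 0"
    using a r zs unfolding supported_def by auto
  then show "a (is @ take (d - r) zs) * a (is @ drop (d - r) zs) = 0" by simp
qed

lemma supported_sym_contraction_norm:
  assumes a: "supported n d a" and r: "r \<le> d"
  shows "(sym_contraction_norm d r a)\<^sup>2 = contraction_energy n d r a"
proof -
  let ?m = "2 * d - 2 * r"
  have eq: "symmetrization ?m (arr_contraction d r a a) zs = symmetrization ?m (box_contraction n d r a a) zs" for zs
    unfolding symmetrization_def using supported_arr_contraction[OF a r] by simp
  have z: "box_contraction n d r a a zs = 0" if "length zs = ?m" "\<not> set zs \<subseteq> {..<n}" for zs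
    unfolding box_contraction_def
  proof (intro sum.neutral ballI)
    fix "is" assume "is \<in> ibox n r"
    then have l: "length is = r" by (simp add: ibox_def)
    have "set zs = set (take (d - r) zs) \<union> set (drop (d - r) zs)"
      by (metis append_take_drop_id set_append)
    then have "\<not> set (take (d - r) zs) \<subseteq> {..<n} \<or> \<not> set (drop (d - r) zs) \<subseteq> {..<n}"
      using that(2) by auto
    moreover have "a (is @ xs) = 0" if "length xs = d - r" "\<not> set xs \<subseteq> {..<n}" for xs
      by (rule supportedD[OF a]) (use that l r in auto)
    moreover have "length (take (d - r) zs) = d - r" "length (drop (d - r) zs) = d - r"
      using r that(1) by auto
    ultimately have "a (is @ take (d - r) zs) = 0 \<or> a (is @ drop (d - r) zs) = 0" by metis
    then show "a (is @ take (d - r) zs) * a (is @ drop (d - r) zs) = 0" by auto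
  qed
  have "symmetrization ?m (box_contraction n d r a a) zs = 0" if "length zs = ?m" "\<not> set zs \<subseteq> {..<n}" for zs
    unfolding symmetrization_def using that z by (auto intro!: sum.neutral)
  then show ?thesis
    unfolding sym_contraction_norm_def l2_square contraction_energy_def eq by (intro infsum_supported) auto
qed

lemma supported_stein_discrepancy:
  assumes a: "supported n d a"
  shows "(stein_discrepancy d a)\<^sup>2
    = (\<Sum>r=1..d-1. (carre_coeff d r)\<^sup>2 * fact (2 * d - 2 * r) * contraction_energy n d r a)"
proof -
  have "(stein_discrepancy d a)\<^sup>2
      = (\<Sum>r=1..d-1. (carre_coeff d r)\<^sup>2 * fact (2 * d - 2 * r) * (sym_contraction_norm d r a)\<^sup>2)"
    unfolding stein_discrepancy_def by (auto intro!: real_sqrt_pow2 sum_nonneg)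
  also have "\<dots> = (\<Sum>r=1..d-1. (carre_coeff d r)\<^sup>2 * fact (2 * d - 2 * r) * contraction_energy n d r a)"
    by (intro sum.cong refl) (auto simp: supported_sym_contraction_norm[OF a])
  finally show ?thesis .
qed

lemma supported_contraction_energy_le:
  assumes a: "supported n d a" and r: "r \<le> d"
  shows "contraction_energy n d r a \<le> (\<Sum>is\<in>ibox n d. (a is)\<^sup>2)\<^sup>2"
proof -
  have "(sym_contraction_norm d r a)\<^sup>2 \<le> ((l2 d a)\<^sup>2)\<^sup>2"
    by (intro power_mono sym_contraction_norm_le supported_sq_summable[OF a] r sym_contraction_norm_nonneg)
  then show ?thesis by (simp add: supported_sym_contraction_norm[OF a r] supported_l2[OF a])
qed

lemma stein_discrepancy_nonneg: "stein_discrepancy d a \<ge> 0"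
  by (simp add: stein_discrepancy_def sum_nonneg)

section \<open>Hermite products and basis tensors as Wick monomials\<close>

lemma pd_wick_zero:
  assumes "i \<notin> set is"
  shows "pd i (wick is) = (\<lambda>_. 0)"
  using assms
proof (induction "is")
  case Nil
  then show ?case by (simp add: pd_const)
next
  case (Cons j "is")
  define n where "n = Suc (Max (set (j # is)))"
  have n: "set (j # is) \<subseteq> {..<n}" by (auto simp: n_def less_Suc_eq_le)
  have "pd i (creation j (wick is)) = (\<lambda>x. (if i = j then wick is x else 0) + creation j (pd i (wick is)) x)"
    by (rule pd_creation[OF wick_polys]) (use n in auto)
  then show ?case using Cons by (simp add: creation_zero)
qed

lemma poly_in_polys: "i < n \<Longrightarrow> (\<lambda>x. poly p (x i)) \<in> polys n"
proof (induction p)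
  case 0
  then show ?case by (simp add: polys.const)
next
  case (pCons a p)
  then have "(\<lambda>x. a + x i * poly p (x i)) \<in> polys n" by (intro polys.intros)
  then show ?case by simp
qed

lemma pd_poly: "pd i (\<lambda>x. poly p (x i)) = (\<lambda>x. poly (pderiv p) (x i))"
  by (rule pd_eqI) simp

lemma hermite_Suc: "hermite (Suc k) = [:0, 1:] * hermite k - pderiv (hermite k)"
  by (simp add: hermite_def)

text \<open>In a coordinate that the rest of the monomial does not involve, creation acts by the recursion of
  the Hermite polynomials.\<close>

lemma wick_replicate_append:
  assumes "i \<notin> set is"
  shows "wick (replicate k i @ is) = (\<lambda>x. poly (hermite k) (x i) * wick is x)"
proof (induction k)
  case 0
  then show ?case by (simp add: hermite_def)
next
  case (Suc k)
  define n where "n = Suc (Max (set (i # is)))"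
  have n: "set (i # is) \<subseteq> {..<n}" by (auto simp: n_def less_Suc_eq_le)
  have "pd i (\<lambda>x. poly (hermite k) (x i) * wick is x) = (\<lambda>x. poly (pderiv (hermite k)) (x i) * wick is x)"
    by (subst pd_mult[OF poly_in_polys wick_polys, where n = n])
      (use n in \<open>auto simp: pd_wick_zero[OF assms] pd_poly\<close>)
  moreover have "wick (replicate (Suc k) i @ is) = creation i (\<lambda>x. poly (hermite k) (x i) * wick is x)"
    using Suc by simp
  ultimately show ?case by (simp add: creation_def hermite_Suc algebra_simps fun_eq_iff)
qed

text \<open>The indices of a multi-index with multiplicities, in the order in which the basis tensors list their
  factors.\<close>

definition index_list :: "(nat \<Rightarrow> nat) \<Rightarrow> nat list" where
  "index_list q = concat (map (\<lambda>i. replicate (q i) i) (sorted_list_of_set {i. q i \<noteq> 0}))"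

lemma wick_concat_replicate:
  assumes "distinct L"
  shows "wick (concat (map (\<lambda>i. replicate (q i) i) L)) x = (\<Prod>i\<in>set L. poly (hermite (q i)) (x i))"
  using assms
proof (induction L)
  case (Cons i L)
  then have "i \<notin> set (concat (map (\<lambda>i. replicate (q i) i) L))" by auto
  from wick_replicate_append[OF this] Cons show ?case by simp
qed simp

lemma hermite_product_eq_wick:
  assumes "finite {i. q i \<noteq> 0}"
  shows "hermite_product G q \<omega> = wick (index_list q) (\<lambda>i. G i \<omega>)"
  using wick_concat_replicate[of "sorted_list_of_set {i. q i \<noteq> 0}" q "\<lambda>i. G i \<omega>"] assms
  by (simp add: hermite_product_def index_list_def)

lemma length_index_list:
  assumes "q \<in> multi_indices d"
  shows "length (index_list q) = d"
proof -
  have "length (index_list q) = (\<Sum>i\<in>{i. q i \<noteq> 0}. q i)"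
    using assms unfolding index_list_def length_concat
    by (simp add: multi_indices_def o_def sum_list_distinct_conv_sum_set)
  then show ?thesis using assms by (simp add: multi_indices_def)
qed

definition sym_basis_array :: "nat \<Rightarrow> (nat \<Rightarrow> nat) \<Rightarrow> nat list \<Rightarrow> real" where
  "sym_basis_array d q = symmetrization d (\<lambda>is. if is = index_list q then 1 else 0)"

lemma elementary_tensor_basis:
  assumes "orthonormal_basis e" "length is = length js"
  shows "elementary_tensor (map e js) (map e is) = (if is = js then 1 else 0)"
proof -
  have on: "inner (e i) (e j) = (if i = j then 1 else 0)" for i j
    using assms(1) by (simp add: orthonormal_basis_def)
  have "elementary_tensor (map e js) (map e is) = (\<Prod>k<length js. if js ! k = is ! k then 1 else 0)"
    using assms(2) by (simp add: elementary_tensor_def on)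
  also have "\<dots> = (if is = js then 1 else 0)"
  proof (cases "is = js")
    case False
    then obtain k where "k < length js" "js ! k \<noteq> is ! k"
      using assms(2) by (metis list_eq_iff_nth_eq)
    then have "(\<Prod>k<length js. if js ! k = is ! k then 1 else 0 :: real) = 0"
      by (intro prod_zero) auto
    then show ?thesis using False by simp
  qed simp
  finally show ?thesis .
qed

text \<open>By orthonormality the elementary tensor of the listed basis vectors has the single nonzero
  coordinate 1.\<close>

lemma sym_basis_tensor_basis:
  assumes e: "orthonormal_basis e" and q: "q \<in> multi_indices d" and l: "length is = d"
  shows "sym_basis_tensor e d q (map e is) = sym_basis_array d q is"
proof -
  have "concat (map (\<lambda>i. replicate (q i) (e i)) L) = map e (concat (map (\<lambda>i. replicate (q i) i) L))" for L
    by (induction L) auto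
  then have "sym_basis_tensor e d q = symmetrization d (elementary_tensor (map e (index_list q)))"
    by (simp add: sym_basis_tensor_def index_list_def)
  moreover have "elementary_tensor (map e (index_list q)) (permute_list \<pi> (map e is))
      = (if permute_list \<pi> is = index_list q then 1 else 0)" if "\<pi> permutes {..<d}" for \<pi>
  proof -
    have "permute_list \<pi> (map e is) = map e (permute_list \<pi> is)"
      using that l by (simp add: permute_list_map)
    then show ?thesis
      using l length_index_list[OF q] by (simp add: elementary_tensor_basis[OF e])
  qed
  ultimately show ?thesis
    using l by (simp add: sym_basis_array_def symmetrization_def)
qed

lemma symmetric_sym_basis_array: "symmetric_array d (sym_basis_array d q)"
  unfolding sym_basis_array_def by (rule symmetric_symmetrization)

lemma supported_sym_basis_array:
  assumes "set (index_list q) \<subseteq> {..<n}"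
  shows "supported n d (sym_basis_array d q)"
  unfolding supported_def
proof (intro allI impI)
  fix "is" :: "nat list" assume l: "length is = d" and s: "\<not> set is \<subseteq> {..<n}"
  have "permute_list \<pi> is \<noteq> index_list q" if "\<pi> permutes {..<d}" for \<pi>
  proof
    assume "permute_list \<pi> is = index_list q"
    then have "set (index_list q) = set is" using that l set_permute_list[of \<pi> "is"] by metis
    then show False using s assms by simp
  qed
  then show "sym_basis_array d q is = 0"
    by (auto simp: sym_basis_array_def symmetrization_def intro!: sum.neutral)
qed

text \<open>Since the chaos element does not see the symmetrization, only one Wick monomial remains.\<close>

lemma chaos_sym_basis_array:
  assumes q: "q \<in> multi_indices d" and n: "set (index_list q) \<subseteq> {..<n}"
  shows "chaos n d (sym_basis_array d q) = wick (index_list q)"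
proof
  fix x
  have "index_list q \<in> ibox n d" using n length_index_list[OF q] by (simp add: ibox_def)
  moreover have "(if is = index_list q then 1 else 0) * wick is x
      = (if is = index_list q then wick (index_list q) x else 0)" for "is" by simp
  ultimately show "chaos n d (sym_basis_array d q) x = wick (index_list q) x"
    unfolding sym_basis_array_def chaos_symmetrization chaos_def by simp
qed

definition basis_combination :: "nat \<Rightarrow> ((nat \<Rightarrow> nat) \<Rightarrow> real) \<Rightarrow> (nat \<Rightarrow> nat) set \<Rightarrow> nat list \<Rightarrow> real" where
  "basis_combination d c A is = (\<Sum>q\<in>A. c q * sym_basis_array d q is)"

lemma symmetric_basis_combination: "symmetric_array d (basis_combination d c A)"
  unfolding symmetric_array_def
proof (intro allI impI)
  fix "is" js :: "nat list" assume l: "length is = d" "mset is = mset js"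
  show "basis_combination d c A is = basis_combination d c A js"
    unfolding basis_combination_def
    by (intro sum.cong refl arg_cong2[where f = "(*)"] symmetric_arrayD[OF symmetric_sym_basis_array] l)
qed

text \<open>Finitely many multi-indices involve finitely many Gaussian variables. The bound is taken positive
  because laws of independent families are compared over nonempty index sets.\<close>

lemma index_list_bound:
  assumes "finite A"
  obtains n where "n > 0" "\<And>q. q \<in> A \<Longrightarrow> set (index_list q) \<subseteq> {..<n}"
proof -
  have "finite (\<Union>q\<in>A. set (index_list q))" using assms by auto
  then obtain m where "\<forall>i\<in>(\<Union>q\<in>A. set (index_list q)). i < m" by (auto simp: finite_nat_set_iff_bounded)
  then show thesis by (intro that[of "Suc m"]) (auto simp: less_Suc_eq)
qed

lemma supported_basis_combination:
  assumes "\<And>q. q \<in> A \<Longrightarrow> set (index_list q) \<subseteq> {..<n}"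
  shows "supported n d (basis_combination d c A)"
  unfolding supported_def
proof (intro allI impI)
  fix "is" :: "nat list" assume l: "length is = d" "\<not> set is \<subseteq> {..<n}"
  show "basis_combination d c A is = 0"
    unfolding basis_combination_def
    using supportedD[OF supported_sym_basis_array[OF assms] l] by (auto intro!: sum.neutral)
qed

lemma chaos_basis_combination:
  assumes "A \<subseteq> multi_indices d" "\<And>q. q \<in> A \<Longrightarrow> set (index_list q) \<subseteq> {..<n}"
  shows "chaos n d (basis_combination d c A) (\<lambda>i. G i \<omega>) = (\<Sum>q\<in>A. c q * hermite_product G q \<omega>)"
proof -
  have "chaos n d (basis_combination d c A) (\<lambda>i. G i \<omega>)
      = (\<Sum>q\<in>A. c q * chaos n d (sym_basis_array d q) (\<lambda>i. G i \<omega>))"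
    unfolding basis_combination_def[abs_def] chaos_sum chaos_cmult ..
  also have "\<dots> = (\<Sum>q\<in>A. c q * hermite_product G q \<omega>)"
  proof (intro sum.cong refl)
    fix q assume q: "q \<in> A"
    then have "q \<in> multi_indices d" using assms(1) by auto
    then show "c q * chaos n d (sym_basis_array d q) (\<lambda>i. G i \<omega>) = c q * hermite_product G q \<omega>"
      using chaos_sym_basis_array[OF _ assms(2)[OF q]]
      by (subst hermite_product_eq_wick) (auto simp: multi_indices_def)
  qed
  finally show ?thesis .
qed

lemma sq_summable_basis_combination: "sq_summable d (basis_combination d c A)"
proof (cases "finite A")
  case True
  from index_list_bound[OF this] obtain n where "\<And>q. q \<in> A \<Longrightarrow> set (index_list q) \<subseteq> {..<n}" by blast
  then show ?thesis by (intro supported_sq_summable supported_basis_combination)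
next
  case False
  then have "basis_combination d c A = (\<lambda>_. 0)" by (simp add: basis_combination_def fun_eq_iff)
  then show ?thesis by (simp add: sq_summable_zero)
qed

lemma tensor_norm_eq_l2: "tensor_norm e m f = l2 m (\<lambda>is. f (map e is))"
  by (simp add: tensor_norm_def tensor_inner_def l2_def power2_eq_square)

lemma sym_contraction_basis:
  assumes "length zs = 2 * d - 2 * r"
  shows "sym_contraction e d r h h (map e zs)
    = symmetrization (2 * d - 2 * r) (arr_contraction d r (\<lambda>is. h (map e is)) (\<lambda>is. h (map e is))) zs"
proof -
  have "contraction e d r h h (permute_list \<pi> (map e zs))
      = arr_contraction d r (\<lambda>is. h (map e is)) (\<lambda>is. h (map e is)) (permute_list \<pi> zs)"
    if "\<pi> permutes {..<2 * d - 2 * r}" for \<pi>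
  proof -
    have "permute_list \<pi> (map e zs) = map e (permute_list \<pi> zs)"
      using that assms by (simp add: permute_list_map)
    then show ?thesis
      using assms by (simp add: contraction_def arr_contraction_def take_map drop_map)
  qed
  then show ?thesis using assms by (simp add: sym_contraction_def symmetrization_def)
qed

lemma T1_eq_stein_discrepancy: "T1 e d h = stein_discrepancy d (\<lambda>is. h (map e is))"
proof -
  have "(carre_coeff d r)\<^sup>2 = (real d)\<^sup>2 * ((fact (r - 1))\<^sup>2 * real ((d - 1) choose (r - 1)) ^ 4)" for r
    by (simp add: carre_coeff_def power_mult_distrib power_mult[symmetric])
  moreover have "tensor_norm e (2 * (d - r)) (sym_contraction e d r h h) = sym_contraction_norm d r (\<lambda>is. h (map e is))" for r
    unfolding tensor_norm_eq_l2 sym_contraction_norm_def diff_mult_distrib2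
    by (rule l2_cong) (rule sym_contraction_basis)
  ultimately show ?thesis
    unfolding T1_def stein_discrepancy_def by (simp add: sum_distrib_left mult.assoc)
qed

section \<open>Bounds for finite chaos elements\<close>

lemma mean_value_bound:
  fixes f f' :: "real \<Rightarrow> real"
  assumes f: "\<And>z. (f has_real_derivative f' z) (at z)" and K: "\<And>z. \<bar>z\<bar> \<le> \<bar>x\<bar> \<Longrightarrow> \<bar>f' z\<bar> \<le> K"
  shows "\<bar>f x - f 0\<bar> \<le> K * \<bar>x\<bar>"
proof -
  have "norm (f x - f 0) \<le> K * norm (x - 0)"
  proof (rule field_differentiable_bound[where S = "closed_segment 0 x" and f' = f'])
    fix z assume z: "z \<in> closed_segment 0 x"
    then have "\<bar>z\<bar> \<le> \<bar>x\<bar>" by (auto simp: closed_segment_eq_real_ivl split: if_splits)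
    then show "norm (f' z) \<le> K" using K by simp
    show "(f has_field_derivative f' z) (at z within closed_segment 0 x)"
      using f by (rule has_field_derivative_at_within)
  qed auto
  then show ?thesis by simp
qed

lemma nonneg_quadratic_discriminant:
  fixes a b c :: real
  assumes q: "\<And>t. 0 \<le> a * t\<^sup>2 - 2 * b * t + c" and a: "a \<ge> 0"
  shows "b\<^sup>2 \<le> a * c"
proof (cases "a = 0")
  case True
  have "b = 0"
  proof (rule ccontr)
    assume "b \<noteq> 0"
    then show False using q[of "(c + 1) / (2 * b)"] True by simp
  qed
  then show ?thesis using True by simp
next
  case False
  then have "a > 0" using a by simp
  then have "0 \<le> a * (a * (b / a)\<^sup>2 - 2 * b * (b / a) + c)"
    by (intro mult_nonneg_nonneg q) simp
  also have "\<dots> = a * c - b\<^sup>2"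
    using \<open>a > 0\<close> by (simp add: power2_eq_square field_simps)
  finally show ?thesis by simp
qed

text \<open>The integral of \<open>(t * \<bar>u\<bar> - \<bar>v\<bar>)\<^sup>2\<close> is a nonnegative quadratic polynomial in t.\<close>

lemma Cauchy_Schwarz_integral:
  fixes u v :: "'a \<Rightarrow> real"
  assumes [measurable]: "u \<in> borel_measurable M" "v \<in> borel_measurable M"
    and u: "integrable M (\<lambda>x. (u x)\<^sup>2)" and v: "integrable M (\<lambda>x. (v x)\<^sup>2)"
  shows "integrable M (\<lambda>x. u x * v x)"
    "(\<integral>x. \<bar>u x * v x\<bar> \<partial>M) \<le> sqrt (\<integral>x. (u x)\<^sup>2 \<partial>M) * sqrt (\<integral>x. (v x)\<^sup>2 \<partial>M)"
proof -
  have ab: "\<bar>a * b\<bar> \<le> a\<^sup>2 + b\<^sup>2" for a b :: real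
  proof -
    have "0 \<le> \<bar>a\<bar> * \<bar>b\<bar>" by simp
    then show ?thesis
      using sum_squares_bound[of "\<bar>a\<bar>" "\<bar>b\<bar>"] unfolding abs_mult power2_abs by linarith
  qed
  show int: "integrable M (\<lambda>x. u x * v x)"
    by (rule Bochner_Integration.integrable_bound[OF Bochner_Integration.integrable_add[OF u v]])
      (auto intro!: AE_I2 ab order_trans[OF _ abs_ge_self])
  let ?U = "\<integral>x. (u x)\<^sup>2 \<partial>M" and ?V = "\<integral>x. (v x)\<^sup>2 \<partial>M" and ?W = "\<integral>x. \<bar>u x * v x\<bar> \<partial>M"
  have "0 \<le> ?U * t\<^sup>2 - 2 * ?W * t + ?V" for t
  proof -
    have "0 \<le> (\<integral>x. (t * \<bar>u x\<bar> - \<bar>v x\<bar>)\<^sup>2 \<partial>M)" by simp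
    also have "\<dots> = (\<integral>x. t\<^sup>2 * (u x)\<^sup>2 - (2 * t) * \<bar>u x * v x\<bar> + (v x)\<^sup>2 \<partial>M)"
      by (intro Bochner_Integration.integral_cong refl) (simp add: power2_diff power_mult_distrib abs_mult)
    also have "\<dots> = t\<^sup>2 * ?U - (2 * t) * ?W + ?V"
      using u v int by simp
    finally show ?thesis by (simp add: algebra_simps)
  qed
  from nonneg_quadratic_discriminant[OF this] have "?W\<^sup>2 \<le> ?U * ?V" by simp
  then have "sqrt (?W\<^sup>2) \<le> sqrt (?U * ?V)" by (rule real_sqrt_le_mono)
  then show "?W \<le> sqrt ?U * sqrt ?V" by (simp add: real_sqrt_mult)
qed

text \<open>The heart of Stein's method on the chaos. With f the solution of Stein's equation, integration by
  parts gives \<open>E g(F) - E g(Z) = E (f'(F) * (1 - \<Gamma>))\<close>. Cauchy-Schwarz separates the two factors; the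
  second moment of \<open>1 - \<Gamma>\<close> is the squared bias \<open>(1 - s)\<^sup>2\<close> plus the variance of \<open>\<Gamma>\<close>. The second moment
  s of F is kept general because approximations of F need not be normalized.\<close>

lemma chaos_stein_bound:
  assumes a: "symmetric_array d a" and sup: "supported n d a" and d: "d \<ge> 1"
    and g: "integrable gauss g" and cg: "continuous_on UNIV g"
    and bd: "\<And>y. \<bar>stein_deriv g y\<bar> \<le> \<alpha> + \<beta> * \<bar>y\<bar>" and ab: "\<alpha> \<ge> 0" "\<beta> \<ge> 0"
    and sg: "tame n (\<lambda>x. g (chaos n d a x))"
  defines "s \<equiv> (\<integral>x. (chaos n d a x)\<^sup>2 \<partial>gaussn n)"
  shows "\<bar>(\<integral>x. g (chaos n d a x) \<partial>gaussn n) - (\<integral>y. g y \<partial>gauss)\<bar>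
    \<le> (\<alpha> + \<beta> * sqrt s) * sqrt ((1 - s)\<^sup>2 + (stein_discrepancy d a)\<^sup>2)"
proof -
  interpret prob_space "gaussn n" by (rule prob_space_gaussn)
  let ?F = "chaos n d a" and ?G = "carre n d a" and ?f' = "stein_deriv g" and ?f = "stein g"
  let ?c = "\<integral>y. g y \<partial>gauss"
  note tF = tame_polys[OF chaos_polys, of n d a]
  have tG: "tame n ?G"
  proof -
    have "?G \<in> polys n"
      unfolding carre_def[abs_def] by (intro polys_cmult polys_sum polys_power chaos_polys)
    then show ?thesis by (rule tame_polys)
  qed
  have gf': "\<bar>?f' y\<bar> \<le> (\<alpha> + \<beta>) * (1 + \<bar>y\<bar>) ^ 1" for y
  proof -
    have "\<alpha> + \<beta> * \<bar>y\<bar> \<le> (\<alpha> + \<beta>) * (1 + \<bar>y\<bar>) ^ 1" using ab by (simp add: algebra_simps)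
    then show ?thesis using bd[of y] by linarith
  qed
  have D: "(?f has_real_derivative ?f' y) (at y)" for y by (rule DERIV_stein[OF g cg])
  have cf': "continuous_on UNIV ?f'" by (rule continuous_stein_deriv[OF g cg])
  have cf: "continuous_on UNIV ?f"
    using D by (meson DERIV_continuous continuous_at_imp_continuous_on)
  have gf: "\<bar>?f y\<bar> \<le> (\<bar>?f 0\<bar> + (\<alpha> + \<beta>)) * (1 + \<bar>y\<bar>) ^ 2" for y
  proof -
    have "\<bar>?f' z\<bar> \<le> (\<alpha> + \<beta>) * (1 + \<bar>y\<bar>)" if "\<bar>z\<bar> \<le> \<bar>y\<bar>" for z
      using gf'[of z] ab that mult_left_mono[of "1 + \<bar>z\<bar>" "1 + \<bar>y\<bar>" "\<alpha> + \<beta>"] by simp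
    from mean_value_bound[OF D this] have "\<bar>?f y - ?f 0\<bar> \<le> ((\<alpha> + \<beta>) * (1 + \<bar>y\<bar>)) * \<bar>y\<bar>" .
    also have "\<dots> \<le> ((\<alpha> + \<beta>) * (1 + \<bar>y\<bar>)) * (1 + \<bar>y\<bar>)"
      using ab by (intro mult_left_mono) auto
    finally have "\<bar>?f y\<bar> \<le> \<bar>?f 0\<bar> * 1 + (\<alpha> + \<beta>) * (1 + \<bar>y\<bar>) ^ 2"
      by (simp add: power2_eq_square mult.assoc)
    also have "\<dots> \<le> \<bar>?f 0\<bar> * (1 + \<bar>y\<bar>) ^ 2 + (\<alpha> + \<beta>) * (1 + \<bar>y\<bar>) ^ 2"
      using ab by (intro add_mono mult_left_mono order_refl) (auto simp: one_le_power)
    finally show ?thesis by (simp add: algebra_simps)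
  qed
  have tf': "tame n (\<lambda>x. ?f' (?F x))"
    by (intro tame_compose[OF tF _ gf'] borel_measurable_continuous_onI cf')
  have tf: "tame n (\<lambda>x. ?f (?F x))"
    by (intro tame_compose[OF tF _ gf] borel_measurable_continuous_onI cf)
  have EG: "(\<integral>x. ?G x \<partial>gaussn n) = s"
  proof -
    have "(\<integral>x. ?F x * ?F x \<partial>gaussn n) = (\<integral>x. 1 * ?G x \<partial>gaussn n)"
      by (rule chaos_integration_by_parts[OF a d, where f = "\<lambda>y. y" and f' = "\<lambda>_. 1" and A = 1 and k = 1 and B = 1 and l = 0])
        auto
    then show ?thesis by (simp add: s_def power2_eq_square)
  qed
  have s: "s = fact d * (\<Sum>is\<in>ibox n d. (a is)\<^sup>2)"
    unfolding s_def by (rule chaos_second_moment[OF a])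
  have var: "(\<integral>x. (1 - ?G x)\<^sup>2 \<partial>gaussn n) = (1 - s)\<^sup>2 + (stein_discrepancy d a)\<^sup>2"
  proof -
    have "(\<integral>x. (1 - ?G x)\<^sup>2 \<partial>gaussn n)
        = (\<integral>x. (1 - s)\<^sup>2 + ((?G x - s)\<^sup>2 - (2 * (1 - s)) * (?G x - s)) \<partial>gaussn n)"
      by (intro Bochner_Integration.integral_cong refl) (simp add: power2_eq_square algebra_simps)
    also have "\<dots> = (1 - s)\<^sup>2 + ((\<integral>x. (?G x - s)\<^sup>2 \<partial>gaussn n) - (2 * (1 - s)) * ((\<integral>x. ?G x \<partial>gaussn n) - s))"
    proof -
      have i1: "integrable (gaussn n) ?G" by (rule tame_integrable[OF tG])
      have i2: "integrable (gaussn n) (\<lambda>x. (?G x - s)\<^sup>2)"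
        by (intro tame_integrable tame_power tame_diff tG tame_const)
      show ?thesis using i1 i2 by (simp add: prob_space)
    qed
    finally show ?thesis
      unfolding EG using carre_variance[OF a d, of n] by (simp add: s supported_stein_discrepancy[OF sup])
  qed
  have i: "integrable (gaussn n) (\<lambda>x. ?f' (?F x))" "integrable (gaussn n) (\<lambda>x. ?F x * ?f (?F x))"
      "integrable (gaussn n) (\<lambda>x. ?f' (?F x) * ?G x)" "integrable (gaussn n) (\<lambda>x. g (?F x))"
    by (intro tame_integrable tame_mult tf tf' tF tG sg)+
  have "(\<integral>x. g (?F x) \<partial>gaussn n) - ?c = (\<integral>x. ?f' (?F x) - ?F x * ?f (?F x) \<partial>gaussn n)"
    using i by (simp add: stein_deriv_def prob_space)
  also have "\<dots> = (\<integral>x. ?f' (?F x) \<partial>gaussn n) - (\<integral>x. ?F x * ?f (?F x) \<partial>gaussn n)"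
    using i by simp
  also have "(\<integral>x. ?F x * ?f (?F x) \<partial>gaussn n) = (\<integral>x. ?f' (?F x) * ?G x \<partial>gaussn n)"
    by (rule chaos_integration_by_parts[OF a d D cf' gf gf'])
  also have "(\<integral>x. ?f' (?F x) \<partial>gaussn n) - \<dots> = (\<integral>x. ?f' (?F x) * (1 - ?G x) \<partial>gaussn n)"
    using i by (simp add: right_diff_distrib)
  finally have "\<bar>(\<integral>x. g (?F x) \<partial>gaussn n) - ?c\<bar> = \<bar>\<integral>x. ?f' (?F x) * (1 - ?G x) \<partial>gaussn n\<bar>" by simp
  also have "\<dots> \<le> (\<integral>x. \<bar>?f' (?F x) * (1 - ?G x)\<bar> \<partial>gaussn n)" by (rule integral_abs_bound)
  also have "\<dots> \<le> sqrt (\<integral>x. (?f' (?F x))\<^sup>2 \<partial>gaussn n) * sqrt (\<integral>x. (1 - ?G x)\<^sup>2 \<partial>gaussn n)"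
    by (intro Cauchy_Schwarz_integral(2) tame_measurable tame_integrable tame_power tame_diff tf' tG tame_const)
  also have "\<dots> \<le> (\<alpha> + \<beta> * sqrt s) * sqrt ((1 - s)\<^sup>2 + (stein_discrepancy d a)\<^sup>2)"
    unfolding var
  proof (intro mult_right_mono)
    have E1: "(\<integral>x. \<bar>?F x\<bar> \<partial>gaussn n) \<le> sqrt s"
      using Cauchy_Schwarz_integral(2)[of ?F "gaussn n" "\<lambda>_. 1"] tame_measurable[OF tF]
        tame_integrable[OF tame_power[OF tF]] by (simp add: s_def prob_space)
    have iF: "integrable (gaussn n) (\<lambda>x. \<bar>?F x\<bar>)" "integrable (gaussn n) (\<lambda>x. (?F x)\<^sup>2)"
      using tame_integrable[OF tF] tame_integrable[OF tame_power[OF tF]] by auto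
    have s0: "s \<ge> 0" by (simp add: s_def)
    have "(\<integral>x. (?f' (?F x))\<^sup>2 \<partial>gaussn n) \<le> (\<integral>x. \<alpha>\<^sup>2 + ((2 * \<alpha> * \<beta>) * \<bar>?F x\<bar> + \<beta>\<^sup>2 * (?F x)\<^sup>2) \<partial>gaussn n)"
    proof (rule integral_mono)
      show "integrable (gaussn n) (\<lambda>x. (?f' (?F x))\<^sup>2)" by (intro tame_integrable tame_power tf')
      show "integrable (gaussn n) (\<lambda>x. \<alpha>\<^sup>2 + ((2 * \<alpha> * \<beta>) * \<bar>?F x\<bar> + \<beta>\<^sup>2 * (?F x)\<^sup>2))"
        using iF by simp
      fix x
      have "(?f' (?F x))\<^sup>2 \<le> (\<alpha> + \<beta> * \<bar>?F x\<bar>)\<^sup>2"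
        using power_mono[OF bd[of "?F x"], of 2] by simp
      then show "(?f' (?F x))\<^sup>2 \<le> \<alpha>\<^sup>2 + ((2 * \<alpha> * \<beta>) * \<bar>?F x\<bar> + \<beta>\<^sup>2 * (?F x)\<^sup>2)"
        by (simp add: power2_sum power_mult_distrib algebra_simps)
    qed
    also have "\<dots> = \<alpha>\<^sup>2 + ((2 * \<alpha> * \<beta>) * (\<integral>x. \<bar>?F x\<bar> \<partial>gaussn n) + \<beta>\<^sup>2 * s)"
      using iF by (simp add: prob_space s_def)
    also have "\<dots> \<le> \<alpha>\<^sup>2 + ((2 * \<alpha> * \<beta>) * sqrt s + \<beta>\<^sup>2 * s)"
      using ab E1 by (intro add_left_mono add_right_mono mult_left_mono) auto
    also have "\<dots> = (\<alpha> + \<beta> * sqrt s)\<^sup>2"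
      using s0 by (simp add: power2_sum power_mult_distrib algebra_simps)
    finally show "sqrt (\<integral>x. (?f' (?F x))\<^sup>2 \<partial>gaussn n) \<le> \<alpha> + \<beta> * sqrt s"
      using ab s0 by (intro real_le_lsqrt) auto
  qed simp
  finally show ?thesis .
qed

section \<open>Convergence of moments\<close>

lemma real_power4_diff_le:
  fixes x y :: real
  shows "(x - y) ^ 4 \<le> 8 * (x ^ 4 + y ^ 4)"
proof -
  have "(x - y) ^ 2 \<le> 2 * (x\<^sup>2 + y\<^sup>2)"
    using zero_le_power2[of "x + y"] by (simp add: power2_eq_square algebra_simps)
  then have "((x - y) ^ 2) ^ 2 \<le> (2 * (x\<^sup>2 + y\<^sup>2)) ^ 2" by (intro power_mono) auto
  also have "\<dots> \<le> 8 * ((x\<^sup>2)\<^sup>2 + (y\<^sup>2)\<^sup>2)"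
    using zero_le_power2[of "x\<^sup>2 - y\<^sup>2"] by (simp add: power2_eq_square algebra_simps)
  finally show ?thesis by (simp add: power_mult[symmetric])
qed

context prob_space
begin

lemma expectation_abs_le_L2:
  fixes u :: "'a \<Rightarrow> real"
  assumes [measurable]: "u \<in> borel_measurable M" and u: "integrable M (\<lambda>x. (u x)\<^sup>2)"
  shows "integrable M u" "(\<integral>x. \<bar>u x\<bar> \<partial>M) \<le> sqrt (\<integral>x. (u x)\<^sup>2 \<partial>M)"
  using Cauchy_Schwarz_integral[of u M "\<lambda>_. 1"] u by (auto simp: prob_space)

lemma integrable_square_diff:
  fixes u v :: "'a \<Rightarrow> real"
  assumes [measurable]: "u \<in> borel_measurable M" "v \<in> borel_measurable M"
    and "integrable M (\<lambda>x. (u x)\<^sup>2)" "integrable M (\<lambda>x. (v x)\<^sup>2)"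
  shows "integrable M (\<lambda>x. (u x - v x)\<^sup>2)"
  using Cauchy_Schwarz_integral(1)[of u M v] assms by (simp add: power2_diff mult.assoc)

lemma integrable_power4_diff:
  fixes u v :: "'a \<Rightarrow> real"
  assumes [measurable]: "u \<in> borel_measurable M" "v \<in> borel_measurable M"
    and u: "integrable M (\<lambda>x. (u x) ^ 4)" and v: "integrable M (\<lambda>x. (v x) ^ 4)"
  shows "integrable M (\<lambda>x. (u x - v x) ^ 4)"
proof (rule Bochner_Integration.integrable_bound)
  show "integrable M (\<lambda>x. 8 * ((u x) ^ 4 + (v x) ^ 4))" using u v by simp
  show "AE x in M. norm ((u x - v x) ^ 4) \<le> norm (8 * (u x ^ 4 + v x ^ 4))"
    using real_power4_diff_le by (auto intro!: AE_I2 simp: power_even_abs_numeral)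
qed measurable

lemma second_moment_diff_le:
  fixes X Y :: "'a \<Rightarrow> real"
  assumes [measurable]: "X \<in> borel_measurable M" "Y \<in> borel_measurable M"
    and X: "integrable M (\<lambda>x. (X x)\<^sup>2)" and Y: "integrable M (\<lambda>x. (Y x)\<^sup>2)"
  defines "D \<equiv> (\<integral>x. (X x - Y x)\<^sup>2 \<partial>M)"
  shows "\<bar>(\<integral>x. (Y x)\<^sup>2 \<partial>M) - (\<integral>x. (X x)\<^sup>2 \<partial>M)\<bar> \<le> sqrt D * sqrt (8 * (\<integral>x. (X x)\<^sup>2 \<partial>M) + 2 * D)"
proof -
  have d: "integrable M (\<lambda>x. (X x - Y x)\<^sup>2)" by (rule integrable_square_diff) (use X Y in auto)
  have b: "(X x + Y x)\<^sup>2 \<le> 8 * (X x)\<^sup>2 + 2 * (X x - Y x)\<^sup>2" for x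
    using zero_le_power2[of "2 * X x + (X x - Y x)"] by (simp add: power2_eq_square algebra_simps)
  have s: "integrable M (\<lambda>x. (X x + Y x)\<^sup>2)"
    by (rule Bochner_Integration.integrable_bound[of _ "\<lambda>x. 8 * (X x)\<^sup>2 + 2 * (X x - Y x)\<^sup>2"])
      (use X d b in \<open>auto intro!: AE_I2\<close>)
  have "\<bar>(\<integral>x. (Y x)\<^sup>2 \<partial>M) - (\<integral>x. (X x)\<^sup>2 \<partial>M)\<bar> = \<bar>\<integral>x. (Y x)\<^sup>2 - (X x)\<^sup>2 \<partial>M\<bar>"
    using X Y by simp
  also have "\<dots> \<le> (\<integral>x. \<bar>(Y x)\<^sup>2 - (X x)\<^sup>2\<bar> \<partial>M)" by (rule integral_abs_bound)
  also have "\<dots> = (\<integral>x. \<bar>(X x - Y x) * (X x + Y x)\<bar> \<partial>M)"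
    by (intro Bochner_Integration.integral_cong refl) (simp add: power2_eq_square algebra_simps abs_minus_commute)
  also have "\<dots> \<le> sqrt D * sqrt (\<integral>x. (X x + Y x)\<^sup>2 \<partial>M)"
    unfolding D_def by (rule Cauchy_Schwarz_integral(2)) (use d s in auto)
  also have "\<dots> \<le> sqrt D * sqrt (8 * (\<integral>x. (X x)\<^sup>2 \<partial>M) + 2 * D)"
  proof (intro mult_left_mono real_sqrt_le_mono)
    have "(\<integral>x. (X x + Y x)\<^sup>2 \<partial>M) \<le> (\<integral>x. 8 * (X x)\<^sup>2 + 2 * (X x - Y x)\<^sup>2 \<partial>M)"
      using s X d b by (intro integral_mono) auto
    then show "(\<integral>x. (X x + Y x)\<^sup>2 \<partial>M) \<le> 8 * (\<integral>x. (X x)\<^sup>2 \<partial>M) + 2 * D"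
      using X d by (simp add: D_def)
  qed (simp add: D_def)
  finally show ?thesis .
qed

lemma second_moment_tendsto:
  fixes X :: "'a \<Rightarrow> real" and Y :: "'i \<Rightarrow> 'a \<Rightarrow> real"
  assumes X: "X \<in> borel_measurable M" "integrable M (\<lambda>x. (X x)\<^sup>2)"
    and Y: "\<forall>\<^sub>F A in \<F>. Y A \<in> borel_measurable M \<and> integrable M (\<lambda>x. (Y A x)\<^sup>2)"
    and lim: "((\<lambda>A. \<integral>x. (X x - Y A x)\<^sup>2 \<partial>M) \<longlongrightarrow> 0) \<F>"
  shows "((\<lambda>A. \<integral>x. (Y A x)\<^sup>2 \<partial>M) \<longlongrightarrow> (\<integral>x. (X x)\<^sup>2 \<partial>M)) \<F>"
proof -
  let ?D = "\<lambda>A. \<integral>x. (X x - Y A x)\<^sup>2 \<partial>M"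
  have "((\<lambda>A. sqrt (?D A) * sqrt (8 * (\<integral>x. (X x)\<^sup>2 \<partial>M) + 2 * ?D A)) \<longlongrightarrow> sqrt 0 * sqrt (8 * (\<integral>x. (X x)\<^sup>2 \<partial>M) + 2 * 0)) \<F>"
    by (intro tendsto_intros lim)
  then have l: "((\<lambda>A. sqrt (?D A) * sqrt (8 * (\<integral>x. (X x)\<^sup>2 \<partial>M) + 2 * ?D A)) \<longlongrightarrow> 0) \<F>" by simp
  have "\<forall>\<^sub>F A in \<F>. norm ((\<integral>x. (Y A x)\<^sup>2 \<partial>M) - (\<integral>x. (X x)\<^sup>2 \<partial>M)) \<le> sqrt (?D A) * sqrt (8 * (\<integral>x. (X x)\<^sup>2 \<partial>M) + 2 * ?D A)"
    using Y by eventually_elim (use second_moment_diff_le[OF X(1) _ X(2)] in auto)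
  from Lim_null_comparison[OF this l] show ?thesis by (simp add: LIM_zero_iff)
qed

text \<open>Along a subsequence the approximations converge almost surely, and Fatou's lemma applies to the
  fourth powers.\<close>

lemma fourth_moment_Fatou:
  fixes X :: "'a \<Rightarrow> real" and Y :: "nat \<Rightarrow> 'a \<Rightarrow> real"
  assumes [measurable]: "X \<in> borel_measurable M" "\<And>n. Y n \<in> borel_measurable M"
    and X: "integrable M (\<lambda>x. (X x)\<^sup>2)" and Y: "\<And>n. integrable M (\<lambda>x. (Y n x)\<^sup>2)"
    and lim: "(\<lambda>n. \<integral>x. (X x - Y n x)\<^sup>2 \<partial>M) \<longlonglongrightarrow> 0"
    and Y4: "\<And>n. integrable M (\<lambda>x. (Y n x) ^ 4)" "\<And>n. (\<integral>x. (Y n x) ^ 4 \<partial>M) \<le> K n" and K: "K \<longlonglongrightarrow> k"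
  shows "integrable M (\<lambda>x. (X x) ^ 4)" "(\<integral>x. (X x) ^ 4 \<partial>M) \<le> k"
proof -
  have d: "integrable M (\<lambda>x. (X x - Y n x)\<^sup>2)" for n
    by (rule integrable_square_diff) (use X Y in auto)
  have "(\<lambda>n. sqrt (\<integral>x. (X x - Y n x)\<^sup>2 \<partial>M)) \<longlonglongrightarrow> sqrt 0" by (intro tendsto_real_sqrt lim)
  then have s0: "(\<lambda>n. sqrt (\<integral>x. (X x - Y n x)\<^sup>2 \<partial>M)) \<longlonglongrightarrow> 0" by simp
  have "(\<lambda>n. \<integral>x. norm (X x - Y n x) \<partial>M) \<longlonglongrightarrow> 0"
    by (rule tendsto_sandwich[OF _ _ tendsto_const s0])
      (use expectation_abs_le_L2(2)[OF _ d] in \<open>auto intro!: always_eventually\<close>)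
  moreover have "integrable M (\<lambda>x. X x - Y n x)" for n
    by (rule expectation_abs_le_L2(1)) (use d in auto)
  ultimately obtain r :: "nat \<Rightarrow> nat" where r: "strict_mono r" "AE x in M. (\<lambda>n. X x - Y (r n) x) \<longlonglongrightarrow> 0"
    using tendsto_L1_AE_subseq[of M "\<lambda>n x. X x - Y n x"] by blast
  have "(\<integral>\<^sup>+x. ennreal ((X x) ^ 4) \<partial>M) = (\<integral>\<^sup>+x. liminf (\<lambda>n. ennreal ((Y (r n) x) ^ 4)) \<partial>M)"
  proof (rule nn_integral_cong_AE)
    show "AE x in M. ennreal ((X x) ^ 4) = liminf (\<lambda>n. ennreal ((Y (r n) x) ^ 4))"
      using r(2)
    proof eventually_elim
      case (elim x)
      have "(\<lambda>n. X x - (X x - Y (r n) x)) \<longlonglongrightarrow> X x - 0" by (intro tendsto_diff tendsto_const elim)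
      then have "(\<lambda>n. Y (r n) x) \<longlonglongrightarrow> X x" by simp
      then have "(\<lambda>n. ennreal ((Y (r n) x) ^ 4)) \<longlonglongrightarrow> ennreal ((X x) ^ 4)"
        by (intro tendsto_ennrealI tendsto_power)
      then show ?case by (intro lim_imp_Liminf[symmetric]) auto
    qed
  qed
  also have "\<dots> \<le> liminf (\<lambda>n. \<integral>\<^sup>+x. ennreal ((Y (r n) x) ^ 4) \<partial>M)"
    by (rule nn_integral_liminf) measurable
  also have "\<dots> \<le> liminf (\<lambda>n. ennreal (K (r n)))"
    using Y4 by (intro Liminf_mono always_eventually allI) (auto simp: nn_integral_eq_integral intro!: ennreal_leI)
  also have "\<dots> = ennreal k"
    using LIMSEQ_subseq_LIMSEQ[OF K r(1)] by (intro lim_imp_Liminf) (auto simp: o_def intro!: tendsto_ennrealI)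
  finally have le: "(\<integral>\<^sup>+x. ennreal ((X x) ^ 4) \<partial>M) \<le> ennreal k" .
  then show i: "integrable M (\<lambda>x. (X x) ^ 4)"
    by (intro integrableI_bounded) (auto simp: power_even_abs_numeral intro: le_less_trans)
  have "k \<ge> 0"
    by (rule LIMSEQ_le_const[OF K]) (use Y4(2) in \<open>auto intro!: order_trans[OF _ Y4(2)] integral_nonneg\<close>)
  then show "(\<integral>x. (X x) ^ 4 \<partial>M) \<le> k"
    using le i by (simp add: nn_integral_eq_integral)
qed

text \<open>The difference of fourth powers is \<open>(X\<^sup>2 - Y\<^sup>2) * (X\<^sup>2 + Y\<^sup>2)\<close>; Cauchy-Schwarz is applied to this
  product and then to \<open>(X\<^sup>2 - Y\<^sup>2)\<^sup>2 = (X - Y)\<^sup>2 * (X + Y)\<^sup>2\<close>. Bounds in terms of X and X - Y alone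
  are what is needed when Y tends to X.\<close>

lemma fourth_moment_diff_le:
  fixes X Y :: "'a \<Rightarrow> real"
  assumes [measurable]: "X \<in> borel_measurable M" "Y \<in> borel_measurable M"
    and X: "integrable M (\<lambda>x. (X x) ^ 4)" and Y: "integrable M (\<lambda>x. (Y x) ^ 4)"
  defines "D \<equiv> (\<integral>x. (X x - Y x) ^ 4 \<partial>M)" and "m \<equiv> (\<integral>x. (X x) ^ 4 \<partial>M)"
  shows "\<bar>(\<integral>x. (Y x) ^ 4 \<partial>M) - m\<bar> \<le> sqrt (sqrt D * sqrt (8 * (16 * m + D))) * sqrt (18 * m + 16 * D)"
proof -
  have d: "integrable M (\<lambda>x. (X x - Y x) ^ 4)" by (rule integrable_power4_diff) (use X Y in auto)
  have sq: "(a\<^sup>2)\<^sup>2 = a ^ 4" for a :: real by simp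
  have b1: "(X x + Y x) ^ 4 \<le> 8 * (16 * (X x) ^ 4 + (X x - Y x) ^ 4)" for x
    using real_power4_diff_le[of "2 * X x" "X x - Y x"] by (simp add: power_mult_distrib)
  have b2: "((X x)\<^sup>2 + (Y x)\<^sup>2)\<^sup>2 \<le> 18 * (X x) ^ 4 + 16 * (X x - Y x) ^ 4" for x
  proof -
    have "((X x)\<^sup>2 + (Y x)\<^sup>2)\<^sup>2 \<le> 2 * (X x) ^ 4 + 2 * (Y x) ^ 4"
      unfolding sq[symmetric] using zero_le_power2[of "(X x)\<^sup>2 - (Y x)\<^sup>2"]
      by (simp add: power2_sum power2_diff)
    then show ?thesis using real_power4_diff_le[of "X x" "X x - Y x"] by simp
  qed
  have i1: "integrable M (\<lambda>x. (X x + Y x) ^ 4)"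
    by (rule Bochner_Integration.integrable_bound[of _ "\<lambda>x. 8 * (16 * (X x) ^ 4 + (X x - Y x) ^ 4)"])
      (use X d b1 in \<open>auto intro!: AE_I2 simp: power_even_abs_numeral\<close>)
  have i2: "integrable M (\<lambda>x. ((X x)\<^sup>2 + (Y x)\<^sup>2)\<^sup>2)"
    by (rule Bochner_Integration.integrable_bound[of _ "\<lambda>x. 18 * (X x) ^ 4 + 16 * (X x - Y x) ^ 4"])
      (use X d b2 in \<open>auto intro!: AE_I2\<close>)
  have e1: "(\<integral>x. (X x + Y x) ^ 4 \<partial>M) \<le> 8 * (16 * m + D)"
    using integral_mono[OF i1 _ b1] X d by (simp add: m_def D_def)
  have e2: "(\<integral>x. ((X x)\<^sup>2 + (Y x)\<^sup>2)\<^sup>2 \<partial>M) \<le> 18 * m + 16 * D"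
    using integral_mono[OF i2 _ b2] X d by (simp add: m_def D_def)
  have cs: "integrable M (\<lambda>x. (X x - Y x)\<^sup>2 * (X x + Y x)\<^sup>2)"
    "(\<integral>x. \<bar>(X x - Y x)\<^sup>2 * (X x + Y x)\<^sup>2\<bar> \<partial>M) \<le> sqrt (\<integral>x. ((X x - Y x)\<^sup>2)\<^sup>2 \<partial>M) * sqrt (\<integral>x. ((X x + Y x)\<^sup>2)\<^sup>2 \<partial>M)"
    using d i1 by (intro Cauchy_Schwarz_integral; simp)+
  have m3: "((X x)\<^sup>2 - (Y x)\<^sup>2)\<^sup>2 = (X x - Y x)\<^sup>2 * (X x + Y x)\<^sup>2" for x
    by (simp add: power2_eq_square algebra_simps)
  have i3: "integrable M (\<lambda>x. ((X x)\<^sup>2 - (Y x)\<^sup>2)\<^sup>2)" using cs(1) by (simp add: m3)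
  have "(\<integral>x. ((X x)\<^sup>2 - (Y x)\<^sup>2)\<^sup>2 \<partial>M) \<le> sqrt D * sqrt (\<integral>x. (X x + Y x) ^ 4 \<partial>M)"
    using cs(2) by (simp add: m3 D_def abs_mult)
  also have "\<dots> \<le> sqrt D * sqrt (8 * (16 * m + D))"
    by (intro mult_left_mono real_sqrt_le_mono e1) (simp add: D_def)
  finally have e3: "(\<integral>x. ((X x)\<^sup>2 - (Y x)\<^sup>2)\<^sup>2 \<partial>M) \<le> sqrt D * sqrt (8 * (16 * m + D))" .
  have "\<bar>(\<integral>x. (Y x) ^ 4 \<partial>M) - m\<bar> = \<bar>m - (\<integral>x. (Y x) ^ 4 \<partial>M)\<bar>" by simp
  also have "\<dots> = \<bar>\<integral>x. (X x) ^ 4 - (Y x) ^ 4 \<partial>M\<bar>"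
    using X Y by (simp add: m_def)
  also have "\<dots> \<le> (\<integral>x. \<bar>(X x) ^ 4 - (Y x) ^ 4\<bar> \<partial>M)" by (rule integral_abs_bound)
  also have "\<dots> = (\<integral>x. \<bar>((X x)\<^sup>2 - (Y x)\<^sup>2) * ((X x)\<^sup>2 + (Y x)\<^sup>2)\<bar> \<partial>M)"
    by (intro Bochner_Integration.integral_cong refl arg_cong[of _ _ abs]) (simp add: power2_eq_square power4_eq_xxxx algebra_simps)
  also have "\<dots> \<le> sqrt (\<integral>x. ((X x)\<^sup>2 - (Y x)\<^sup>2)\<^sup>2 \<partial>M) * sqrt (\<integral>x. ((X x)\<^sup>2 + (Y x)\<^sup>2)\<^sup>2 \<partial>M)"
    by (rule Cauchy_Schwarz_integral(2)) (use i2 i3 in auto)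
  also have "\<dots> \<le> sqrt (sqrt D * sqrt (8 * (16 * m + D))) * sqrt (18 * m + 16 * D)"
    by (intro mult_mono real_sqrt_le_mono e2 e3) (auto simp: D_def m_def)
  finally show ?thesis .
qed

lemma fourth_moment_tendsto:
  fixes X :: "'a \<Rightarrow> real" and Y :: "'i \<Rightarrow> 'a \<Rightarrow> real"
  assumes X: "X \<in> borel_measurable M" "integrable M (\<lambda>x. (X x) ^ 4)"
    and Y: "\<forall>\<^sub>F A in \<F>. Y A \<in> borel_measurable M \<and> integrable M (\<lambda>x. (Y A x) ^ 4)"
    and lim: "((\<lambda>A. \<integral>x. (X x - Y A x) ^ 4 \<partial>M) \<longlongrightarrow> 0) \<F>"
  shows "((\<lambda>A. \<integral>x. (Y A x) ^ 4 \<partial>M) \<longlongrightarrow> (\<integral>x. (X x) ^ 4 \<partial>M)) \<F>"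
proof -
  let ?D = "\<lambda>A. \<integral>x. (X x - Y A x) ^ 4 \<partial>M" and ?m = "\<integral>x. (X x) ^ 4 \<partial>M"
  let ?b = "\<lambda>D. sqrt (sqrt D * sqrt (8 * (16 * ?m + D))) * sqrt (18 * ?m + 16 * D)"
  have "((\<lambda>A. ?b (?D A)) \<longlongrightarrow> ?b 0) \<F>"
    by (intro tendsto_intros lim)
  then have l: "((\<lambda>A. ?b (?D A)) \<longlongrightarrow> 0) \<F>" by simp
  have "\<forall>\<^sub>F A in \<F>. norm ((\<integral>x. (Y A x) ^ 4 \<partial>M) - ?m) \<le> ?b (?D A)"
    using Y by eventually_elim (use fourth_moment_diff_le[OF X(1) _ X(2)] in auto)
  from Lim_null_comparison[OF this l] show ?thesis by (simp add: LIM_zero_iff)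
qed

lemma expectation_diff_le:
  fixes X Y :: "'a \<Rightarrow> real" and g :: "real \<Rightarrow> real"
  assumes [measurable]: "X \<in> borel_measurable M" "Y \<in> borel_measurable M" "g \<in> borel_measurable borel"
    and X: "integrable M (\<lambda>x. (X x) ^ 4)" and Y: "integrable M (\<lambda>x. (Y x) ^ 4)"
    and X2: "integrable M (\<lambda>x. (X x)\<^sup>2)" and Y2: "integrable M (\<lambda>x. (Y x)\<^sup>2)"
    and gX: "integrable M (\<lambda>x. g (X x))" and gY: "integrable M (\<lambda>x. g (Y x))"
    and lip: "\<And>x y. \<bar>g x - g y\<bar> \<le> L * ((1 + x\<^sup>2 + y\<^sup>2) * \<bar>x - y\<bar>)" and L: "L \<ge> 0"
  shows "\<bar>(\<integral>x. g (Y x) \<partial>M) - (\<integral>x. g (X x) \<partial>M)\<bar>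
    \<le> L * (sqrt (3 * (1 + 9 * (\<integral>x. (X x) ^ 4 \<partial>M) + 8 * (\<integral>x. (X x - Y x) ^ 4 \<partial>M))) * sqrt (\<integral>x. (X x - Y x)\<^sup>2 \<partial>M))"
proof -
  let ?w = "\<lambda>x. 1 + (X x)\<^sup>2 + (Y x)\<^sup>2"
  have d: "integrable M (\<lambda>x. (X x - Y x) ^ 4)" by (rule integrable_power4_diff) (use X Y in auto)
  have d2: "integrable M (\<lambda>x. (X x - Y x)\<^sup>2)" by (rule integrable_square_diff) (use X2 Y2 in auto)
  have b: "(?w x)\<^sup>2 \<le> 3 * (1 + 9 * (X x) ^ 4 + 8 * (X x - Y x) ^ 4)" for x
  proof -
    have "(1 + a + b)\<^sup>2 \<le> 3 * (1 + a\<^sup>2 + b\<^sup>2)" for a b :: real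
      using zero_le_power2[of "1 - a"] zero_le_power2[of "1 - b"] zero_le_power2[of "a - b"]
      by (simp add: power2_eq_square algebra_simps)
    from this[of "(X x)\<^sup>2" "(Y x)\<^sup>2"] show ?thesis
      using real_power4_diff_le[of "X x" "X x - Y x"] by simp
  qed
  have iw: "integrable M (\<lambda>x. (?w x)\<^sup>2)"
    by (rule Bochner_Integration.integrable_bound[of _ "\<lambda>x. 3 * (1 + 9 * (X x) ^ 4 + 8 * (X x - Y x) ^ 4)"])
      (use X d b in \<open>auto intro!: AE_I2 order_trans[OF b abs_ge_self]\<close>)
  have ew: "(\<integral>x. (?w x)\<^sup>2 \<partial>M) \<le> 3 * (1 + 9 * (\<integral>x. (X x) ^ 4 \<partial>M) + 8 * (\<integral>x. (X x - Y x) ^ 4 \<partial>M))"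
    using integral_mono[OF iw _ b] X d by (simp add: prob_space)
  have cs: "integrable M (\<lambda>x. ?w x * (X x - Y x))"
    "(\<integral>x. \<bar>?w x * (X x - Y x)\<bar> \<partial>M) \<le> sqrt (\<integral>x. (?w x)\<^sup>2 \<partial>M) * sqrt (\<integral>x. (X x - Y x)\<^sup>2 \<partial>M)"
    using iw d2 by (intro Cauchy_Schwarz_integral; simp)+
  have "\<bar>(\<integral>x. g (Y x) \<partial>M) - (\<integral>x. g (X x) \<partial>M)\<bar> = \<bar>(\<integral>x. g (X x) \<partial>M) - (\<integral>x. g (Y x) \<partial>M)\<bar>" by simp
  also have "\<dots> = \<bar>\<integral>x. g (X x) - g (Y x) \<partial>M\<bar>" using gX gY by simp
  also have "\<dots> \<le> (\<integral>x. \<bar>g (X x) - g (Y x)\<bar> \<partial>M)" by (rule integral_abs_bound)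
  also have "\<dots> \<le> (\<integral>x. L * \<bar>?w x * (X x - Y x)\<bar> \<partial>M)"
  proof (rule integral_mono)
    show "integrable M (\<lambda>x. \<bar>g (X x) - g (Y x)\<bar>)" using gX gY by simp
    show "integrable M (\<lambda>x. L * \<bar>?w x * (X x - Y x)\<bar>)" using cs(1) by simp
    show "\<bar>g (X x) - g (Y x)\<bar> \<le> L * \<bar>?w x * (X x - Y x)\<bar>" for x
      using lip[of "X x" "Y x"] by (simp add: abs_mult)
  qed
  also have "\<dots> = L * (\<integral>x. \<bar>?w x * (X x - Y x)\<bar> \<partial>M)" by simp
  also have "\<dots> \<le> L * (sqrt (3 * (1 + 9 * (\<integral>x. (X x) ^ 4 \<partial>M) + 8 * (\<integral>x. (X x - Y x) ^ 4 \<partial>M))) * sqrt (\<integral>x. (X x - Y x)\<^sup>2 \<partial>M))"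
    by (intro mult_left_mono L order_trans[OF cs(2)] mult_right_mono real_sqrt_le_mono ew) auto
  finally show ?thesis .
qed

end

section \<open>Elements of the Gaussian chaos\<close>

lemma integral_standard_normal:
  fixes g :: "real \<Rightarrow> real"
  assumes "distributed N lborel Z std_normal_density" "g \<in> borel_measurable borel"
  shows "(\<integral>\<omega>. g (Z \<omega>) \<partial>N) = (\<integral>y. g y \<partial>gauss)"
  using distributed_integral[OF assms(1), of g] assms(2) by (simp add: integral_gauss)

locale gaussian_sequence = prob_space M for M :: "'a measure" +
  fixes G :: "nat \<Rightarrow> 'a \<Rightarrow> real"
  assumes indep: "indep_vars (\<lambda>_. borel) G UNIV"
    and normal: "\<And>i. distributed M lborel (G i) std_normal_density"
begin

lemma measurable_G [measurable]: "G i \<in> borel_measurable M"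
  using normal[of i] by (simp add: distributed_def)

lemma distr_G: "distr M borel (G i) = gauss"
proof -
  have "distr M borel (G i) = distr M lborel (G i)" by (rule distr_cong) auto
  then show ?thesis using normal[of i] by (simp add: distributed_def gauss_def)
qed

text \<open>Independence identifies the joint law of the first n variables with the product measure.\<close>

lemma transfer_gaussn:
  assumes u: "tame n u" and n: "n > 0"
  shows "integrable M (\<lambda>\<omega>. u (\<lambda>i. G i \<omega>))" "(\<integral>\<omega>. u (\<lambda>i. G i \<omega>) \<partial>M) = (\<integral>x. u x \<partial>gaussn n)"
proof -
  let ?X = "\<lambda>\<omega>. \<lambda>i\<in>{..<n}. G i \<omega>" and ?P = "\<Pi>\<^sub>M i\<in>{..<n}. (borel :: real measure)"
  have "indep_vars (\<lambda>_. borel) G {..<n}" using indep by (rule indep_vars_subset) auto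
  then have "distr M ?P ?X = (\<Pi>\<^sub>M i\<in>{..<n}. distr M borel (G i))"
    using n by (subst (asm) indep_vars_iff_distr_eq_PiM) auto
  then have law: "distr M ?P ?X = gaussn n" by (simp add: distr_G gaussn_def)
  have X: "?X \<in> M \<rightarrow>\<^sub>M ?P" by measurable
  have um: "u \<in> borel_measurable ?P" using u by (simp add: tame_def)
  have eq: "u (\<lambda>i. G i \<omega>) = u (?X \<omega>)" for \<omega> by (rule tame_depends[OF u]) auto
  show "integrable M (\<lambda>\<omega>. u (\<lambda>i. G i \<omega>))"
    unfolding eq using integrable_distr[OF X, of u] tame_integrable[OF u] law by simp
  show "(\<integral>\<omega>. u (\<lambda>i. G i \<omega>) \<partial>M) = (\<integral>x. u x \<partial>gaussn n)"
    unfolding eq law[symmetric] by (rule integral_distr[OF X um, symmetric])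
qed

definition partial_sum :: "((nat \<Rightarrow> nat) \<Rightarrow> real) \<Rightarrow> (nat \<Rightarrow> nat) set \<Rightarrow> 'a \<Rightarrow> real" where
  "partial_sum c A \<omega> = (\<Sum>q\<in>A. c q * hermite_product G q \<omega>)"

lemma measurable_partial_sum [measurable]: "partial_sum c A \<in> borel_measurable M"
  unfolding partial_sum_def[abs_def] hermite_product_def
  by (intro borel_measurable_sum borel_measurable_times borel_measurable_const borel_measurable_prod
      measurable_compose[OF measurable_G] borel_measurable_continuous_onI continuous_intros)

lemma partial_sum_eq_chaos:
  assumes "finite A" "A \<subseteq> multi_indices d"
  obtains n where "n > 0" "supported n d (basis_combination d c A)"
    "\<And>\<omega>. partial_sum c A \<omega> = chaos n d (basis_combination d c A) (\<lambda>i. G i \<omega>)"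
proof -
  from index_list_bound[OF assms(1)] obtain n where n: "n > 0" "\<And>q. q \<in> A \<Longrightarrow> set (index_list q) \<subseteq> {..<n}"
    by blast
  show thesis
    by (rule that[OF n(1) supported_basis_combination[OF n(2)]])
      (simp_all add: partial_sum_def chaos_basis_combination[OF assms(2) n(2)])
qed

lemma partial_sum_moments:
  assumes A: "finite A" "A \<subseteq> multi_indices d" and d: "d \<ge> 1"
  shows "integrable M (\<lambda>\<omega>. (partial_sum c A \<omega>) ^ k)"
    and "(\<integral>\<omega>. (partial_sum c A \<omega>) ^ 4 \<partial>M) \<le> hyper_const d * (\<integral>\<omega>. (partial_sum c A \<omega>)\<^sup>2 \<partial>M)\<^sup>2"
    and "(stein_discrepancy d (basis_combination d c A))\<^sup>2
      \<le> (real d - 1) / (3 * real d) * ((\<integral>\<omega>. (partial_sum c A \<omega>) ^ 4 \<partial>M) - 3 * (\<integral>\<omega>. (partial_sum c A \<omega>)\<^sup>2 \<partial>M)\<^sup>2)"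
proof -
  let ?a = "basis_combination d c A"
  obtain n where n: "n > 0" and sup: "supported n d ?a"
    and eq: "\<And>\<omega>. partial_sum c A \<omega> = chaos n d ?a (\<lambda>i. G i \<omega>)"
    using partial_sum_eq_chaos[OF A] by blast
  note sym = symmetric_basis_combination[of d c A]
  note t = transfer_gaussn[OF tame_power[OF tame_polys[OF chaos_polys]] n, of d ?a]
  show "integrable M (\<lambda>\<omega>. (partial_sum c A \<omega>) ^ k)"
    unfolding eq by (rule t(1))
  have e: "contraction_energy n d r ?a \<le> (\<Sum>is\<in>ibox n d. (?a is)\<^sup>2)\<^sup>2" if "r \<in> {1..d}" for r
    using that by (intro supported_contraction_energy_le sup) auto
  show "(\<integral>\<omega>. (partial_sum c A \<omega>) ^ 4 \<partial>M) \<le> hyper_const d * (\<integral>\<omega>. (partial_sum c A \<omega>)\<^sup>2 \<partial>M)\<^sup>2"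
    unfolding eq t(2) by (rule hypercontractivity[OF sym d e])
  show "(stein_discrepancy d ?a)\<^sup>2
      \<le> (real d - 1) / (3 * real d) * ((\<integral>\<omega>. (partial_sum c A \<omega>) ^ 4 \<partial>M) - 3 * (\<integral>\<omega>. (partial_sum c A \<omega>)\<^sup>2 \<partial>M)\<^sup>2)"
    unfolding eq t(2) supported_stein_discrepancy[OF sup] chaos_second_moment[OF sym]
    by (rule fourth_cumulant_bound[OF sym d])
qed

lemma partial_sum_stein_bound:
  fixes g :: "real \<Rightarrow> real" and c :: "(nat \<Rightarrow> nat) \<Rightarrow> real"
  assumes A: "finite A" "A \<subseteq> multi_indices d" and d: "d \<ge> 1"
    and cg: "continuous_on UNIV g" and growth: "\<And>y. \<bar>g y\<bar> \<le> K * (1 + \<bar>y\<bar>) ^ m"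
    and bd: "\<And>y. \<bar>stein_deriv g y\<bar> \<le> \<alpha> + \<beta> * \<bar>y\<bar>" and ab: "\<alpha> \<ge> 0" "\<beta> \<ge> 0"
  defines "s \<equiv> (\<integral>\<omega>. (partial_sum c A \<omega>)\<^sup>2 \<partial>M)"
  shows "integrable M (\<lambda>\<omega>. g (partial_sum c A \<omega>))"
    and "\<bar>(\<integral>\<omega>. g (partial_sum c A \<omega>) \<partial>M) - (\<integral>y. g y \<partial>gauss)\<bar>
      \<le> (\<alpha> + \<beta> * sqrt s) * sqrt ((1 - s)\<^sup>2 + (stein_discrepancy d (basis_combination d c A))\<^sup>2)"
proof -
  let ?a = "basis_combination d c A"
  obtain n where n: "n > 0" and sup: "supported n d ?a"
    and eq: "\<And>\<omega>. partial_sum c A \<omega> = chaos n d ?a (\<lambda>i. G i \<omega>)"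
    using partial_sum_eq_chaos[OF A] by blast
  have [measurable]: "g \<in> borel_measurable borel" by (rule borel_measurable_continuous_onI[OF cg])
  have tg: "tame n (\<lambda>x. g (chaos n d ?a x))"
    by (rule tame_compose[OF tame_polys[OF chaos_polys] _ growth]) measurable
  show "integrable M (\<lambda>\<omega>. g (partial_sum c A \<omega>))"
    unfolding eq by (rule transfer_gaussn(1)[OF tg n])
  have ig: "integrable gauss g"
    by (rule integrable_gauss_poly_growth[OF _ growth]) measurable
  show "\<bar>(\<integral>\<omega>. g (partial_sum c A \<omega>) \<partial>M) - (\<integral>y. g y \<partial>gauss)\<bar>
      \<le> (\<alpha> + \<beta> * sqrt s) * sqrt ((1 - s)\<^sup>2 + (stein_discrepancy d (basis_combination d c A))\<^sup>2)"
    unfolding s_def eq transfer_gaussn(2)[OF tame_power[OF tame_polys[OF chaos_polys]] n] transfer_gaussn(2)[OF tg n]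
    by (rule chaos_stein_bound[OF symmetric_basis_combination sup d ig cg bd ab tg])
qed

text \<open>The moment bounds for finite chaos elements are to be applied to the increments of the net of
  partial sums.\<close>

lemma partial_sum_diff:
  assumes "finite A" "finite B"
  obtains c' where "\<And>\<omega>. partial_sum c B \<omega> - partial_sum c A \<omega> = partial_sum c' (A \<union> B) \<omega>"
proof -
  let ?c = "\<lambda>q. c q * (of_bool (q \<in> B) - of_bool (q \<in> A))"
  have ext: "partial_sum c S \<omega> = (\<Sum>q\<in>A \<union> B. c q * of_bool (q \<in> S) * hermite_product G q \<omega>)"
    if "S \<subseteq> A \<union> B" for S \<omega>
    unfolding partial_sum_def using that assms by (intro sum.mono_neutral_cong_left) auto
  have "partial_sum c B \<omega> - partial_sum c A \<omega> = partial_sum ?c (A \<union> B) \<omega>" for \<omega>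
    unfolding ext[OF Un_upper2] ext[OF Un_upper1] sum_subtractf[symmetric] partial_sum_def[of ?c]
    by (intro sum.cong refl) (simp add: algebra_simps)
  then show thesis by (rule that)
qed

end

text \<open>The kernel enters through its array of coordinates a only. What ties F to a is that both are limits
  of finite sums with the same coefficients c.\<close>

locale chaos_element = gaussian_sequence M G for M :: "'a measure" and G +
  fixes d :: nat and c :: "(nat \<Rightarrow> nat) \<Rightarrow> real" and a :: "nat list \<Rightarrow> real" and F :: "'a \<Rightarrow> real"
  assumes d: "d \<ge> 1"
    and measurable_F [measurable]: "F \<in> borel_measurable M"
    and square_F: "integrable M (\<lambda>\<omega>. (F \<omega>)\<^sup>2)"
    and sq_a: "sq_summable d a"
    and lim_a: "((\<lambda>A. l2 d (\<lambda>is. a is - basis_combination d c A is)) \<longlongrightarrow> 0) (finite_subsets_at_top (multi_indices d))"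
    and lim_F: "((\<lambda>A. \<integral>\<omega>. (F \<omega> - partial_sum c A \<omega>)\<^sup>2 \<partial>M) \<longlongrightarrow> 0) (finite_subsets_at_top (multi_indices d))"
begin

abbreviation "net \<equiv> finite_subsets_at_top (multi_indices d)"

lemma eventually_net: "(\<And>A. finite A \<Longrightarrow> A \<subseteq> multi_indices d \<Longrightarrow> P A) \<Longrightarrow> eventually P net"
  by (rule eventually_finite_subsets_at_top_weakI)

lemma integrable_square_partial_sum:
  assumes "finite A" "A \<subseteq> multi_indices d"
  shows "integrable M (\<lambda>\<omega>. (partial_sum c' A \<omega>)\<^sup>2)"
  by (rule partial_sum_moments(1)[OF assms d])

lemma approximating_sequence:
  obtains B where "\<And>n. finite (B n)" "\<And>n. B n \<subseteq> multi_indices d"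
    "(\<lambda>n. \<integral>\<omega>. (F \<omega> - partial_sum c (B n) \<omega>)\<^sup>2 \<partial>M) \<longlonglongrightarrow> 0"
proof -
  let ?D = "\<lambda>A. \<integral>\<omega>. (F \<omega> - partial_sum c A \<omega>)\<^sup>2 \<partial>M"
  have "\<exists>A. (finite A \<and> A \<subseteq> multi_indices d) \<and> ?D A < 1 / real (Suc n)" for n
  proof -
    have "eventually (\<lambda>A. ?D A < 1 / real (Suc n)) net"
      using lim_F by (rule order_tendstoD) simp
    moreover have "eventually (\<lambda>A. finite A \<and> A \<subseteq> multi_indices d) net" by (rule eventually_net) auto
    ultimately have "eventually (\<lambda>A. (finite A \<and> A \<subseteq> multi_indices d) \<and> ?D A < 1 / real (Suc n)) net"
      by eventually_elim auto
    then show ?thesis by (rule eventually_happens'[OF finite_subsets_at_top_neq_bot])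
  qed
  then obtain B where B: "\<And>n. (finite (B n) \<and> B n \<subseteq> multi_indices d) \<and> ?D (B n) < 1 / real (Suc n)" by metis
  have "(\<lambda>n. ?D (B n)) \<longlonglongrightarrow> 0"
    by (rule tendsto_sandwich[OF _ _ tendsto_const LIMSEQ_inverse_real_of_nat])
      (use B in \<open>auto intro!: always_eventually less_imp_le simp: inverse_eq_divide simp del: of_nat_Suc\<close>)
  then show thesis using B that by blast
qed

text \<open>The remainder is the limit in L2 of differences of partial sums, for which the fourth moment is
  controlled by the second; Fatou's lemma carries the bound to the limit. Thus convergence in L2
  implies convergence in L4.\<close>

lemma fourth_moment_remainder:
  assumes A: "finite A" "A \<subseteq> multi_indices d"
  shows "integrable M (\<lambda>\<omega>. (F \<omega> - partial_sum c A \<omega>) ^ 4)"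
    "(\<integral>\<omega>. (F \<omega> - partial_sum c A \<omega>) ^ 4 \<partial>M) \<le> hyper_const d * (\<integral>\<omega>. (F \<omega> - partial_sum c A \<omega>)\<^sup>2 \<partial>M)\<^sup>2"
proof -
  obtain B where B: "\<And>n. finite (B n)" "\<And>n. B n \<subseteq> multi_indices d"
    "(\<lambda>n. \<integral>\<omega>. (F \<omega> - partial_sum c (B n) \<omega>)\<^sup>2 \<partial>M) \<longlonglongrightarrow> 0"
    using approximating_sequence by blast
  let ?X = "\<lambda>\<omega>. F \<omega> - partial_sum c A \<omega>" and ?Y = "\<lambda>n \<omega>. partial_sum c (B n) \<omega> - partial_sum c A \<omega>"
  have X: "integrable M (\<lambda>\<omega>. (?X \<omega>)\<^sup>2)"
    by (rule integrable_square_diff) (use square_F integrable_square_partial_sum[OF A] in auto)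
  have lim: "(\<lambda>n. \<integral>\<omega>. (?X \<omega> - ?Y n \<omega>)\<^sup>2 \<partial>M) \<longlonglongrightarrow> 0" using B(3) by simp
  have Y: "integrable M (\<lambda>\<omega>. (?Y n \<omega>) ^ k) \<and>
      (\<integral>\<omega>. (?Y n \<omega>) ^ 4 \<partial>M) \<le> hyper_const d * (\<integral>\<omega>. (?Y n \<omega>)\<^sup>2 \<partial>M)\<^sup>2" for n k
  proof -
    obtain c' where c': "\<And>\<omega>. ?Y n \<omega> = partial_sum c' (A \<union> B n) \<omega>"
      using partial_sum_diff[OF A(1) B(1)] by metis
    have "finite (A \<union> B n)" "A \<union> B n \<subseteq> multi_indices d" using A B by auto
    from partial_sum_moments(1,2)[OF this d] show ?thesis unfolding c' by blast
  qed
  have "((\<lambda>n. \<integral>\<omega>. (?Y n \<omega>)\<^sup>2 \<partial>M) \<longlongrightarrow> (\<integral>\<omega>. (?X \<omega>)\<^sup>2 \<partial>M)) sequentially"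
    by (rule second_moment_tendsto[OF _ X _ lim]) (use Y in auto)
  then have K: "(\<lambda>n. hyper_const d * (\<integral>\<omega>. (?Y n \<omega>)\<^sup>2 \<partial>M)\<^sup>2) \<longlonglongrightarrow> hyper_const d * (\<integral>\<omega>. (?X \<omega>)\<^sup>2 \<partial>M)\<^sup>2"
    by (intro tendsto_intros)
  show "integrable M (\<lambda>\<omega>. (?X \<omega>) ^ 4)"
    by (rule fourth_moment_Fatou(1)[OF _ _ X _ lim _ _ K]) (use Y in auto)
  show "(\<integral>\<omega>. (?X \<omega>) ^ 4 \<partial>M) \<le> hyper_const d * (\<integral>\<omega>. (?X \<omega>)\<^sup>2 \<partial>M)\<^sup>2"
    by (rule fourth_moment_Fatou(2)[OF _ _ X _ lim _ _ K]) (use Y in auto)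
qed

lemma integrable_fourth: "integrable M (\<lambda>\<omega>. (F \<omega>) ^ 4)"
  (* The empty partial sum is zero. *)
  using fourth_moment_remainder(1)[of "{}"] by (simp add: partial_sum_def)

lemma lim_fourth_remainder: "((\<lambda>A. \<integral>\<omega>. (F \<omega> - partial_sum c A \<omega>) ^ 4 \<partial>M) \<longlongrightarrow> 0) net"
proof -
  have "((\<lambda>A. hyper_const d * (\<integral>\<omega>. (F \<omega> - partial_sum c A \<omega>)\<^sup>2 \<partial>M)\<^sup>2) \<longlongrightarrow> hyper_const d * 0\<^sup>2) net"
    by (intro tendsto_intros lim_F)
  then have *: "((\<lambda>A. hyper_const d * (\<integral>\<omega>. (F \<omega> - partial_sum c A \<omega>)\<^sup>2 \<partial>M)\<^sup>2) \<longlongrightarrow> 0) net" by simp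
  show ?thesis
    by (rule tendsto_sandwich[OF _ _ tendsto_const *])
      (auto intro!: eventually_net fourth_moment_remainder(2) integral_nonneg)
qed

lemma lim_second_moment: "((\<lambda>A. \<integral>\<omega>. (partial_sum c A \<omega>)\<^sup>2 \<partial>M) \<longlongrightarrow> (\<integral>\<omega>. (F \<omega>)\<^sup>2 \<partial>M)) net"
  by (rule second_moment_tendsto[OF measurable_F square_F _ lim_F])
    (auto intro!: eventually_net integrable_square_partial_sum)

lemma lim_fourth_moment: "((\<lambda>A. \<integral>\<omega>. (partial_sum c A \<omega>) ^ 4 \<partial>M) \<longlongrightarrow> (\<integral>\<omega>. (F \<omega>) ^ 4 \<partial>M)) net"
  by (rule fourth_moment_tendsto[OF measurable_F integrable_fourth _ lim_fourth_remainder])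
    (auto intro!: eventually_net partial_sum_moments(1) d)

lemma lim_stein_discrepancy: "((\<lambda>A. stein_discrepancy d (basis_combination d c A)) \<longlongrightarrow> stein_discrepancy d a) net"
  by (rule stein_discrepancy_tendsto[OF sq_a sq_summable_basis_combination lim_a])

theorem fourth_moment_bound:
  "(stein_discrepancy d a)\<^sup>2
    \<le> (real d - 1) / (3 * real d) * ((\<integral>\<omega>. (F \<omega>) ^ 4 \<partial>M) - 3 * (\<integral>\<omega>. (F \<omega>)\<^sup>2 \<partial>M)\<^sup>2)"
proof (rule tendsto_le[OF finite_subsets_at_top_neq_bot])
  show "((\<lambda>A. (stein_discrepancy d (basis_combination d c A))\<^sup>2) \<longlongrightarrow> (stein_discrepancy d a)\<^sup>2) net"
    by (intro tendsto_intros lim_stein_discrepancy)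
  show "((\<lambda>A. (real d - 1) / (3 * real d) * ((\<integral>\<omega>. (partial_sum c A \<omega>) ^ 4 \<partial>M) - 3 * (\<integral>\<omega>. (partial_sum c A \<omega>)\<^sup>2 \<partial>M)\<^sup>2))
      \<longlongrightarrow> (real d - 1) / (3 * real d) * ((\<integral>\<omega>. (F \<omega>) ^ 4 \<partial>M) - 3 * (\<integral>\<omega>. (F \<omega>)\<^sup>2 \<partial>M)\<^sup>2)) net"
    by (intro tendsto_mult[OF tendsto_const] tendsto_diff tendsto_power lim_second_moment lim_fourth_moment)
  show "\<forall>\<^sub>F A in net. (stein_discrepancy d (basis_combination d c A))\<^sup>2
      \<le> (real d - 1) / (3 * real d) * ((\<integral>\<omega>. (partial_sum c A \<omega>) ^ 4 \<partial>M) - 3 * (\<integral>\<omega>. (partial_sum c A \<omega>)\<^sup>2 \<partial>M)\<^sup>2)"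
    by (rule eventually_net) (rule partial_sum_moments(3)[OF _ _ d])
qed

text \<open>The bound for partial sums passes to the limit: all moments involved converge, and the means of g
  converge because g is Lipschitz up to quadratic factors, which the fourth moments absorb.\<close>

theorem stein_bound:
  fixes g :: "real \<Rightarrow> real"
  assumes unit: "(\<integral>\<omega>. (F \<omega>)\<^sup>2 \<partial>M) = 1"
    and cg: "continuous_on UNIV g"
    and lip: "\<And>x y. \<bar>g x - g y\<bar> \<le> L * ((1 + x\<^sup>2 + y\<^sup>2) * \<bar>x - y\<bar>)" and L: "L \<ge> 0"
    and bd: "\<And>y. \<bar>stein_deriv g y\<bar> \<le> \<alpha> + \<beta> * \<bar>y\<bar>" and ab: "\<alpha> \<ge> 0" "\<beta> \<ge> 0"
  shows "\<bar>(\<integral>\<omega>. g (F \<omega>) \<partial>M) - (\<integral>y. g y \<partial>gauss)\<bar> \<le> (\<alpha> + \<beta>) * stein_discrepancy d a"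
proof -
  have [measurable]: "g \<in> borel_measurable borel" by (rule borel_measurable_continuous_onI[OF cg])
  have g0: "\<bar>g y\<bar> \<le> \<bar>g 0\<bar> + L * ((1 + y\<^sup>2) * \<bar>y\<bar>)" for y
    using lip[of y 0] by simp
  have growth: "\<bar>g y\<bar> \<le> (\<bar>g 0\<bar> + L) * (1 + \<bar>y\<bar>) ^ 3" for y
  proof -
    have "1 + y\<^sup>2 \<le> (1 + \<bar>y\<bar>)\<^sup>2" by (simp add: power2_sum)
    then have "(1 + y\<^sup>2) * \<bar>y\<bar> \<le> (1 + \<bar>y\<bar>)\<^sup>2 * (1 + \<bar>y\<bar>)" by (intro mult_mono) auto
    then have "(1 + y\<^sup>2) * \<bar>y\<bar> \<le> (1 + \<bar>y\<bar>) ^ 3" by (simp add: power2_eq_square power3_eq_cube)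
    then have "L * ((1 + y\<^sup>2) * \<bar>y\<bar>) \<le> L * (1 + \<bar>y\<bar>) ^ 3" using L by (rule mult_left_mono)
    moreover have "\<bar>g 0\<bar> * 1 \<le> \<bar>g 0\<bar> * (1 + \<bar>y\<bar>) ^ 3" by (intro mult_left_mono one_le_power) auto
    ultimately show ?thesis using g0[of y] unfolding distrib_right by linarith
  qed
  have gF: "integrable M (\<lambda>\<omega>. g (F \<omega>))"
  proof (rule Bochner_Integration.integrable_bound)
    show "integrable M (\<lambda>\<omega>. \<bar>g 0\<bar> + L * (2 * (1 + (F \<omega>) ^ 4)))" using integrable_fourth by simp
    have "(1 + y\<^sup>2) * \<bar>y\<bar> \<le> 2 * (1 + y ^ 4)" for y :: real
    proof -
      have "2 * \<bar>y\<bar> \<le> 1 + y\<^sup>2" using zero_le_power2[of "1 - \<bar>y\<bar>"] by (simp add: power2_diff)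
      then have "(1 + y\<^sup>2) * (2 * \<bar>y\<bar>) \<le> (1 + y\<^sup>2) * (1 + y\<^sup>2)" by (intro mult_left_mono) auto
      moreover have "(1 + y\<^sup>2) * (1 + y\<^sup>2) \<le> 2 * (1 + (y\<^sup>2)\<^sup>2)"
        using zero_le_power2[of "1 - y\<^sup>2"] by (simp add: power2_eq_square algebra_simps)
      ultimately have "(1 + y\<^sup>2) * (2 * \<bar>y\<bar>) \<le> 2 * (1 + (y\<^sup>2)\<^sup>2)" by (rule order_trans)
      then have "(1 + y\<^sup>2) * \<bar>y\<bar> \<le> 1 + y ^ 4" by simp
      also have "\<dots> \<le> 2 * (1 + y ^ 4)" by simp
      finally show ?thesis .
    qed
    then have "\<bar>g y\<bar> \<le> \<bar>g 0\<bar> + L * (2 * (1 + y ^ 4))" for y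
      using g0[of y] mult_left_mono[OF _ L] by (meson add_left_mono order_trans)
    then show "AE \<omega> in M. norm (g (F \<omega>)) \<le> norm (\<bar>g 0\<bar> + L * (2 * (1 + (F \<omega>) ^ 4)))"
      by (intro AE_I2) (simp add: order_trans[OF _ abs_ge_self])
  qed measurable
  let ?s = "\<lambda>A. \<integral>\<omega>. (partial_sum c A \<omega>)\<^sup>2 \<partial>M" and ?T = "\<lambda>A. stein_discrepancy d (basis_combination d c A)"
  let ?D2 = "\<lambda>A. \<integral>\<omega>. (F \<omega> - partial_sum c A \<omega>)\<^sup>2 \<partial>M" and ?D4 = "\<lambda>A. \<integral>\<omega>. (F \<omega> - partial_sum c A \<omega>) ^ 4 \<partial>M"
  let ?m = "\<integral>\<omega>. (F \<omega>) ^ 4 \<partial>M"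
  note sb = partial_sum_stein_bound[OF _ _ d cg growth bd ab]
  have limg: "((\<lambda>A. \<integral>\<omega>. g (partial_sum c A \<omega>) \<partial>M) \<longlongrightarrow> (\<integral>\<omega>. g (F \<omega>) \<partial>M)) net"
  proof -
    have "((\<lambda>A. L * (sqrt (3 * (1 + 9 * ?m + 8 * ?D4 A)) * sqrt (?D2 A)))
        \<longlongrightarrow> L * (sqrt (3 * (1 + 9 * ?m + 8 * 0)) * sqrt 0)) net"
      by (intro tendsto_intros lim_F lim_fourth_remainder)
    then have l: "((\<lambda>A. L * (sqrt (3 * (1 + 9 * ?m + 8 * ?D4 A)) * sqrt (?D2 A))) \<longlongrightarrow> 0) net" by simp
    have "\<forall>\<^sub>F A in net. norm ((\<integral>\<omega>. g (partial_sum c A \<omega>) \<partial>M) - (\<integral>\<omega>. g (F \<omega>) \<partial>M))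
        \<le> L * (sqrt (3 * (1 + 9 * ?m + 8 * ?D4 A)) * sqrt (?D2 A))"
      unfolding real_norm_def
      by (intro eventually_net expectation_diff_le integrable_fourth partial_sum_moments(1)[OF _ _ d] square_F gF
          sb(1) lip L) measurable
    from Lim_null_comparison[OF this l] show ?thesis by (simp add: LIM_zero_iff)
  qed
  have "\<bar>(\<integral>\<omega>. g (F \<omega>) \<partial>M) - (\<integral>y. g y \<partial>gauss)\<bar>
      \<le> (\<alpha> + \<beta> * sqrt 1) * sqrt ((1 - 1)\<^sup>2 + (stein_discrepancy d a)\<^sup>2)"
  proof (rule tendsto_le[OF finite_subsets_at_top_neq_bot])
    show "((\<lambda>A. (\<alpha> + \<beta> * sqrt (?s A)) * sqrt ((1 - ?s A)\<^sup>2 + (?T A)\<^sup>2))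
        \<longlongrightarrow> (\<alpha> + \<beta> * sqrt 1) * sqrt ((1 - 1)\<^sup>2 + (stein_discrepancy d a)\<^sup>2)) net"
      using lim_second_moment unfolding unit by (intro tendsto_intros lim_stein_discrepancy)
    show "((\<lambda>A. \<bar>(\<integral>\<omega>. g (partial_sum c A \<omega>) \<partial>M) - (\<integral>y. g y \<partial>gauss)\<bar>)
        \<longlongrightarrow> \<bar>(\<integral>\<omega>. g (F \<omega>) \<partial>M) - (\<integral>y. g y \<partial>gauss)\<bar>) net"
      by (intro tendsto_rabs tendsto_diff limg tendsto_const)
    show "\<forall>\<^sub>F A in net. \<bar>(\<integral>\<omega>. g (partial_sum c A \<omega>) \<partial>M) - (\<integral>y. g y \<partial>gauss)\<bar>
        \<le> (\<alpha> + \<beta> * sqrt (?s A)) * sqrt ((1 - ?s A)\<^sup>2 + (?T A)\<^sup>2)"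
      by (intro eventually_net sb(2))
  qed
  then show ?thesis by (simp add: stein_discrepancy_nonneg)
qed

end

section \<open>The distances\<close>

lemma lipschitz_stein_deriv_bound:
  assumes "L-lipschitz_on UNIV g"
  shows "\<bar>stein_deriv g x\<bar> \<le> L"
proof -
  have L: "L \<ge> 0" using assms by (rule lipschitz_on_nonneg)
  have lip: "\<bar>g y - g x\<bar> \<le> L * \<bar>y - x\<bar>" for x y
    using lipschitz_onD[OF assms, of y x] by (simp add: dist_real_def)
  have cg: "continuous_on UNIV g" using assms by (rule lipschitz_on_continuous_on)
  have "\<bar>g y\<bar> \<le> (\<bar>g 0\<bar> + L) * (1 + \<bar>y\<bar>) ^ 1" for y
  proof -
    have "\<bar>g y\<bar> \<le> \<bar>g 0\<bar> + L * \<bar>y\<bar>" using lip[of y 0] by simp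
    also have "\<dots> \<le> (\<bar>g 0\<bar> + L) * (1 + \<bar>y\<bar>) ^ 1" using L by (simp add: algebra_simps)
    finally show ?thesis .
  qed
  from integrable_gauss_poly_growth[OF borel_measurable_continuous_onI[OF cg] this]
  have "\<bar>stein_deriv g x\<bar> \<le> L + 0 * (4 * \<bar>x\<bar> + 3)"
    by (rule stein_deriv_bound) (use L lip in auto)
  then show ?thesis by simp
qed

text \<open>The indicator of a compact set is the decreasing limit of Lipschitz functions with values in the
  unit interval, which gives the bound for compact sets; by inner regularity of \<open>\<mu>\<close> it extends to all
  Borel sets.\<close>

lemma setwise_bound_from_lipschitz:
  fixes \<mu> \<nu> :: "real measure"
  assumes "prob_space \<mu>" "prob_space \<nu>" and sets: "sets \<mu> = sets borel" "sets \<nu> = sets borel"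
    and b: "\<And>L g. L-lipschitz_on UNIV g \<Longrightarrow> (\<And>y. 0 \<le> g y \<and> g y \<le> 1) \<Longrightarrow> (\<integral>y. g y \<partial>\<mu>) - (\<integral>y. g y \<partial>\<nu>) \<le> T"
    and A: "A \<in> sets borel"
  shows "measure \<mu> A - measure \<nu> A \<le> T"
proof -
  interpret \<mu>: prob_space \<mu> by fact
  interpret \<nu>: prob_space \<nu> by fact
  note [measurable_cong] = sets
  have cpt: "measure \<mu> K - measure \<nu> K \<le> T" if K: "compact K" for K
  proof (cases "K = {}")
    case True
    then show ?thesis using b[of 0 "\<lambda>_. 0"] by (simp add: lipschitz_on_def)
  next
    case False
    have cl: "closed K" using K by (rule compact_imp_closed)
    then have [measurable]: "K \<in> sets borel" by simp
    let ?g = "\<lambda>m y. max 0 (1 - real m * infdist y K)"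
    have g01: "0 \<le> ?g m y \<and> ?g m y \<le> 1" for m y by (simp add: infdist_nonneg)
    have lip: "(real m)-lipschitz_on UNIV (?g m)" for m
    proof (rule lipschitz_onI)
      fix x y :: real
      have "\<bar>?g m x - ?g m y\<bar> \<le> \<bar>real m * infdist x K - real m * infdist y K\<bar>" by (auto simp: max_def)
      also have "\<dots> = real m * \<bar>infdist x K - infdist y K\<bar>" by (simp add: abs_mult right_diff_distrib[symmetric])
      also have "\<dots> \<le> real m * dist x y" by (intro mult_left_mono infdist_triangle_abs) simp
      finally show "dist (?g m x) (?g m y) \<le> real m * dist x y" by (simp add: dist_real_def)
    qed simp
    have gm [measurable]: "?g m \<in> borel_measurable borel" for m
      by (intro borel_measurable_continuous_onI lipschitz_on_continuous_on[OF lip])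
    have lower: "measure \<mu> K \<le> T + (\<integral>y. ?g m y \<partial>\<nu>)" for m
    proof -
      have "measure \<mu> K = (\<integral>y. indicator K y \<partial>\<mu>)" by simp
      also have "\<dots> \<le> (\<integral>y. ?g m y \<partial>\<mu>)"
      proof (rule integral_mono)
        show "integrable \<mu> (?g m)"
          by (rule \<mu>.integrable_const_bound[of _ 1]) (use g01 in auto)
        show "indicator K y \<le> ?g m y" for y using g01[of m y] by (auto simp: indicator_def)
        show "integrable \<mu> (indicat_real K)"
          by (rule \<mu>.integrable_const_bound[of _ 1]) auto
      qed
      finally show ?thesis using b[OF lip g01, of m] by linarith
    qed
    have "(\<lambda>m. \<integral>y. ?g m y \<partial>\<nu>) \<longlonglongrightarrow> (\<integral>y. indicator K y \<partial>\<nu>)"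
    proof (rule integral_dominated_convergence[where w = "\<lambda>_. 1"])
      show "AE y in \<nu>. (\<lambda>m. ?g m y) \<longlonglongrightarrow> indicator K y"
      proof (rule AE_I2)
        fix y
        show "(\<lambda>m. ?g m y) \<longlonglongrightarrow> indicator K y"
        proof (cases "y \<in> K")
          case False
          then have p: "infdist y K > 0"
            using cl \<open>K \<noteq> {}\<close> in_closed_iff_infdist_zero[of K y] infdist_nonneg[of y K] by auto
          have "\<forall>\<^sub>F m in sequentially. ?g m y = 0"
          proof -
            obtain N :: nat where "1 / infdist y K \<le> real N" using real_arch_simple by blast
            then have "1 \<le> real N * infdist y K" using p by (simp add: divide_le_eq)
            then have "?g m y = 0" if "m \<ge> N" for m
            proof -
              have "real N * infdist y K \<le> real m * infdist y K"
                using that p by (intro mult_right_mono) auto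
              then show ?thesis using \<open>1 \<le> real N * infdist y K\<close> by simp
            qed
            then show ?thesis by (auto simp: eventually_sequentially)
          qed
          then show ?thesis using False by (simp add: tendsto_eventually)
        qed simp
      qed
    qed (use g01 in auto)
    then have l: "(\<lambda>m. T + (\<integral>y. ?g m y \<partial>\<nu>)) \<longlonglongrightarrow> T + measure \<nu> K"
      by (intro tendsto_intros) simp
    have "measure \<mu> K \<le> T + measure \<nu> K" by (rule LIMSEQ_le_const[OF l]) (use lower in auto)
    then show ?thesis by simp
  qed
  show ?thesis
  proof (rule field_le_epsilon)
    fix \<epsilon> :: real assume \<epsilon>: "\<epsilon> > 0"
    have reg: "emeasure \<mu> A = (SUP K\<in>{K. K \<subseteq> A \<and> compact K}. emeasure \<mu> K)"
      by (rule inner_regular) (use sets A in \<open>auto simp: \<mu>.emeasure_finite\<close>)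
    have "\<exists>K. K \<subseteq> A \<and> compact K \<and> measure \<mu> A - \<epsilon> \<le> measure \<mu> K"
    proof (rule ccontr)
      assume "\<not> ?thesis"
      then have less: "measure \<mu> K < measure \<mu> A - \<epsilon>" if "K \<subseteq> A" "compact K" for K
        using that by (meson not_le)
      have "emeasure \<mu> A \<le> ennreal (measure \<mu> A - \<epsilon>)"
        by (subst reg, rule SUP_least) (auto simp: \<mu>.emeasure_eq_measure intro!: ennreal_leI less[THEN less_imp_le])
      moreover have "0 \<le> measure \<mu> A - \<epsilon>" using less[of "{}"] by simp
      ultimately show False using \<epsilon> unfolding \<mu>.emeasure_eq_measure by simp
    qed
    then obtain K where K: "K \<subseteq> A" "compact K" "measure \<mu> A \<le> measure \<mu> K + \<epsilon>"
      by (auto simp: algebra_simps)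
    note K(3)
    moreover have "measure \<nu> K \<le> measure \<nu> A"
      by (rule \<nu>.finite_measure_mono) (use K sets A in auto)
    ultimately show "measure \<mu> A - measure \<nu> A \<le> T + \<epsilon>" using cpt[OF K(2)] by linarith
  qed
qed

text \<open>Integrating twice gives a quadratic bound for the first derivative, in which the linear term is
  absorbed by \<open>2 * \<bar>z\<bar> \<le> 1 + z\<^sup>2\<close>; the oscillation is then at most that of a primitive of this
  bound.\<close>

lemma cubic_oscillation:
  fixes \<phi> \<phi>' \<phi>'' \<phi>''' :: "real \<Rightarrow> real"
  assumes d1: "\<And>x. (\<phi> has_real_derivative \<phi>' x) (at x)"
    and d2: "\<And>x. (\<phi>' has_real_derivative \<phi>'' x) (at x)"
    and d3: "\<And>x. (\<phi>'' has_real_derivative \<phi>''' x) (at x)"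
    and B: "\<And>x. \<bar>\<phi>''' x\<bar> \<le> B"
  defines "\<alpha> \<equiv> \<bar>\<phi>' 0\<bar> + \<bar>\<phi>'' 0\<bar> / 2" and "\<beta> \<equiv> (\<bar>\<phi>'' 0\<bar> / 2 + B) / 3"
  shows "\<bar>\<phi> y - \<phi> x\<bar> \<le> \<alpha> * \<bar>y - x\<bar> + \<beta> * \<bar>y ^ 3 - x ^ 3\<bar>"
proof -
  have B0: "B \<ge> 0" using B[of 0] by linarith
  have b2: "\<bar>\<phi>'' z\<bar> \<le> \<bar>\<phi>'' 0\<bar> + B * \<bar>z\<bar>" for z
    using mean_value_bound[OF d3 B, of z] by linarith
  have b1: "\<bar>\<phi>' z\<bar> \<le> \<alpha> + 3 * \<beta> * z\<^sup>2" for z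
  proof -
    have *: "\<bar>\<phi>'' w\<bar> \<le> \<bar>\<phi>'' 0\<bar> + B * \<bar>z\<bar>" if "\<bar>w\<bar> \<le> \<bar>z\<bar>" for w
      using b2[of w] mult_left_mono[OF that B0] by linarith
    have "\<bar>\<phi>' z - \<phi>' 0\<bar> \<le> (\<bar>\<phi>'' 0\<bar> + B * \<bar>z\<bar>) * \<bar>z\<bar>" by (rule mean_value_bound[OF d2 *])
    then have "\<bar>\<phi>' z\<bar> \<le> \<bar>\<phi>' 0\<bar> + (\<bar>\<phi>'' 0\<bar> + B * \<bar>z\<bar>) * \<bar>z\<bar>" by linarith
    also have "\<dots> = \<bar>\<phi>' 0\<bar> + \<bar>\<phi>'' 0\<bar> * \<bar>z\<bar> + B * z\<^sup>2"
      by (simp add: distrib_right mult.assoc power2_eq_square)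
    also have "\<dots> \<le> \<bar>\<phi>' 0\<bar> + \<bar>\<phi>'' 0\<bar> * ((1 + z\<^sup>2) / 2) + B * z\<^sup>2"
    proof (intro add_mono mult_left_mono order_refl)
      show "\<bar>z\<bar> \<le> (1 + z\<^sup>2) / 2" using zero_le_power2[of "1 - \<bar>z\<bar>"] by (simp add: power2_diff)
    qed (use B0 in simp_all)
    also have "\<dots> = \<alpha> + 3 * \<beta> * z\<^sup>2" by (simp add: \<alpha>_def \<beta>_def field_simps)
    finally show ?thesis .
  qed
  have mono: "\<bar>\<phi> y - \<phi> x\<bar> \<le> \<alpha> * \<bar>y - x\<bar> + \<beta> * \<bar>y ^ 3 - x ^ 3\<bar>" if "x \<le> y" for x y
  proof -
    let ?M = "\<lambda>z. \<alpha> * z + \<beta> * z ^ 3"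
    have M: "(?M has_real_derivative \<alpha> + 3 * \<beta> * z\<^sup>2) (at z)" for z
    proof -
      have "(?M has_real_derivative \<alpha> * 1 + \<beta> * (3 * z\<^sup>2)) (at z)"
        using DERIV_pow[of 3 z] by (intro DERIV_add DERIV_cmult DERIV_ident) simp
      then show ?thesis by (simp add: mult_ac)
    qed
    have "?M x - \<phi> x \<le> ?M y - \<phi> y"
    proof (rule DERIV_nonneg_imp_nondecreasing[OF that])
      fix z
      have "((\<lambda>z. ?M z - \<phi> z) has_real_derivative (\<alpha> + 3 * \<beta> * z\<^sup>2) - \<phi>' z) (at z)"
        by (intro DERIV_diff M d1)
      moreover have "(\<alpha> + 3 * \<beta> * z\<^sup>2) - \<phi>' z \<ge> 0" using b1[of z] by linarith
      ultimately show "\<exists>D. ((\<lambda>z. ?M z - \<phi> z) has_real_derivative D) (at z) \<and> 0 \<le> D" by blast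
    qed
    moreover have "?M x + \<phi> x \<le> ?M y + \<phi> y"
    proof (rule DERIV_nonneg_imp_nondecreasing[OF that])
      fix z
      have "((\<lambda>z. ?M z + \<phi> z) has_real_derivative (\<alpha> + 3 * \<beta> * z\<^sup>2) + \<phi>' z) (at z)"
        by (intro DERIV_add M d1)
      moreover have "(\<alpha> + 3 * \<beta> * z\<^sup>2) + \<phi>' z \<ge> 0" using b1[of z] by linarith
      ultimately show "\<exists>D. ((\<lambda>z. ?M z + \<phi> z) has_real_derivative D) (at z) \<and> 0 \<le> D" by blast
    qed
    ultimately have "\<bar>\<phi> y - \<phi> x\<bar> \<le> ?M y - ?M x" by linarith
    also have "\<dots> = \<alpha> * \<bar>y - x\<bar> + \<beta> * \<bar>y ^ 3 - x ^ 3\<bar>"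
      using that power_mono_odd[of 3 x y] by (simp add: algebra_simps)
    finally show ?thesis .
  qed
  show ?thesis
    using mono[of x y] mono[of y x] by (cases "x \<le> y") (auto simp: abs_minus_commute)
qed

context chaos_element
begin

lemma lipschitz_mean_bound:
  fixes g :: "real \<Rightarrow> real"
  assumes unit: "(\<integral>\<omega>. (F \<omega>)\<^sup>2 \<partial>M) = 1" and g: "L-lipschitz_on UNIV g"
    and \<alpha>: "\<And>y. \<bar>stein_deriv g y\<bar> \<le> \<alpha>"
  shows "\<bar>(\<integral>\<omega>. g (F \<omega>) \<partial>M) - (\<integral>y. g y \<partial>gauss)\<bar> \<le> \<alpha> * stein_discrepancy d a"
proof -
  have L: "L \<ge> 0" using g by (rule lipschitz_on_nonneg)
  have lip: "\<bar>g x - g y\<bar> \<le> L * ((1 + x\<^sup>2 + y\<^sup>2) * \<bar>x - y\<bar>)" for x y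
  proof -
    have "\<bar>g x - g y\<bar> \<le> L * (1 * \<bar>x - y\<bar>)"
      using lipschitz_onD[OF g, of x y] by (simp add: dist_real_def)
    also have "\<dots> \<le> L * ((1 + x\<^sup>2 + y\<^sup>2) * \<bar>x - y\<bar>)" by (intro mult_left_mono mult_right_mono L) auto
    finally show ?thesis .
  qed
  have bd: "\<bar>stein_deriv g y\<bar> \<le> \<alpha> + 0 * \<bar>y\<bar>" for y using \<alpha> by simp
  have "\<alpha> \<ge> 0" using \<alpha>[of 0] by linarith
  from stein_bound[OF unit lipschitz_on_continuous_on[OF g] lip L bd this order_refl]
  show ?thesis by simp
qed

text \<open>The one-sided bound for sets is applied to A and to its complement.\<close>

lemma total_variation_bound:
  assumes unit: "(\<integral>\<omega>. (F \<omega>)\<^sup>2 \<partial>M) = 1" and A: "A \<in> sets borel"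
  shows "\<bar>measure (distr M borel F) A - measure gauss A\<bar> \<le> 2 * stein_discrepancy d a"
proof -
  let ?\<mu> = "distr M borel F" and ?T = "stein_discrepancy d a"
  have p\<mu>: "prob_space ?\<mu>" by (rule prob_space_distr) measurable
  have bound: "\<bar>(\<integral>y. g y \<partial>?\<mu>) - (\<integral>y. g y \<partial>gauss)\<bar> \<le> 2 * ?T"
    if g: "L-lipschitz_on UNIV g" and g01: "\<And>y. 0 \<le> g y \<and> g y \<le> 1" for L g
  proof -
    have gm [measurable]: "g \<in> borel_measurable borel"
      by (intro borel_measurable_continuous_onI lipschitz_on_continuous_on[OF g])
    interpret gauss: prob_space gauss by (rule prob_space_gauss)
    have ig: "integrable gauss g"
      by (rule gauss.integrable_const_bound[of _ 1]) (use g01 in auto)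
    have "0 \<le> (\<integral>y. g y \<partial>gauss)" by (rule Bochner_Integration.integral_nonneg) (use g01 in auto)
    moreover have "(\<integral>y. g y \<partial>gauss) \<le> 1"
      using integral_mono[OF ig gauss.integrable_const[of 1]] g01 gauss.prob_space by simp
    ultimately have "\<bar>g y - (\<integral>y. g y \<partial>gauss)\<bar> \<le> 1" for y using g01[of y] by linarith
    from lipschitz_mean_bound[OF unit g stein_deriv_bound_bounded[OF ig this]]
    show ?thesis by (simp add: integral_distr)
  qed
  have up: "measure ?\<mu> A - measure gauss A \<le> 2 * ?T" if "A \<in> sets borel" for A
    by (rule setwise_bound_from_lipschitz[OF p\<mu> prob_space_gauss _ _ _ that])
      (use bound in \<open>auto simp: abs_le_iff\<close>)
  have "measure ?\<mu> (UNIV - A) = 1 - measure ?\<mu> A" "measure gauss (UNIV - A) = 1 - measure gauss A"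
    using prob_space.prob_compl[OF p\<mu>, of A] prob_space.prob_compl[OF prob_space_gauss, of A] A by auto
  moreover have "UNIV - A \<in> sets borel" using A by auto
  ultimately show ?thesis using up[OF A] up[of "UNIV - A"] by linarith
qed

text \<open>The derivative of the Stein solution grows linearly, with slope \<open>4 * \<beta>\<close> and constant term
  \<open>\<alpha> + 3 * \<beta>\<close>, where \<open>\<alpha>\<close> and \<open>\<beta>\<close> come from the cubic bound for the oscillation. Since F has unit
  second moment, its L2 norm at F is at most the sum of the two.\<close>

lemma smooth_mean_bound:
  fixes \<phi> \<phi>' \<phi>'' \<phi>''' :: "real \<Rightarrow> real"
  assumes unit: "(\<integral>\<omega>. (F \<omega>)\<^sup>2 \<partial>M) = 1"
    and d1: "\<And>x. (\<phi> has_real_derivative \<phi>' x) (at x)"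
    and d2: "\<And>x. (\<phi>' has_real_derivative \<phi>'' x) (at x)"
    and d3: "\<And>x. (\<phi>'' has_real_derivative \<phi>''' x) (at x)"
    and B: "\<And>x. \<bar>\<phi>''' x\<bar> \<le> B"
  shows "\<bar>(\<integral>\<omega>. \<phi> (F \<omega>) \<partial>M) - (\<integral>y. \<phi> y \<partial>gauss)\<bar>
    \<le> (\<bar>\<phi>' 0\<bar> + 5 / 3 * \<bar>\<phi>'' 0\<bar> + 7 / 3 * B) * stein_discrepancy d a"
proof -
  define \<alpha> where "\<alpha> = \<bar>\<phi>' 0\<bar> + \<bar>\<phi>'' 0\<bar> / 2"
  define \<beta> where "\<beta> = (\<bar>\<phi>'' 0\<bar> / 2 + B) / 3"
  have B0: "B \<ge> 0" using B[of 0] by linarith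
  have ab: "\<alpha> \<ge> 0" "\<beta> \<ge> 0" using B0 by (auto simp: \<alpha>_def \<beta>_def)
  have osc: "\<bar>\<phi> y - \<phi> x\<bar> \<le> \<alpha> * \<bar>y - x\<bar> + \<beta> * \<bar>y ^ 3 - x ^ 3\<bar>" for x y
    unfolding \<alpha>_def \<beta>_def by (rule cubic_oscillation[OF d1 d2 d3 B])
  have cphi: "continuous_on UNIV \<phi>"
    using d1 by (meson DERIV_continuous continuous_at_imp_continuous_on)
  have lip: "\<bar>\<phi> x - \<phi> y\<bar> \<le> (\<alpha> + 2 * \<beta>) * ((1 + x\<^sup>2 + y\<^sup>2) * \<bar>x - y\<bar>)" for x y
  proof -
    let ?w = "(1 + x\<^sup>2 + y\<^sup>2) * \<bar>x - y\<bar>"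
    have "x ^ 3 - y ^ 3 = (x\<^sup>2 + x * y + y\<^sup>2) * (x - y)"
      by (simp add: power2_eq_square power3_eq_cube algebra_simps)
    then have "\<bar>x ^ 3 - y ^ 3\<bar> = \<bar>x\<^sup>2 + x * y + y\<^sup>2\<bar> * \<bar>x - y\<bar>" by (simp add: abs_mult)
    also have "\<dots> \<le> 2 * (1 + x\<^sup>2 + y\<^sup>2) * \<bar>x - y\<bar>"
    proof (rule mult_right_mono)
      have aux: "\<bar>p + m + q\<bar> \<le> 2 * (1 + p + q)" if "2 * \<bar>m\<bar> \<le> p + q" "0 \<le> p + q" for p q m :: real
        using that by (simp add: abs_le_iff)
      have "2 * \<bar>x * y\<bar> \<le> x\<^sup>2 + y\<^sup>2"
        using sum_squares_bound[of "\<bar>x\<bar>" "\<bar>y\<bar>"] by (simp add: abs_mult)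
      then show "\<bar>x\<^sup>2 + x * y + y\<^sup>2\<bar> \<le> 2 * (1 + x\<^sup>2 + y\<^sup>2)" by (rule aux) simp
    qed simp
    finally have cube: "\<bar>x ^ 3 - y ^ 3\<bar> \<le> 2 * ?w" by (simp only: mult.assoc)
    have "1 * \<bar>x - y\<bar> \<le> ?w" by (intro mult_right_mono) auto
    then have lin: "\<bar>x - y\<bar> \<le> ?w" by simp
    have "\<bar>\<phi> x - \<phi> y\<bar> \<le> \<alpha> * \<bar>x - y\<bar> + \<beta> * \<bar>x ^ 3 - y ^ 3\<bar>" by (rule osc)
    also have "\<dots> \<le> \<alpha> * ?w + \<beta> * (2 * ?w)" by (intro add_mono mult_left_mono lin cube ab)
    finally show ?thesis by (simp add: algebra_simps)
  qed
  have growth: "\<bar>\<phi> y\<bar> \<le> (\<bar>\<phi> 0\<bar> + \<alpha> + \<beta>) * (1 + \<bar>y\<bar>) ^ 3" for y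
  proof -
    have "\<bar>\<phi> y\<bar> \<le> \<bar>\<phi> 0\<bar> * 1 + \<alpha> * \<bar>y\<bar> + \<beta> * \<bar>y\<bar> ^ 3"
      using osc[of y 0] by (simp add: power_abs)
    also have "\<dots> \<le> \<bar>\<phi> 0\<bar> * (1 + \<bar>y\<bar>) ^ 3 + \<alpha> * (1 + \<bar>y\<bar>) ^ 3 + \<beta> * (1 + \<bar>y\<bar>) ^ 3"
      using ab self_le_power[of "1 + \<bar>y\<bar>" 3]
      by (intro add_mono mult_left_mono power_mono) (auto simp: one_le_power)
    finally show ?thesis by (simp add: algebra_simps)
  qed
  have pm: "\<phi> \<in> borel_measurable borel" by (rule borel_measurable_continuous_onI[OF cphi])
  have ig: "integrable gauss \<phi>" by (rule integrable_gauss_poly_growth[OF pm growth])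
  have bd: "\<bar>stein_deriv \<phi> y\<bar> \<le> (\<alpha> + 3 * \<beta>) + 4 * \<beta> * \<bar>y\<bar>" for y
    using stein_deriv_bound[OF ig ab osc, of y] by (simp add: algebra_simps)
  have "\<bar>(\<integral>\<omega>. \<phi> (F \<omega>) \<partial>M) - (\<integral>y. \<phi> y \<partial>gauss)\<bar> \<le> (\<alpha> + 3 * \<beta> + 4 * \<beta>) * stein_discrepancy d a"
    by (rule stein_bound[OF unit cphi lip _ bd]) (use ab in auto)
  also have "\<alpha> + 3 * \<beta> + 4 * \<beta> = \<bar>\<phi>' 0\<bar> + 5 / 3 * \<bar>\<phi>'' 0\<bar> + 7 / 3 * B"
    by (simp add: \<alpha>_def \<beta>_def field_simps)
  finally show ?thesis .
qed

end

theorem theorem3p1: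
  fixes e :: "nat \<Rightarrow> 'h :: {real_inner, complete_space}"
    and M :: "'a measure" and G :: "nat \<Rightarrow> 'a \<Rightarrow> real"
    and N :: "'b measure" and Z :: "'b \<Rightarrow> real"
    and d :: nat and h :: "'h form" and F :: "'a \<Rightarrow> real"
  assumes basis: "orthonormal_basis e"
    and M: "prob_space M"
    and G_indep: "prob_space.indep_vars M (\<lambda>_. borel) G UNIV"
    and G_normal: "\<And>i. distributed M lborel (G i) std_normal_density"
    and N: "prob_space N"
    and Z_normal: "distributed N lborel Z std_normal_density"
    and d: "d \<ge> 2"
    and h: "h \<in> sym_tensor_power e d"
    and F: "is_multiple_integral M G e d h F"
    and F_var: "(\<integral>\<omega>. (F \<omega>)\<^sup>2 \<partial>M) = 1"
  shows "T1 e d h \<le> T2 M d F \<and>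
    tv_distance M F N Z \<le> 2 * T1 e d h \<and>
    wasserstein_distance M F N Z \<le> ereal (T1 e d h) \<and>
    (\<forall>\<phi> \<phi>' \<phi>'' \<phi>''' :: real \<Rightarrow> real.
       (\<forall>x. (\<phi> has_real_derivative \<phi>' x) (at x)) \<longrightarrow>
       (\<forall>x. (\<phi>' has_real_derivative \<phi>'' x) (at x)) \<longrightarrow>
       (\<forall>x. (\<phi>'' has_real_derivative \<phi>''' x) (at x)) \<longrightarrow>
       bounded (range \<phi>''') \<longrightarrow>
       \<bar>(\<integral>\<omega>. \<phi> (F \<omega>) \<partial>M) - (\<integral>\<omega>. \<phi> (Z \<omega>) \<partial>N)\<bar>
         \<le> 4 * sqrt 2 * (1 + 5 powr (3 * real d / 2)) *
           max (3 / 2 * \<bar>\<phi>'' 0\<bar> + (SUP x. \<bar>\<phi>''' x\<bar>) / 3 * (2 * sqrt 2 / sqrt pi))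
               (2 * \<bar>\<phi>' 0\<bar> + 1 / 3 * (SUP x. \<bar>\<phi>''' x\<bar>)) *
           T1 e d h)"
proof -
  interpret gaussian_sequence M G
    using M G_indep G_normal by (simp add: gaussian_sequence_def gaussian_sequence_axioms_def)
  let ?a = "\<lambda>is. h (map e is)" and ?T = "T1 e d h"
  from F obtain c where measF: "F \<in> borel_measurable M" and sqF: "integrable M (\<lambda>\<omega>. (F \<omega>)\<^sup>2)"
    and lh: "((\<lambda>A. tensor_norm e d (\<lambda>xs. h xs - (\<Sum>q\<in>A. c q * sym_basis_tensor e d q xs)))
           \<longlongrightarrow> 0) (finite_subsets_at_top (multi_indices d))"
    and lF: "((\<lambda>A. \<integral>\<omega>. (F \<omega> - (\<Sum>q\<in>A. c q * hermite_product G q \<omega>))\<^sup>2 \<partial>M)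
           \<longlongrightarrow> 0) (finite_subsets_at_top (multi_indices d))"
    unfolding is_multiple_integral_def by blast
  have norm_eq: "tensor_norm e d (\<lambda>xs. h xs - (\<Sum>q\<in>A. c q * sym_basis_tensor e d q xs))
      = l2 d (\<lambda>is. ?a is - basis_combination d c A is)" if "A \<subseteq> multi_indices d" for A
    unfolding tensor_norm_eq_l2 basis_combination_def
    using that by (intro l2_cong arg_cong2[where f = "(-)"] refl sum.cong) (auto simp: sym_basis_tensor_basis[OF basis])
  interpret chaos_element M G d c ?a F
  proof unfold_locales
    show "1 \<le> d" using d by simp
    have "(\<lambda>is. (h (map e is))\<^sup>2) summable_on {is. length is = d}"
      using h by (simp add: sym_tensor_power_def tensor_power_def)
    then show "sq_summable d ?a" by (simp add: sq_summable_def)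
    show "((\<lambda>A. l2 d (\<lambda>is. ?a is - basis_combination d c A is)) \<longlongrightarrow> 0) (finite_subsets_at_top (multi_indices d))"
      by (rule Lim_transform_eventually[OF lh])
        (auto intro!: eventually_finite_subsets_at_top_weakI norm_eq)
    show "((\<lambda>A. \<integral>\<omega>. (F \<omega> - partial_sum c A \<omega>)\<^sup>2 \<partial>M) \<longlongrightarrow> 0) (finite_subsets_at_top (multi_indices d))"
      using lF by (simp add: partial_sum_def)
  qed (use measF sqF in auto)
  have T: "?T = stein_discrepancy d ?a" by (rule T1_eq_stein_discrepancy)
  have T0: "?T \<ge> 0" unfolding T by (rule stein_discrepancy_nonneg)
  have first: "?T \<le> T2 M d F"
  proof -
    have "?T\<^sup>2 \<le> (real d - 1) / (3 * real d) * ((\<integral>\<omega>. (F \<omega>) ^ 4 \<partial>M) - 3)"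
      using fourth_moment_bound by (simp add: T F_var)
    also have "\<dots> \<le> (real d - 1) / (3 * real d) * \<bar>(\<integral>\<omega>. (F \<omega>) ^ 4 \<partial>M) - 3\<bar>"
      using d by (intro mult_left_mono) auto
    finally show ?thesis unfolding T2_def by (rule real_le_rsqrt)
  qed
  have W: "wasserstein_distance M F N Z \<le> ereal ?T"
    unfolding wasserstein_distance_def
  proof (rule SUP_least)
    fix g :: "real \<Rightarrow> real" assume "g \<in> {g. 1-lipschitz_on UNIV g}"
    then have g: "1-lipschitz_on UNIV g" by simp
    have gm: "g \<in> borel_measurable borel"
      by (intro borel_measurable_continuous_onI lipschitz_on_continuous_on[OF g])
    show "ereal \<bar>(\<integral>\<omega>. g (F \<omega>) \<partial>M) - (\<integral>\<omega>. g (Z \<omega>) \<partial>N)\<bar> \<le> ereal ?T"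
      using lipschitz_mean_bound[OF F_var g lipschitz_stein_deriv_bound[OF g]]
      unfolding integral_standard_normal[OF Z_normal gm] T by simp
  qed
  have TV: "tv_distance M F N Z \<le> 2 * ?T"
  proof -
    let ?\<mu> = "distr M borel F"
    have Zm: "Z \<in> borel_measurable N" using Z_normal by (simp add: distributed_def)
    have "distr N borel Z = distr N lborel Z" by (rule distr_cong) auto
    then have Zg: "distr N borel Z = gauss" using Z_normal by (simp add: distributed_def gauss_def)
    show ?thesis
      unfolding tv_distance_def
    proof (rule cSUP_least)
      fix A :: "real set" assume A: "A \<in> sets borel"
      have "measure ?\<mu> A = measure M (F -` A \<inter> space M)" by (rule measure_distr[OF measF A])
      moreover have "measure gauss A = measure N (Z -` A \<inter> space N)"
        unfolding Zg[symmetric] by (rule measure_distr[OF Zm A])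
      ultimately show "\<bar>measure M (F -` A \<inter> space M) - measure N (Z -` A \<inter> space N)\<bar> \<le> 2 * ?T"
        using total_variation_bound[OF F_var A] by (simp add: T)
    qed auto
  qed
  have smooth: "\<bar>(\<integral>\<omega>. \<phi> (F \<omega>) \<partial>M) - (\<integral>\<omega>. \<phi> (Z \<omega>) \<partial>N)\<bar>
         \<le> 4 * sqrt 2 * (1 + 5 powr (3 * real d / 2)) *
           max (3 / 2 * \<bar>\<phi>'' 0\<bar> + (SUP x. \<bar>\<phi>''' x\<bar>) / 3 * (2 * sqrt 2 / sqrt pi))
               (2 * \<bar>\<phi>' 0\<bar> + 1 / 3 * (SUP x. \<bar>\<phi>''' x\<bar>)) * ?T"
    if d1: "\<And>x. (\<phi> has_real_derivative \<phi>' x) (at x)"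
      and d2: "\<And>x. (\<phi>' has_real_derivative \<phi>'' x) (at x)"
      and d3: "\<And>x. (\<phi>'' has_real_derivative \<phi>''' x) (at x)"
      and bdd: "bounded (range \<phi>''')" for \<phi> \<phi>' \<phi>'' \<phi>''' :: "real \<Rightarrow> real"
  proof -
    define B where "B = (SUP x. \<bar>\<phi>''' x\<bar>)"
    obtain K where K: "\<And>x. \<bar>\<phi>''' x\<bar> \<le> K" using bdd by (auto simp: bounded_iff)
    have B: "\<bar>\<phi>''' x\<bar> \<le> B" for x
      unfolding B_def by (rule cSUP_upper) (auto intro!: bdd_aboveI2[of _ _ K] K)
    have B0: "B \<ge> 0" using B[of 0] by linarith
    let ?K = "\<bar>\<phi>' 0\<bar> + 5 / 3 * \<bar>\<phi>'' 0\<bar> + 7 / 3 * B"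
    have pm: "\<phi> \<in> borel_measurable borel"
      using d1 by (intro borel_measurable_continuous_onI) (meson DERIV_continuous continuous_at_imp_continuous_on)
    have main: "\<bar>(\<integral>\<omega>. \<phi> (F \<omega>) \<partial>M) - (\<integral>\<omega>. \<phi> (Z \<omega>) \<partial>N)\<bar> \<le> ?K * ?T"
      unfolding integral_standard_normal[OF Z_normal pm] T by (rule smooth_mean_bound[OF F_var d1 d2 d3 B])
    let ?m = "max (3 / 2 * \<bar>\<phi>'' 0\<bar> + B / 3 * (2 * sqrt 2 / sqrt pi)) (2 * \<bar>\<phi>' 0\<bar> + 1 / 3 * B)"
    have c1: "5 \<le> 4 * sqrt 2"
      using real_le_rsqrt[of "5 / 4" 2] by (simp add: power2_eq_square)
    have c2: "1 \<le> 5 powr (3 * real d / 2)" by (rule ge_one_powr_ge_zero) auto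
    have c3: "1 \<le> 2 * sqrt 2 / sqrt pi"
    proof -
      have "sqrt pi \<le> sqrt (4 * 2)" using pi_less_4 by (intro real_sqrt_le_mono) simp
      then show ?thesis unfolding real_sqrt_mult by (simp add: le_divide_eq)
    qed
    (* The maximum of two numbers is at least their mean, and the factor in front of it at least 10. *)
    have "?K \<le> 10 * ((3 / 2 * \<bar>\<phi>'' 0\<bar> + B / 3 * 1) / 2 + (2 * \<bar>\<phi>' 0\<bar> + 1 / 3 * B) / 2)"
      using B0 by (simp add: field_simps)
    also have "\<dots> \<le> 10 * ?m"
    proof -
      have "B / 3 * 1 \<le> B / 3 * (2 * sqrt 2 / sqrt pi)" using B0 c3 by (intro mult_left_mono) auto
      moreover have "10 * ((u + p) / 2 + v / 2) \<le> 10 * max (u + q) v" if "p \<le> q" for u v p q :: real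
        using that by (cases "u + q \<le> v") (simp_all add: max_def field_simps)
      ultimately show ?thesis by blast
    qed
    also have "\<dots> \<le> (4 * sqrt 2 * (1 + 5 powr (3 * real d / 2))) * ?m"
    proof (rule mult_right_mono)
      have "5 * 2 \<le> 4 * sqrt 2 * (1 + 5 powr (3 * real d / 2))" using c1 c2 by (intro mult_mono) auto
      then show "10 \<le> 4 * sqrt 2 * (1 + 5 powr (3 * real d / 2))" by simp
      have "0 \<le> 2 * \<bar>\<phi>' 0\<bar> + 1 / 3 * B" using B0 by simp
      then show "0 \<le> ?m" by (simp add: le_max_iff_disj)
    qed
    finally have "?K * ?T \<le> (4 * sqrt 2 * (1 + 5 powr (3 * real d / 2))) * ?m * ?T"
      using T0 by (rule mult_right_mono)
    from order_trans[OF main this] show ?thesis unfolding B_def .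
  qed
  show ?thesis using first W TV smooth by blast
qed

end
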